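(* Let $\mathcal F$ be the Farey tree. There is an exact sequence $$1\to \mathsf{Sym}^{\pm}(\mathsf{PSL}_2(\mathbb Z))\to \mathsf{PMG}(\mathcal F)\xrightarrow{\ \gamma\ }\mathsf{Aut}^\infty(\mathcal F)\to 1,$$ where $\mathsf{PMG}(\mathcal F)$ is the isotropy group of a labeled Farey tree $|\mathcal F,\ell|$ in the fundamental modular groupoid $\mathbf{\Pi MG}$, $\mathsf{Aut}^\infty(\mathcal F)$ is the group of partial $\mathcal F$-automorphisms, and $\gamma$ is the germification map, i.e. the map sending an element of $\mathsf{PMG}(\mathcal F)$, viewed as a permutation of $E(\mathcal F)$ (which is a ribbon graph near-automorphism of $\mathcal F$), to its germ.
   Context: **Modular graphs.** A modular graph is a connected bipartite ribbon graph $\mathcal G$ in which every edge joins a vertex of degree 2 to a vertex of degree 3 (multiple edges allowed); ribbon structure means a cyclic (counterclockwise) order of the edges at each vertex. Two edges sharing a degree-2 vertex are called twins. **Farey tree.** $\mathsf{PSL}_2(\mathbb Z)=\langle S\rangle*\langle L\rangle\cong \mathbb Z/2*\mathbb Z/3$ with $S(z)=-1/z$, $L(z)=(z-1)/z$. $\mathcal F$ is the modular graph with edges $\{W\}$, $W\in\mathsf{PSL}_2(\mathbb Z)$, degree-2 vertices $\{W,WS\}$ and degree-3 vertices $\{W,WL,WL^2\}$ (with this cyclic order), an edge being incident to the vertices containing $W$. It is a planar tree; $E(\mathcal F)$ is identified with $\mathsf{PSL}_2(\mathbb Z)$ and the twin of $W$ is $WS$. **Labelings, flips, relabelings.** A labeling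 of $\mathcal F$ (and similarly of any infinite modular graph) is a bijection $\ell:E(\mathcal F)\to\mathbb N\times\{+,-\}$ such that twins carry labels $(k,+),(k,-)$ for some $k$. Let $f$ be an edge of a labeled modular graph $(\mathcal G,\ell)$ with twin $e$. If $e,f$ have a second common vertex, the flip at $f$ does nothing. Otherwise let the degree-3 vertices of $f$ and $e$ have cyclic orders $(f,a,b)$ and $(e,d,c)$. The flip produces $(\mathcal G',\ell')$ by replacing these two vertices by degree-3 vertices with cyclic orders $(e',c',a')$ and $(f',b',d')$, keeping $e',f'$ twins and leaving all else unchanged; $x'$ keeps the label of $x$. A relabeling changes only the labeling, by a permutation of the labels carrying each pair $\{(m,+),(m,-)\}$ to a pair $\{(k,+),(k,-)\}$. **Graph fundamental groupoid.** $\widetilde\Pi_1^{\mathcal G}$ has object set $E(\mathcal G)$, and morphisms the homotopy classes of paths in $\mathcal G$ between midpoints of edges; it is generated by length-2 paths $(x,y)_v$ through a common vertex $v$. A nontrivial flip at $f$ induces the isomorphism $\widetilde\Pi_1^{\mathcal G}\to\widetilde\Pi_1^{\mathcal G'}$ given on objects by $x\mapsto x'$ and on generators by $(a,f)\mapsto(a',e')(e',f')$, $(b,f)\mapsto(b',f')$, $(c,e)\mapsto(c',e')$, $(d,e)\mapsto(d',f')(f',e')$, $(f,e)\mapsto(f',e')$, and $(x,y)_v\mapsto(x',y')_v$ for all vertices $v$ other than the three vertices on $e,f$. Trivial flips and relabelings induce the identity. **$\mathbf{\Pi MG}$ and $\mathsf{PMG}(\mathcal F)$.** The objects of $\mathbf{\Pi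 MG}$ are the labeled modular graphs $|\mathcal G,\ell|$ up to label- and ribbon-structure-preserving isomorphism; morphisms $|\mathcal G_1,\ell_1|\to|\mathcal G_2,\ell_2|$ are the isomorphisms $\widetilde\Pi_1^{\mathcal G_1}\to\widetilde\Pi_1^{\mathcal G_2}$ induced by finite sequences of flips and relabelings. $\mathsf{PMG}(\mathcal F)=\mathrm{Mor}_{\mathbf{\Pi MG}}(|\mathcal F,\ell|,|\mathcal F,\ell|)$ for a fixed labeling $\ell$ (independent of $\ell$ up to isomorphism). Since $\mathcal F$ is simply connected, $\widetilde\Pi_1^{\mathcal F}$ is the pair groupoid on $E(\mathcal F)$, so $\mathsf{Aut}(\widetilde\Pi_1^{\mathcal F})=\mathsf{Sym}(E(\mathcal F))=\mathsf{Sym}(\mathsf{PSL}_2(\mathbb Z))$ and $\mathsf{PMG}(\mathcal F)$ is a subgroup of $\mathsf{Sym}(\mathsf{PSL}_2(\mathbb Z))$. **$\mathsf{Sym}^\pm$.** $\mathsf{Sym}^\pm(\mathsf{PSL}_2(\mathbb Z))$ is the group of permutations $\pi$ of $\mathsf{PSL}_2(\mathbb Z)$ of finite support such that for every $W$ there is $W'$ with $\{\pi(W),\pi(WS)\}=\{W',W'S\}$ (twins go to twins). The first arrow of the sequence is the inclusion inside $\mathsf{Sym}(\mathsf{PSL}_2(\mathbb Z))$. **Near and partial automorphisms.** A ribbon graph near-automorphism of $\mathcal F$ is a bijection $\sigma:E(\mathcal F)\to E(\mathcal F)$, sending twins to twins, for which there are finite subtrees $\mathcal T_1,\mathcal T_2$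 such that $\sigma$ restricts to a ribbon graph isomorphism $\mathcal F\setminus\mathcal T_1\to\mathcal F\setminus\mathcal T_2$ respecting the cyclic orders on the sets of components (branches) of $\mathcal F\setminus\mathcal T_1$, $\mathcal F\setminus\mathcal T_2$ induced by the planar structure (here $\setminus$ removes the vertices and edges of the subtree). Two near-automorphisms are equivalent if they agree on the complement of a finite subtree; the equivalence class is the germ, and $\mathsf{Aut}^\infty(\mathcal F)$ is the group of germs of ribbon graph near-automorphisms. *)

theory Defs
  imports "HOL-Analysis.Determinants" "HOL-Algebra.Coset" "HOL-Algebra.Bij"
begin

section \<open>Modular graphs\<close>

text \<open>
  A connected bipartite ribbon graph whose edges join vertices of degree 2 to vertices of degree 3
  is given by its set of edges together with, for each edge, the next edge counterclockwise at its
  degree-2 vertex (\<open>twin\<close>) and at its degree-3 vertex (\<open>nxt\<close>).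
  A vertex is identified with the set of the edges incident to it: a vertex of degree 2 is an orbit
  of \<open>twin\<close>, a vertex of degree 3 an orbit of \<open>nxt\<close>, and incidence is membership.  Degrees keep the
  two kinds apart and each edge has one vertex of each kind, so nothing is lost, also when there
  are multiple edges.  The values of \<open>twin\<close> and \<open>nxt\<close> outside the edge set are irrelevant.
\<close>

record 'e mgraph =
  Edges :: "'e set"
  twin :: "'e \<Rightarrow> 'e"
  nxt :: "'e \<Rightarrow> 'e"

definition vert2 :: "'e mgraph \<Rightarrow> 'e \<Rightarrow> 'e set" where
  "vert2 G x = {x, twin G x}"

definition vert3 :: "'e mgraph \<Rightarrow> 'e \<Rightarrow> 'e set" where
  "vert3 G x = {x, nxt G x, nxt G (nxt G x)}"

definition Verts :: "'e mgraph \<Rightarrow> 'e set set" where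
  "Verts G = vert2 G ` Edges G \<union> vert3 G ` Edges G"

text \<open>The edge following \<open>x\<close> in the cyclic order at its endpoint \<open>v\<close>.\<close>

definition rot :: "'e mgraph \<Rightarrow> 'e set \<Rightarrow> 'e \<Rightarrow> 'e" where
  "rot G v x = (if v = vert2 G x then twin G x else nxt G x)"

text \<open>
  A path starting at the midpoint of an edge \<open>x\<^sub>0\<close> is coded by the list
  \<open>[(v\<^sub>1,x\<^sub>1),\<dots>,(v\<^sub>n,x\<^sub>n)]\<close>: it passes through the vertex \<open>v\<^sub>1\<close> to the midpoint of \<open>x\<^sub>1\<close>, and so on.
\<close>

type_synonym 'e path = "('e set \<times> 'e) list"

fun is_path :: "'e mgraph \<Rightarrow> 'e \<Rightarrow> 'e path \<Rightarrow> 'e \<Rightarrow> bool" where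
  "is_path G x [] y \<longleftrightarrow> x \<in> Edges G \<and> x = y"
| "is_path G x ((v, z) # p) y \<longleftrightarrow> v \<in> Verts G \<and> x \<in> v \<and> z \<in> v \<and> is_path G z p y"

definition modular_graph :: "'e mgraph \<Rightarrow> bool" where
  "modular_graph G \<longleftrightarrow>
     Edges G \<noteq> {} \<and>
     (\<forall>x\<in>Edges G. twin G x \<in> Edges G \<and> twin G x \<noteq> x \<and> twin G (twin G x) = x) \<and>
     (\<forall>x\<in>Edges G. nxt G x \<in> Edges G \<and> nxt G x \<noteq> x \<and> nxt G (nxt G (nxt G x)) = x) \<and>
     (\<forall>x\<in>Edges G. \<forall>y\<in>Edges G. \<exists>p. is_path G x p y)"

section \<open>The graph fundamental groupoid\<close>

text \<open>
  Homotopy of paths with fixed endpoints is generated by deleting a detour from the midpoint of an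
  edge to one of its endpoints and back, either between two steps (\<open>stay\<close>) or in the
  middle of the passage through a vertex (\<open>shortcut\<close>).
\<close>

inductive reduces :: "'e mgraph \<Rightarrow> 'e \<Rightarrow> 'e path \<Rightarrow> 'e path \<Rightarrow> bool" for G x where
  stay: "is_path G x p y \<Longrightarrow> v \<in> Verts G \<Longrightarrow> y \<in> v \<Longrightarrow> is_path G y q z \<Longrightarrow>
    reduces G x (p @ (v, y) # q) (p @ q)"
| shortcut: "is_path G x p y \<Longrightarrow> v \<in> Verts G \<Longrightarrow> y \<in> v \<Longrightarrow> w \<in> v \<Longrightarrow> w' \<in> v \<Longrightarrow>
    is_path G w' q z \<Longrightarrow>
    reduces G x (p @ (v, w) # (v, w') # q) (p @ (v, w') # q)"

definition homotopic :: "'e mgraph \<Rightarrow> 'e \<Rightarrow> 'e path \<Rightarrow> 'e path \<Rightarrow> bool" where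
  "homotopic G x = equivclp (reduces G x)"

text \<open>A morphism is a homotopy class of paths, each path listed together with its initial edge.\<close>

type_synonym 'e arrow = "('e \<times> 'e path) set"

definition pclass :: "'e mgraph \<Rightarrow> 'e \<Rightarrow> 'e path \<Rightarrow> 'e arrow" where
  "pclass G x p = {(x, q) | q. homotopic G x p q}"

definition Hom :: "'e mgraph \<Rightarrow> 'e \<Rightarrow> 'e \<Rightarrow> 'e arrow set" where
  "Hom G x y = {pclass G x p | p. is_path G x p y}"

definition Arr :: "'e mgraph \<Rightarrow> 'e arrow set" where
  "Arr G = (\<Union>x\<in>Edges G. \<Union>y\<in>Edges G. Hom G x y)"

text \<open>Composition in path order: first \<open>\<alpha>\<close>, then \<open>\<beta>\<close>.\<close>

definition arr_comp :: "'e mgraph \<Rightarrow> 'e arrow \<Rightarrow> 'e arrow \<Rightarrow> 'e arrow" where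
  "arr_comp G \<alpha> \<beta> = (\<Union>(x, p)\<in>\<alpha>. \<Union>(y, q)\<in>\<beta>. pclass G x (p @ q))"

text \<open>
  A morphism of groupoids is the pair of its object map and its arrow map.  Both are taken
  extensional, so that equality of pairs is equality of morphisms.
\<close>

type_synonym 'e gmap = "('e \<Rightarrow> 'e) \<times> ('e arrow \<Rightarrow> 'e arrow)"

definition groupoid_iso :: "'e mgraph \<Rightarrow> 'e mgraph \<Rightarrow> 'e gmap \<Rightarrow> bool" where
  "groupoid_iso G G' \<Phi> \<longleftrightarrow>
     fst \<Phi> \<in> extensional (Edges G) \<and> bij_betw (fst \<Phi>) (Edges G) (Edges G') \<and>
     snd \<Phi> \<in> extensional (Arr G) \<and> bij_betw (snd \<Phi>) (Arr G) (Arr G') \<and>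
     (\<forall>x\<in>Edges G. \<forall>y\<in>Edges G. \<forall>\<alpha>\<in>Hom G x y. snd \<Phi> \<alpha> \<in> Hom G' (fst \<Phi> x) (fst \<Phi> y)) \<and>
     (\<forall>x\<in>Edges G. snd \<Phi> (pclass G x []) = pclass G' (fst \<Phi> x) []) \<and>
     (\<forall>x\<in>Edges G. \<forall>y\<in>Edges G. \<forall>z\<in>Edges G. \<forall>\<alpha>\<in>Hom G x y. \<forall>\<beta>\<in>Hom G y z.
        snd \<Phi> (arr_comp G \<alpha> \<beta>) = arr_comp G' (snd \<Phi> \<alpha>) (snd \<Phi> \<beta>))"

definition gid :: "'e mgraph \<Rightarrow> 'e gmap" where
  "gid G = (restrict id (Edges G), restrict id (Arr G))"

text \<open>First \<open>\<Phi>\<close>, whose source is the groupoid of \<open>G\<close>, then \<open>\<Psi>\<close>.\<close>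

definition gcomp :: "'e mgraph \<Rightarrow> 'e gmap \<Rightarrow> 'e gmap \<Rightarrow> 'e gmap" where
  "gcomp G \<Psi> \<Phi> = (compose (Edges G) (fst \<Psi>) (fst \<Phi>), compose (Arr G) (snd \<Psi>) (snd \<Phi>))"

section \<open>Labelings, flips and relabelings\<close>

datatype sign = Plus | Minus

type_synonym label = "nat \<times> sign"

type_synonym 'e lmgraph = "'e mgraph \<times> ('e \<Rightarrow> label)"

definition labeling :: "'e mgraph \<Rightarrow> ('e \<Rightarrow> label) \<Rightarrow> bool" where
  "labeling G l \<longleftrightarrow> bij_betw l (Edges G) UNIV \<and>
     (\<forall>x\<in>Edges G. \<exists>k. {l x, l (twin G x)} = {(k, Plus), (k, Minus)})"

definition label_iso :: "('e \<Rightarrow> 'e) \<Rightarrow> 'e lmgraph \<Rightarrow> 'e lmgraph \<Rightarrow> bool" where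
  "label_iso \<phi> X Y \<longleftrightarrow>
     bij_betw \<phi> (Edges (fst X)) (Edges (fst Y)) \<and>
     (\<forall>x\<in>Edges (fst X). \<phi> (twin (fst X) x) = twin (fst Y) (\<phi> x) \<and>
        \<phi> (nxt (fst X) x) = nxt (fst Y) (\<phi> x) \<and> snd Y (\<phi> x) = snd X x)"

definition iso_induced :: "('e \<Rightarrow> 'e) \<Rightarrow> 'e mgraph \<Rightarrow> 'e gmap" where
  "iso_induced \<phi> G =
     (restrict \<phi> (Edges G),
      restrict (image (map_prod \<phi> (map (map_prod (image \<phi>) \<phi>)))) (Arr G))"

definition label_perm :: "(label \<Rightarrow> label) \<Rightarrow> bool" where
  "label_perm \<rho> \<longleftrightarrow> bij \<rho> \<and> (\<forall>m. \<exists>k. \<rho> ` {(m, Plus), (m, Minus)} = {(k, Plus), (k, Minus)})"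

definition flip_trivial :: "'e mgraph \<Rightarrow> 'e \<Rightarrow> bool" where
  "flip_trivial G f \<longleftrightarrow> vert3 G f = vert3 G (twin G f)"

text \<open>
  The edge \<open>x'\<close> of the flipped graph is the edge \<open>x\<close> itself, so that the edge set, the twins and the
  labels are unchanged and only the cyclic orders \<open>(f,a,b)\<close>, \<open>(e,d,c)\<close> are replaced by
  \<open>(e,c,a)\<close>, \<open>(f,b,d)\<close>.
\<close>

definition flip :: "'e mgraph \<Rightarrow> 'e \<Rightarrow> 'e mgraph" where
  "flip G f =
     (if flip_trivial G f then G else
      (let e = twin G f; a = nxt G f; b = nxt G a; d = nxt G e; c = nxt G d
       in G\<lparr>nxt := (nxt G)(e := c, c := a, a := e, f := b, b := d, d := f)\<rparr>))"

definition flip_induced :: "'e mgraph \<Rightarrow> 'e \<Rightarrow> 'e gmap \<Rightarrow> bool" where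
  "flip_induced G f \<Phi> \<longleftrightarrow>
     (if flip_trivial G f then \<Phi> = gid G else
      (let G' = flip G f;
           e = twin G f; a = nxt G f; b = nxt G a; d = nxt G e; c = nxt G d;
           u = {e, f}; v = {f, a, b}; w = {e, d, c}; v' = {e, c, a}; w' = {f, b, d}
       in groupoid_iso G G' \<Phi> \<and>
          (\<forall>x\<in>Edges G. fst \<Phi> x = x) \<and>
          snd \<Phi> (pclass G a [(v, f)]) = pclass G' a [(v', e), (u, f)] \<and>
          snd \<Phi> (pclass G b [(v, f)]) = pclass G' b [(w', f)] \<and>
          snd \<Phi> (pclass G c [(w, e)]) = pclass G' c [(v', e)] \<and>
          snd \<Phi> (pclass G d [(w, e)]) = pclass G' d [(w', f), (u, e)] \<and>
          snd \<Phi> (pclass G f [(u, e)]) = pclass G' f [(u, e)] \<and>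
          (\<forall>t\<in>Verts G - {u, v, w}. \<forall>x\<in>t. \<forall>y\<in>t.
             snd \<Phi> (pclass G x [(t, y)]) = pclass G' x [(t, y)])))"

text \<open>
  \<open>induced X Y \<Phi>\<close>: the isomorphism \<open>\<Phi>\<close> is induced by a finite sequence of flips and relabelings
  leading from \<open>X\<close> to \<open>Y\<close>.  Labeled modular graphs count up to isomorphism, so a sequence
  may also pass to an isomorphic labeled graph.
\<close>

inductive induced :: "'e lmgraph \<Rightarrow> 'e lmgraph \<Rightarrow> 'e gmap \<Rightarrow> bool" for X where
  start: "modular_graph (fst X) \<Longrightarrow> labeling (fst X) (snd X) \<Longrightarrow> induced X X (gid (fst X))"
| flip: "induced X (G, l) \<Phi> \<Longrightarrow> f \<in> Edges G \<Longrightarrow> flip_induced G f \<Psi> \<Longrightarrow>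
    induced X (flip G f, l) (gcomp (fst X) \<Psi> \<Phi>)"
| relabel: "induced X (G, l) \<Phi> \<Longrightarrow> label_perm \<rho> \<Longrightarrow> induced X (G, \<rho> \<circ> l) \<Phi>"
| transport: "induced X Y \<Phi> \<Longrightarrow> label_iso \<phi> Y Z \<Longrightarrow>
    induced X Z (gcomp (fst X) (iso_induced \<phi> (fst Y)) \<Phi>)"

text \<open>The isotropy group of an object of the fundamental modular groupoid.\<close>

definition isotropy :: "'e lmgraph \<Rightarrow> 'e gmap monoid" where
  "isotropy X = \<lparr>carrier = {\<Phi>. induced X X \<Phi>}, mult = gcomp (fst X), one = gid (fst X)\<rparr>"

section \<open>The Farey tree\<close>

definition mobius_equiv :: "int^2^2 \<Rightarrow> int^2^2 \<Rightarrow> bool" where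
  "mobius_equiv M N \<longleftrightarrow> det M = 1 \<and> (N = M \<or> N = - M)"

lemma det_uminus_2: "det (- M) = det (M :: int^2^2)"
  by (simp add: det_2)

lemma matrix_uminus_left: "(- M) ** N = - (M ** (N :: int^2^2))"
  by (simp add: matrix_matrix_mult_def vec_eq_iff sum_negf)

lemma matrix_uminus_right: "M ** (- N) = - (M ** (N :: int^2^2))"
  by (simp add: matrix_matrix_mult_def vec_eq_iff sum_negf)

text \<open>The class of a matrix with rows \<open>(a,b)\<close>, \<open>(c,d)\<close> is the map \<open>z \<mapsto> (az+b)/(cz+d)\<close>.\<close>

quotient_type psl2z = "int^2^2" / partial: mobius_equiv
proof (rule part_equivpI)
  show "\<exists>M. mobius_equiv M M"
    by (rule exI[of _ "mat 1"]) (simp add: mobius_equiv_def det_I)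
  show "symp mobius_equiv"
    by (auto simp: symp_def mobius_equiv_def det_uminus_2)
  show "transp mobius_equiv"
    by (auto simp: transp_def mobius_equiv_def)
qed

instantiation psl2z :: monoid_mult
begin

lift_definition one_psl2z :: psl2z is "mat 1"
  by (simp add: mobius_equiv_def det_I)

lift_definition times_psl2z :: "psl2z \<Rightarrow> psl2z \<Rightarrow> psl2z" is "(**)"
  by (auto simp: mobius_equiv_def det_mul matrix_uminus_left matrix_uminus_right)

instance
  by standard (transfer; auto simp: mobius_equiv_def det_mul matrix_mul_assoc)+

end

text \<open>The maps \<open>z \<mapsto> - 1 / z\<close> and \<open>z \<mapsto> (z - 1) / z\<close>.\<close>

lift_definition psl_S :: psl2z is "vector [vector [0, - 1], vector [1, 0]]"
  by (simp add: mobius_equiv_def det_2)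

lift_definition psl_L :: psl2z is "vector [vector [1, - 1], vector [1, 0]]"
  by (simp add: mobius_equiv_def det_2)

definition farey :: "psl2z mgraph" where
  "farey = \<lparr>Edges = UNIV, twin = (\<lambda>W. W * psl_S), nxt = (\<lambda>W. W * psl_L)\<rparr>"

definition PMG :: "(psl2z \<Rightarrow> label) \<Rightarrow> psl2z gmap monoid" where
  "PMG l = isotropy (farey, l)"

section \<open>Permutations preserving twins\<close>

definition sym_pm :: "(psl2z \<Rightarrow> psl2z) set" where
  "sym_pm = {\<pi>. bij \<pi> \<and> finite {W. \<pi> W \<noteq> W} \<and> (\<forall>W. \<exists>W'. {\<pi> W, \<pi> (W * psl_S)} = {W', W' * psl_S})}"

definition Sym_pm :: "(psl2z \<Rightarrow> psl2z) monoid" where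
  "Sym_pm = (BijGroup UNIV)\<lparr>carrier := sym_pm\<rparr>"

text \<open>
  The identification of permutations of the edges of the Farey tree with automorphisms of its
  fundamental groupoid, where there is exactly one arrow between any two objects.
\<close>

definition perm_to_auto :: "(psl2z \<Rightarrow> psl2z) \<Rightarrow> psl2z gmap" where
  "perm_to_auto \<pi> =
     (\<pi>, \<lambda>\<alpha>\<in>Arr farey. THE \<beta>. \<exists>x y. \<alpha> \<in> Hom farey x y \<and> \<beta> \<in> Hom farey (\<pi> x) (\<pi> y))"

section \<open>Near-automorphisms and germs\<close>

text \<open>
  A subtree is given by its vertices and edges; in the Farey tree it is the same as a connected
  subgraph.
\<close>

type_synonym 'e subgraph = "'e set set \<times> 'e set"

definition finite_subtree :: "'e mgraph \<Rightarrow> 'e subgraph \<Rightarrow> bool" where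
  "finite_subtree G T \<longleftrightarrow>
     fst T \<subseteq> Verts G \<and> snd T \<subseteq> Edges G \<and> fst T \<noteq> {} \<and> finite (fst T) \<and> finite (snd T) \<and>
     (\<forall>x\<in>snd T. \<forall>v\<in>Verts G. x \<in> v \<longrightarrow> v \<in> fst T) \<and>
     (\<forall>u\<in>fst T. \<forall>v\<in>fst T. (u, v) \<in> {(s, t). \<exists>x\<in>snd T. s \<in> fst T \<and> t \<in> fst T \<and> x \<in> s \<and> x \<in> t}\<^sup>*)"

text \<open>
  Removing the vertices and edges of \<open>T\<close> keeps the edges that are not in \<open>T\<close> but have one endpoint
  in \<open>T\<close>; such an edge is left with its other endpoint only, and every remaining vertex keeps all
  its edges.  In a tree each branch contains exactly one of these edges.
\<close>

definition branches :: "'e mgraph \<Rightarrow> 'e subgraph \<Rightarrow> 'e set set" where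
  "branches G T =
     (Edges G - snd T) //
       {(x, y). x \<in> Edges G - snd T \<and> y \<in> Edges G - snd T \<and>
          (x, y) \<in> {(z, z'). \<exists>v\<in>Verts G - fst T. z \<in> v \<and> z' \<in> v}\<^sup>*}"

text \<open>
  Walking around \<open>T\<close>: coming along the edge \<open>x\<close> to the vertex \<open>v\<close> of \<open>T\<close>, turn into the next edge
  at \<open>v\<close>; if it belongs to \<open>T\<close>, follow it to its other endpoint and continue there,
  otherwise it is the edge reached.
\<close>

inductive contour :: "'e mgraph \<Rightarrow> 'e subgraph \<Rightarrow> 'e set \<Rightarrow> 'e \<Rightarrow> 'e \<Rightarrow> bool" for G T where
  leave: "v \<in> fst T \<Longrightarrow> x \<in> v \<Longrightarrow> rot G v x \<notin> snd T \<Longrightarrow> contour G T v x (rot G v x)"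
| follow: "v \<in> fst T \<Longrightarrow> x \<in> v \<Longrightarrow> rot G v x \<in> snd T \<Longrightarrow> w \<in> fst T \<Longrightarrow> w \<noteq> v \<Longrightarrow> rot G v x \<in> w \<Longrightarrow>
    contour G T w (rot G v x) y \<Longrightarrow> contour G T v x y"

text \<open>\<open>B\<close> is the immediate successor of \<open>A\<close> in the planar cyclic order on the branches.\<close>

definition next_branch :: "'e mgraph \<Rightarrow> 'e subgraph \<Rightarrow> 'e set \<Rightarrow> 'e set \<Rightarrow> bool" where
  "next_branch G T A B \<longleftrightarrow> A \<in> branches G T \<and> B \<in> branches G T \<and>
     (\<exists>v\<in>fst T. \<exists>x\<in>A \<inter> v. \<exists>y\<in>B. contour G T v x y)"

definition branch_iso :: "'e mgraph \<Rightarrow> 'e subgraph \<Rightarrow> 'e subgraph \<Rightarrow> ('e \<Rightarrow> 'e) \<Rightarrow> bool" where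
  "branch_iso G T1 T2 \<sigma> \<longleftrightarrow>
     bij_betw \<sigma> (Edges G - snd T1) (Edges G - snd T2) \<and>
     bij_betw (image \<sigma>) (Verts G - fst T1) (Verts G - fst T2) \<and>
     (\<forall>v\<in>Verts G - fst T1. \<forall>x\<in>v. \<sigma> (rot G v x) = rot G (\<sigma> ` v) (\<sigma> x)) \<and>
     (\<forall>A\<in>branches G T1. \<forall>B\<in>branches G T1.
        next_branch G T1 A B \<longleftrightarrow> next_branch G T2 (\<sigma> ` A) (\<sigma> ` B))"

definition near_aut :: "(psl2z \<Rightarrow> psl2z) \<Rightarrow> bool" where
  "near_aut \<sigma> \<longleftrightarrow> bij \<sigma> \<and> (\<forall>W. \<sigma> (twin farey W) = twin farey (\<sigma> W)) \<and>
     (\<exists>T1 T2. finite_subtree farey T1 \<and> finite_subtree farey T2 \<and> branch_iso farey T1 T2 \<sigma>)"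

definition germ_rel :: "((psl2z \<Rightarrow> psl2z) \<times> (psl2z \<Rightarrow> psl2z)) set" where
  "germ_rel = {(\<sigma>, \<tau>). near_aut \<sigma> \<and> near_aut \<tau> \<and>
     (\<exists>T. finite_subtree farey T \<and> (\<forall>W. W \<notin> snd T \<longrightarrow> \<sigma> W = \<tau> W))}"

definition germ :: "(psl2z \<Rightarrow> psl2z) \<Rightarrow> (psl2z \<Rightarrow> psl2z) set" where
  "germ \<sigma> = germ_rel `` {\<sigma>}"

definition Aut_inf :: "(psl2z \<Rightarrow> psl2z) set monoid" where
  "Aut_inf =
     \<lparr>carrier = Collect near_aut // germ_rel,
      mult = (\<lambda>A B. \<Union>\<sigma>\<in>A. \<Union>\<tau>\<in>B. germ (\<sigma> \<circ> \<tau>)),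
      one = germ id\<rparr>"

definition germification :: "psl2z gmap \<Rightarrow> (psl2z \<Rightarrow> psl2z) set" where
  "germification \<Phi> = germ (fst \<Phi>)"

end

theory Submission
  imports Defs
begin

text \<open>
  Every labeled graph reached from the Farey tree by flips is again a tree, and by transitivity of the
  automorphism group it suffices to understand the flip at \<open>1\<close>.  Hence the permutations of the edges
  that occur in \<open>PMG\<close> are generated by the left multiplications and one explicit permutation.

  A permutation that is an automorphism outside a finite set of edges respects the cyclic order of
  the branches iff it sends the two ends of each sequence of edges turning around a cusp to the two
  ends of another such sequence.  This condition does not mention subtrees and is stable under
  composition, so it holds for all elements of \<open>PMG\<close>.  Conversely, a permutation with this property
  is a product of flips and automorphisms, by induction on the size of a convex set outside of which
  it is an automorphism: flips make the images of the two edges leaving an ear of this set adjacent,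
  and then a permutation of pairs of twins, available by the pentagon relation, removes the ear.
  Thus \<open>PMG\<close> consists of all near-automorphisms, among which those with trivial germ are the
  permutations in \<open>sym_pm\<close>.
\<close>

subsection \<open>The modular group\<close>

text \<open>The cyclic order in a near-automorphism refers to chosen subtrees, so composing two of
  them directly would require common enlargements. The cusp criterion avoids this. Walking around a
  subtree means turning the same way at every vertex, so the contour from a branch to the next is a
  stretch of some sequence \<open>W * psl_T i\<close>, where \<open>psl_T 1 = L * S\<close> is the
  translation \<open>z + 1\<close>. Successive branches are those containing the negative and the
  positive end of one such sequence, whatever the subtree. In \<open>cusp_at\<close> the negative
  end normalises \<open>V\<close>; the shift \<open>k\<close> of the positive end counts edges
  gained or lost in between. It has to be left free: a flip gains one edge at two opposite corners
  of its square and loses one at the other two.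

  Labels cause no obstruction, because a relabeling turns any graph isomorphism into a
  label-preserving one. Nor do the prescribed values of a flip on arrows: all graphs met are simply
  connected, so an isomorphism of groupoids is determined by its map of objects.\<close>

abbreviation (input) S :: psl2z where "S \<equiv> psl_S"
abbreviation (input) L :: psl2z where "L \<equiv> psl_L"

abbreviation (input) mat22 :: "int \<Rightarrow> int \<Rightarrow> int \<Rightarrow> int \<Rightarrow> int^2^2" where
  "mat22 a b c d \<equiv> vector [vector [a, b], vector [c, d]]"

lemma mat22_nth [simp]:
  "mat22 a b c d $ 1 $ 1 = a" "mat22 a b c d $ 1 $ 2 = b"
  "mat22 a b c d $ 2 $ 1 = c" "mat22 a b c d $ 2 $ 2 = d"
  by simp_all

lemma mat22_eq_iff: "(M :: int^2^2) = N \<longleftrightarrow>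
    M$1$1 = N$1$1 \<and> M$1$2 = N$1$2 \<and> M$2$1 = N$2$1 \<and> M$2$2 = N$2$2"
  by (auto simp: vec_eq_iff forall_2)

lemma mat22_mult_nth: "((M :: int^2^2) ** N) $ i $ j = M$i$1 * N$1$j + M$i$2 * N$2$j"
  by (simp add: matrix_matrix_mult_def sum_2)

lemma mat_1_nth: "(mat 1 :: int^2^2) $ i $ j = (if i = j then 1 else 0)"
  by (simp add: mat_def)

lemmas mat22_simps = mat22_eq_iff mat22_mult_nth mat_1_nth det_2

lemma psl_S_S: "S * S = 1"
  by transfer (simp add: mobius_equiv_def mat22_simps)

lemma psl_L_L_L: "L * L * L = 1"
  by transfer (simp add: mobius_equiv_def mat22_simps)

lemma psl_L_neq_1: "L \<noteq> 1"
  by transfer (simp add: mobius_equiv_def mat22_simps)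

text \<open>The matrices with rows \<open>(a,b)\<close>, \<open>(c,d)\<close> for which \<open>0\<close> and \<open>\<infinity>\<close> are mapped into \<open>[0,\<infinity>]\<close>;
  without \<open>S\<close>, these are the reduced words that do not start with \<open>S\<close>, see \<open>psl_cone_complement\<close>.\<close>

lift_definition psl_cone :: "psl2z \<Rightarrow> bool" is
  "\<lambda>M. M$1$1 * M$2$1 \<ge> 0 \<and> M$1$2 * M$2$2 \<ge> 0 \<and> \<not> mobius_equiv M (mat22 0 (-1) 1 0)"
  by (auto simp: mobius_equiv_def det_uminus_2 minus_equation_iff)

lemma psl_cone_1: "psl_cone 1"
  by transfer (simp add: mobius_equiv_def mat22_simps)

lemma not_psl_cone_S: "\<not> psl_cone S"
  by transfer (simp add: mobius_equiv_def mat22_simps)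

lemma psl_cone_mult_S: "psl_cone W \<Longrightarrow> W \<noteq> 1 \<Longrightarrow> psl_cone (W * S)"
proof transfer
  fix M :: "int^2^2"
  assume "mobius_equiv M M"
    and "0 \<le> M$1$1 * M$2$1 \<and> 0 \<le> M$1$2 * M$2$2 \<and> \<not> mobius_equiv M (mat22 0 (-1) 1 0)"
    and "\<not> mobius_equiv M (mat 1)"
  then show "0 \<le> (M ** mat22 0 (-1) 1 0)$1$1 * (M ** mat22 0 (-1) 1 0)$2$1 \<and>
      0 \<le> (M ** mat22 0 (-1) 1 0)$1$2 * (M ** mat22 0 (-1) 1 0)$2$2 \<and>
      \<not> mobius_equiv (M ** mat22 0 (-1) 1 0) (mat22 0 (-1) 1 0)"
    by (auto simp: mobius_equiv_def mat22_simps algebra_simps)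
qed

text \<open>With \<open>u = a * c\<close>, \<open>v = b * d\<close>, \<open>y = - (b * c)\<close>
  the product is \<open>u + v + 1 - 2 * y\<close>, and \<open>u * v = y * (y - 1)\<close>. If it
  were negative, integrality would give \<open>u + v \<le> 2 * y - 2\<close>, and
  \<open>4 * u * v \<le> (u + v)^2\<close> then leaves only \<open>y = 1\<close>,
  \<open>u = v = 0\<close>, that is \<open>a = d = 0\<close>.\<close>

lemma det_1_mediant:
  fixes a b c d :: int
  assumes det: "a * d - b * c = 1" and ac: "0 \<le> a * c" and bd: "0 \<le> b * d" and nz: "a \<noteq> 0 \<or> d \<noteq> 0"
  shows "0 \<le> (a + b) * (c + d)"
proof (rule ccontr)
  assume "\<not> 0 \<le> (a + b) * (c + d)"
  define u v y where "u = a * c" and "v = b * d" and "y = - (b * c)"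
  have ad: "a * d = 1 - y" using det by (simp add: y_def)
  have neg: "u + v + 1 - 2 * y < 0"
    using \<open>\<not> 0 \<le> (a + b) * (c + d)\<close> ad by (simp add: u_def v_def y_def algebra_simps)
  have "u * v = (a * d) * (b * c)" by (simp add: u_def v_def)
  then have uv: "u * v = y * (y - 1)" using ad by (simp add: y_def algebra_simps)
  have nonneg: "0 \<le> u" "0 \<le> v" using ac bd by (simp_all add: u_def v_def)
  have "4 * (u * v) \<le> (u + v)\<^sup>2"
    using zero_le_power2[of "u - v"] by (simp add: power2_eq_square algebra_simps)
  also have "\<dots> \<le> (2 * y - 2)\<^sup>2"
    using neg nonneg by (intro power_mono) auto
  finally have "y \<le> 1" using uv by (simp add: power2_eq_square algebra_simps)
  then have "y = 1" "u = 0" "v = 0" using neg nonneg by auto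
  then show False using nz by (auto simp: u_def v_def y_def)
qed

text \<open>The columns of the product are the sum of the old columns and the negative of the first
  one, so only the sum needs an argument. The class of \<open>S\<close>, excluded from
  \<open>psl_cone\<close>, is exactly the exception \<open>a = d = 0\<close> of
  \<open>det_1_mediant\<close>.\<close>

lemma psl_cone_mult_L: "psl_cone W \<Longrightarrow> psl_cone (W * L)"
proof transfer
  fix M :: "int^2^2"
  define a b c d where "a = M$1$1" and "b = M$1$2" and "c = M$2$1" and "d = M$2$2"
  note entries = this
  assume "mobius_equiv M M"
    and hyp: "0 \<le> M$1$1 * M$2$1 \<and> 0 \<le> M$1$2 * M$2$2 \<and> \<not> mobius_equiv M (mat22 0 (-1) 1 0)"
  then have det: "a * d - b * c = 1" by (simp add: mobius_equiv_def mat22_simps entries)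
  have "a \<noteq> 0 \<or> d \<noteq> 0"
  proof (rule ccontr)
    assume "\<not> (a \<noteq> 0 \<or> d \<noteq> 0)"
    then have "a = 0" "d = 0" "b * (- c) = 1" using det by auto
    then have "b = 1 \<and> c = -1 \<or> b = -1 \<and> c = 1"
      using pos_zmult_eq_1_iff_lemma[of b "- c"] by (auto simp: minus_equation_iff abs_if split: if_splits)
    then show False
      using \<open>a = 0\<close> \<open>d = 0\<close> hyp by (auto simp: mobius_equiv_def mat22_simps entries)
  qed
  with det hyp have "0 \<le> (a + b) * (c + d)"
    by (intro det_1_mediant) (simp_all add: entries)
  moreover have not_S: "\<not> mobius_equiv (M ** mat22 1 (-1) 1 0) (mat22 0 (-1) 1 0)"
  proof
    assume "mobius_equiv (M ** mat22 1 (-1) 1 0) (mat22 0 (-1) 1 0)"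
    then have "b = 1 \<and> d = -1 \<or> b = -1 \<and> d = 1"
      unfolding mobius_equiv_def mat22_simps uminus_vec_def by (auto simp: entries)
    then show False using hyp by (auto simp: entries)
  qed
  ultimately show "0 \<le> (M ** mat22 1 (-1) 1 0)$1$1 * (M ** mat22 1 (-1) 1 0)$2$1 \<and>
      0 \<le> (M ** mat22 1 (-1) 1 0)$1$2 * (M ** mat22 1 (-1) 1 0)$2$2 \<and>
      \<not> mobius_equiv (M ** mat22 1 (-1) 1 0) (mat22 0 (-1) 1 0)"
    using hyp not_S by (simp add: mat22_mult_nth entries mult.commute)
qed

section \<open>Generation by \<open>S\<close> and \<open>L\<close> through the Euclidean
  algorithm\<close>

inductive_set psl_gen :: "psl2z set" where
  "1 \<in> psl_gen"
| "W \<in> psl_gen \<Longrightarrow> W * S \<in> psl_gen"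
| "W \<in> psl_gen \<Longrightarrow> W * L \<in> psl_gen"

lemma psl_gen_mult_S_iff: "W * S \<in> psl_gen \<longleftrightarrow> W \<in> psl_gen"
  by (metis mult.assoc mult.right_neutral psl_S_S psl_gen.intros(2))

lemma psl_gen_mult_L_iff: "W * L \<in> psl_gen \<longleftrightarrow> W \<in> psl_gen"
  by (metis mult.assoc mult.right_neutral psl_L_L_L psl_gen.intros(3))

text \<open>The translations \<open>z + k\<close>: here the column operations of the Euclidean
  algorithm, later the parabolic elements that turn around a cusp.\<close>

lift_definition psl_T :: "int \<Rightarrow> psl2z" is "\<lambda>k. mat22 1 k 0 1"
  by (simp add: mobius_equiv_def det_2)

lemma psl_T_0: "psl_T 0 = 1"
  by transfer (simp add: mobius_equiv_def mat22_simps)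

lemma psl_T_Suc: "psl_T (k + 1) = psl_T k * L * S"
  by transfer (simp add: mobius_equiv_def mat22_simps)

lemma psl_gen_mult_T_iff: "W * psl_T k \<in> psl_gen \<longleftrightarrow> W \<in> psl_gen"
proof (induction k rule: int_induct[of _ 0])
  case (step1 i)
  then show ?case
    by (simp add: psl_T_Suc psl_gen_mult_S_iff psl_gen_mult_L_iff flip: mult.assoc)
next
  case (step2 i)
  then show ?case
    using psl_T_Suc[of "i - 1"]
    by (simp add: psl_gen_mult_S_iff psl_gen_mult_L_iff flip: mult.assoc)
qed (simp add: psl_T_0)

lift_definition psl_row :: "psl2z \<Rightarrow> nat" is "\<lambda>M. nat \<bar>M$2$1\<bar>"
  by (auto simp: mobius_equiv_def)

lemma psl_row_0: "psl_row W = 0 \<Longrightarrow> \<exists>k. W = psl_T k"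
proof transfer
  fix M :: "int^2^2"
  assume M: "mobius_equiv M M" "nat \<bar>M$2$1\<bar> = 0"
  then have "M$1$1 * M$2$2 = 1" by (simp add: mobius_equiv_def mat22_simps)
  then consider "M$1$1 = 1" "M$2$2 = 1" | "M$1$1 = -1" "M$2$2 = -1"
    by (metis zmult_eq_1_iff)
  then show "\<exists>k. mobius_equiv M (mat22 1 k 0 1)"
  proof cases
    case 1
    then show ?thesis using M
      by (intro exI[of _ "M$1$2"]) (auto simp: mobius_equiv_def mat22_simps)
  next
    case 2
    then show ?thesis using M
      by (intro exI[of _ "- M$1$2"]) (auto simp: mobius_equiv_def mat22_simps)
  qed
qed

text \<open>Multiplication by \<open>psl_T k\<close> and \<open>S\<close> turns the bottom row
  \<open>(c, d)\<close> into \<open>(d + k * c, - c)\<close>; for \<open>k\<close> minus the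
  quotient of \<open>d\<close> by \<open>c\<close>, the new left entry is the remainder.\<close>

lemma psl_row_euclid: "psl_row W \<noteq> 0 \<Longrightarrow> \<exists>k. psl_row (W * psl_T k * S) < psl_row W"
proof transfer
  fix M :: "int^2^2"
  assume "nat \<bar>M$2$1\<bar> \<noteq> 0"
  define q where "q = M$2$2 div M$2$1"
  have "\<bar>M$2$2 - q * M$2$1\<bar> < \<bar>M$2$1\<bar>"
    using \<open>nat \<bar>M$2$1\<bar> \<noteq> 0\<close> abs_mod_less[of "M$2$1" "M$2$2"]
    by (simp add: q_def minus_div_mult_eq_mod)
  then show "\<exists>k. nat \<bar>(M ** mat22 1 k 0 1 ** mat22 0 (-1) 1 0)$2$1\<bar> < nat \<bar>M$2$1\<bar>"
    by (intro exI[of _ "- q"]) (simp add: mat22_mult_nth algebra_simps)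
qed

lemma psl_gen_UNIV: "W \<in> psl_gen"
proof (induction "psl_row W" arbitrary: W rule: less_induct)
  case less
  show ?case
  proof (cases "psl_row W = 0")
    case True
    then obtain k where "W = psl_T k" using psl_row_0 by blast
    then show ?thesis using psl_gen_mult_T_iff[of 1 k] by (simp add: psl_gen.intros)
  next
    case False
    then obtain k where "psl_row (W * psl_T k * S) < psl_row W" using psl_row_euclid by blast
    from less[OF this] show ?thesis
      by (simp add: psl_gen_mult_T_iff psl_gen_mult_S_iff)
  qed
qed

lemma psl_induct [case_names 1 S L]:
  assumes "P 1" and "\<And>W. P W \<Longrightarrow> P (W * S)" and "\<And>W. P W \<Longrightarrow> P (W * L)"
  shows "P W"
  using psl_gen_UNIV[of W] by (induction rule: psl_gen.induct) (simp_all add: assms)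

lemma psl_S_S_left: "S * (S * W) = W"
  by (simp add: psl_S_S flip: mult.assoc)

lemma psl_L_L_L_left: "L * (L * (L * W)) = W"
  by (simp add: psl_L_L_L flip: mult.assoc)

lemma psl_L_L_L_right: "L * (L * L) = 1"
  by (simp add: psl_L_L_L flip: mult.assoc)

lemmas psl_simps = mult.assoc psl_S_S psl_S_S_left psl_L_L_L_right psl_L_L_L_left

lemma psl_inverse_exists: "\<exists>V. V * W = (1::psl2z) \<and> W * V = 1"
proof (induction W rule: psl_induct)
  case 1
  then show ?case by (intro exI[of _ 1]) simp
next
  case (S W)
  then obtain V where V: "V * W = 1" "W * V = 1" by blast
  have "(S * V) * (W * S) = S * (V * W) * S" "(W * S) * (S * V) = W * (S * S) * V"
    by (simp_all only: mult.assoc)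
  then show ?case using V by (intro exI[of _ "S * V"]) (simp add: psl_S_S)
next
  case (L W)
  then obtain V where V: "V * W = 1" "W * V = 1" by blast
  have "(L * L * V) * (W * L) = L * L * (V * W) * L" "(W * L) * (L * L * V) = W * (L * L * L) * V"
    by (simp_all only: mult.assoc)
  then show ?case using V by (intro exI[of _ "L * L * V"]) (simp add: psl_L_L_L)
qed

definition psl_inv :: "psl2z \<Rightarrow> psl2z" where
  "psl_inv W = (SOME V. V * W = 1 \<and> W * V = 1)"

lemma psl_inv: "psl_inv W * W = 1" "W * psl_inv W = 1"
  using someI_ex[OF psl_inverse_exists, of W] unfolding psl_inv_def by blast+

lemma psl_inv_left [simp]: "psl_inv W * (W * V) = V" "W * (psl_inv W * V) = V"
  by (simp_all add: psl_inv flip: mult.assoc)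

lemma psl_left_cancel [simp]: "W * X = W * Y \<longleftrightarrow> X = (Y::psl2z)"
  by (metis psl_inv_left(1))

lemma psl_right_cancel [simp]: "X * W = Y * W \<longleftrightarrow> X = (Y::psl2z)"
  by (metis mult.assoc mult.right_neutral psl_inv(2))

lemma psl_left_cancel_1 [simp]: "W * X = W \<longleftrightarrow> X = (1::psl2z)" "W = W * X \<longleftrightarrow> X = (1::psl2z)"
  using psl_left_cancel[of W X 1] by auto

lemma psl_right_cancel_1 [simp]: "X * W = W \<longleftrightarrow> X = (1::psl2z)" "W = X * W \<longleftrightarrow> X = (1::psl2z)"
  using psl_right_cancel[of X W 1] by auto

subsection \<open>Reduced words\<close>

definition cone :: "psl2z set" where "cone = {W. psl_cone W}"

lemma one_in_cone [simp]: "1 \<in> cone"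
  by (simp add: cone_def psl_cone_1)

lemma S_notin_cone [simp]: "S \<notin> cone"
  by (simp add: cone_def not_psl_cone_S)

lemma cone_mult_S: "W \<in> cone \<Longrightarrow> W \<noteq> 1 \<Longrightarrow> W * S \<in> cone"
  by (simp add: cone_def psl_cone_mult_S)

lemma cone_mult_L: "W \<in> cone \<Longrightarrow> W * L \<in> cone"
  by (simp add: cone_def psl_cone_mult_L)

lemma cone_mult_L_iff [simp]: "W * L \<in> cone \<longleftrightarrow> W \<in> cone"
  using cone_mult_L[of W] cone_mult_L[of "W * L"] cone_mult_L[of "W * L * L"]
  by (auto simp: psl_simps)

lemma not_cone_mult_S: "W \<notin> cone \<Longrightarrow> W \<noteq> S \<Longrightarrow> W * S \<notin> cone"
  using cone_mult_S[of "W * S"] psl_right_cancel[of W S S] by (auto simp: psl_simps)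

text \<open>The condition \<open>W \<noteq> 1\<close> only forbids leaving the edge 1 through its
  degree-2 vertex, so these are the edges reached from 1 through its degree-3 vertex.\<close>

inductive_set cone_gen :: "psl2z set" where
  "1 \<in> cone_gen"
| "W \<in> cone_gen \<Longrightarrow> W \<noteq> 1 \<Longrightarrow> W * S \<in> cone_gen"
| "W \<in> cone_gen \<Longrightarrow> W * L \<in> cone_gen"

lemma cone_gen_subset: "W \<in> cone_gen \<Longrightarrow> W \<in> cone"
  by (induction rule: cone_gen.induct) (simp_all add: cone_mult_S cone_mult_L)

lemma S_cone_gen_disjoint: "W \<in> cone_gen \<Longrightarrow> S * W \<notin> cone"
proof (induction rule: cone_gen.induct)
  case (2 W)
  then show ?case using not_cone_mult_S[of "S * W"] by (simp add: mult.assoc)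
next
  case (3 W)
  then show ?case using cone_mult_L_iff[of "S * W"] by (simp add: mult.assoc)
qed simp

lemma cone_gen_cover: "W \<in> cone_gen \<or> S * W \<in> cone_gen"
proof (induction W rule: psl_induct)
  case 1
  then show ?case by (simp add: cone_gen.intros)
next
  case (S W)
  show ?case
  proof (cases "W = 1 \<or> S * W = 1")
    case True
    then have "W = 1 \<or> W = S" by (metis psl_S_S_left mult.right_neutral)
    then show ?thesis by (auto simp: psl_simps intro: cone_gen.intros)
  next
    case False
    then show ?thesis using S cone_gen.intros(2)[of W] cone_gen.intros(2)[of "S * W"]
      by (auto simp: mult.assoc)
  qed
next
  case (L W)
  then show ?case using cone_gen.intros(3)[of W] cone_gen.intros(3)[of "S * W"]
    by (auto simp: mult.assoc)
qed

text \<open>Ping-pong: \<open>cone_gen\<close> lies in \<open>cone\<close>, its left translate by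
  \<open>S\<close> avoids \<open>cone\<close>, and the two together are everything. This is the free
  product structure in the form used below: induction over a branch, with \<open>S\<close>
  exchanging \<open>cone\<close> and its complement.\<close>

lemma cone_eq_cone_gen: "cone = cone_gen"
  using cone_gen_cover cone_gen_subset S_cone_gen_disjoint psl_S_S_left by (metis subset_antisym subsetI)

lemma psl_cone_complement [simp]: "S * W \<in> cone \<longleftrightarrow> W \<notin> cone"
  using cone_gen_cover S_cone_gen_disjoint cone_eq_cone_gen by metis

lemma cone_induct [consumes 1, case_names 1 S L]:
  assumes "W \<in> cone" and "P 1"
    and "\<And>W. W \<in> cone \<Longrightarrow> W \<noteq> 1 \<Longrightarrow> P W \<Longrightarrow> P (W * S)"
    and "\<And>W. W \<in> cone \<Longrightarrow> P W \<Longrightarrow> P (W * L)"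
  shows "P W"
  using assms(1) unfolding cone_eq_cone_gen
  by (induction rule: cone_gen.induct) (simp_all add: assms(2-) cone_eq_cone_gen)

lemma L_in_cone [simp]: "L \<in> cone" "L * L \<in> cone"
  using cone_mult_L[of 1] cone_mult_L[of L] by simp_all

lemma psl_L_L_neq_1: "L * L \<noteq> 1"
  using psl_L_L_L psl_L_neq_1 by (metis mult.left_neutral)

lemma psl_S_neq_1: "S \<noteq> 1"
  using S_notin_cone one_in_cone by metis

lemma psl_neqs [simp]: "L \<noteq> 1" "L * L \<noteq> 1" "S \<noteq> 1" "1 \<noteq> L" "1 \<noteq> L * L"
    "1 \<noteq> S" "S \<noteq> L" "S \<noteq> L * L" "L \<noteq> S" "L * L \<noteq> S"
  using psl_L_neq_1 psl_L_L_neq_1 psl_S_neq_1 L_in_cone S_notin_cone by metis+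

text \<open>The translated branches start inside \<open>cone\<close>, and a walk can leave
  \<open>cone\<close> only through 1, a value which \<open>neq\<close> rules out.\<close>

lemma L_mult_in_cone_aux:
  assumes "W \<in> cone"
  shows "L * S * W \<in> cone \<and> L * S * W \<noteq> 1 \<and>
         L * L * S * W \<in> cone \<and> L * L * S * W \<noteq> 1"
proof -
  have neq: "L * S * W \<noteq> 1 \<and> L * L * S * W \<noteq> 1" if "W \<in> cone" for W
  proof -
    have "L * S * W = 1 \<Longrightarrow> S * W = L * L" "L * L * S * W = 1 \<Longrightarrow> S * W = L"
      using psl_L_L_L_left[of "S * W"] by (simp_all add: mult.assoc)
    then show ?thesis using that psl_cone_complement[of W] L_in_cone by metis
  qed
  have "L * S * W \<in> cone \<and> L * L * S * W \<in> cone"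
    using assms
  proof (induction rule: cone_induct)
    case 1
    then show ?case by (simp add: cone_mult_S)
  next
    case (S W)
    then show ?case using neq[of W] cone_mult_S[of "L * S * W"] cone_mult_S[of "L * L * S * W"]
      by (auto simp: mult.assoc)
  next
    case (L W)
    then show ?case using cone_mult_L[of "L * S * W"] cone_mult_L[of "L * L * S * W"]
      by (auto simp: mult.assoc)
  qed
  then show ?thesis using neq assms by blast
qed

lemma L_mult_in_cone [simp]:
  "W \<notin> cone \<Longrightarrow> L * W \<in> cone" "W \<notin> cone \<Longrightarrow> L * (L * W) \<in> cone"
  using L_mult_in_cone_aux[of "S * W"] by (simp_all add: mult.assoc psl_S_S_left)

text \<open>The self-similarity of a branch: its first vertex and two smaller branches behind
  it.\<close>

lemma cone_cases:
  assumes "W \<in> cone"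
  obtains "W \<in> {1, L, L * L}"
  | V where "V \<in> cone" "W = L * S * V"
  | V where "V \<in> cone" "W = L * L * S * V"
proof -
  have "W \<in> {1, L, L * L} \<or> (\<exists>V\<in>cone. W = L * S * V \<or> W = L * L * S * V)"
    using assms
  proof (induction rule: cone_induct)
    case (S W)
    then consider "W = L" | "W = L * L" | V where "V \<in> cone" "W = L * S * V \<or> W = L * L * S * V"
      by auto
    then show ?case
    proof cases
      case 3
      show ?thesis
      proof (cases "V = 1")
        case True
        then show ?thesis using 3 by (auto simp: psl_simps)
      next
        case False
        then have "V * S \<in> cone" using 3 cone_mult_S by simp
        moreover have "W * S = L * S * (V * S) \<or> W * S = L * L * S * (V * S)"
          using 3(2) by (auto simp: mult.assoc)
        ultimately show ?thesis by blast
      qed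
    qed (auto intro!: bexI[of _ 1])
  next
    case (L W)
    then consider "W \<in> {1, L, L * L}" | V where "V \<in> cone" "W = L * S * V \<or> W = L * L * S * V"
      by auto
    then show ?case
    proof cases
      case 2
      then have "V * L \<in> cone" "W * L = L * S * (V * L) \<or> W * L = L * L * S * (V * L)"
        by (auto simp: mult.assoc)
      then show ?thesis by blast
    qed (auto simp: psl_L_L_L)
  qed simp
  then show ?thesis using that by blast
qed

lemma cone_subtree:
  assumes "V \<in> cone"
  shows "L * S * V \<in> cone - {1, L, L * L}"
    "L * L * S * V \<in> cone - {1, L, L * L}"
proof -
  have "S * V \<notin> {1, L, L * L}"
    using assms psl_cone_complement[of V] one_in_cone L_in_cone by (metis insertE empty_iff)
  moreover have "L * S * V = L \<Longrightarrow> S * V = 1" "L * S * V = L * L \<Longrightarrow> S * V = L"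
    "L * L * S * V = L * L \<Longrightarrow> S * V = 1"
    by (simp_all add: mult.assoc)
  moreover have "L * L * S * V = L \<Longrightarrow> S * V = L * L"
    by (drule arg_cong[of _ _ "\<lambda>Z. L * Z"]) (simp add: psl_simps)
  ultimately show "L * S * V \<in> cone - {1, L, L * L}"
    "L * L * S * V \<in> cone - {1, L, L * L}"
    using L_mult_in_cone_aux[OF assms] by blast+
qed

subsection \<open>Convex sets of edges\<close>

text \<open>\<open>W \<cdot> cone\<close> consists of \<open>W\<close> and the edges beyond its vertex of degree 3.\<close>

definition convex_edges :: "psl2z set \<Rightarrow> bool" where
  "convex_edges U \<longleftrightarrow> finite U \<and> (\<forall>W\<in>U. W * L \<in> U) \<and>
     (\<forall>W. W \<notin> U \<longrightarrow> W * S \<in> U \<longrightarrow> (\<forall>V\<in>cone. W * V \<notin> U))"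

lemma convex_edges_L_iff:
  assumes "convex_edges U"
  shows "W * L \<in> U \<longleftrightarrow> W \<in> U"
proof -
  have "\<forall>W\<in>U. W * L \<in> U" using assms by (simp add: convex_edges_def)
  then have "W * L \<in> U \<Longrightarrow> W * L * L * L \<in> U" "W \<in> U \<Longrightarrow> W * L \<in> U" by blast+
  then show ?thesis by (auto simp: psl_simps)
qed

lemma convex_edgesD:
  "convex_edges U \<Longrightarrow> W \<notin> U \<Longrightarrow> W * S \<in> U \<Longrightarrow> V \<in> cone \<Longrightarrow> W * V \<notin> U"
  by (simp add: convex_edges_def)

lemma convex_edges_empty: "convex_edges {}"
  by (simp add: convex_edges_def)

text \<open>Attaches the star of a degree-3 vertex at the edge \<open>W\<close>. A branch leaving an
  old edge cannot contain \<open>W\<close>, as it would then contain \<open>W * S\<close> in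
  \<open>U\<close>; the branches behind \<open>W * L\<close> and \<open>W * L * L\<close> are parts
  of the branch of \<open>W\<close>, which was outside already. The alternative
  \<open>U = {}\<close> starts the construction.\<close>

lemma convex_edges_add:
  assumes U: "convex_edges U" and W: "W \<notin> U" "W * S \<in> U \<or> U = {}"
  shows "convex_edges (U \<union> {W, W * L, W * L * L})" (is "convex_edges ?U'")
  unfolding convex_edges_def
proof (intro conjI allI impI ballI)
  show "finite ?U'" using U by (simp add: convex_edges_def)
next
  fix X assume "X \<in> ?U'"
  then show "X * L \<in> ?U'" by (auto simp: convex_edges_L_iff[OF U] psl_simps)
next
  fix X V assume X: "X \<notin> ?U'" "X * S \<in> ?U'" and V: "V \<in> cone"
  consider "X * S \<in> U" | "X = W * S" "U = {}" | "X = W * L * S" | "X = W * L * L * S"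
    using X W by (auto simp: psl_simps dest!: arg_cong[of "X * S" _ "\<lambda>Z. Z * S"])
  then show "X * V \<notin> ?U'"
  proof cases
    case 1
    have "X * V' \<noteq> W" if "V' \<in> cone" for V'
    proof
      assume "X * V' = W"
      then have "V' \<noteq> 1" using X(1) by auto
      then have "X * (V' * S) \<notin> U"
        using convex_edgesD[OF U _ 1] X(1) that cone_mult_S by auto
      then show False using \<open>X * V' = W\<close> W(2) 1 by (auto simp: mult.assoc)
    qed
    moreover have "V * L \<in> cone" "V * L * L \<in> cone" using V by simp_all
    ultimately have "X * V \<noteq> W" "X * V * L \<noteq> W" "X * V * L * L \<noteq> W"
      using V by (metis mult.assoc)+
    moreover have "X * V = W * L \<Longrightarrow> X * V * L * L = W"
      by (drule arg_cong[of _ _ "\<lambda>Z. Z * (L * L)"]) (simp add: psl_simps)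
    moreover have "X * V = W * L * L \<Longrightarrow> X * V * L = W"
      by (drule arg_cong[of _ _ "\<lambda>Z. Z * L"]) (simp add: psl_simps)
    moreover have "X * V \<notin> U" using convex_edgesD[OF U _ 1 V] X(1) by blast
    ultimately show ?thesis by blast
  next
    case 2
    have "S * V \<notin> {1, L, L * L}"
      using V psl_cone_complement[of V] one_in_cone L_in_cone by (metis insertE empty_iff)
    then show ?thesis using 2 by (auto simp: mult.assoc)
  next
    case 3
    have "L * S * V \<in> cone" "L * S * V \<notin> {1, L, L * L}"
      using cone_subtree[OF V] by auto
    then show ?thesis using 3 W convex_edgesD[OF U W(1), of "L * S * V"] by (auto simp: mult.assoc)
  next
    case 4
    have "L * L * S * V \<in> cone" "L * L * S * V \<notin> {1, L, L * L}"
      using cone_subtree[OF V] by auto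
    then show ?thesis using 4 W convex_edgesD[OF U W(1), of "L * L * S * V"] by (auto simp: mult.assoc)
  qed
qed

lemma convex_edges_extend_S:
  assumes "convex_edges U" "W \<in> U"
  shows "\<exists>U'. convex_edges U' \<and> U \<subseteq> U' \<and> W * S \<in> U'"
proof (cases "W * S \<in> U")
  case False
  then have "convex_edges (U \<union> {W * S, W * S * L, W * S * L * L})"
    using assms by (intro convex_edges_add) (simp_all add: psl_simps)
  then show ?thesis by (intro exI) auto
qed (use assms in blast)

text \<open>A walk to \<open>W\<close>, letter by letter: only \<open>S\<close> can lead out of the
  set, and then one star is added.\<close>

lemma convex_edges_extend:
  assumes "convex_edges U"
  shows "\<exists>U'. convex_edges U' \<and> U \<subseteq> U' \<and> W \<in> U'"
proof -
  obtain U0 X where U0: "convex_edges U0" "U \<subseteq> U0" "X \<in> U0"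
    using assms convex_edges_add[of "{}" 1] convex_edges_empty by (cases "U = {}") auto
  have "\<exists>U'. convex_edges U' \<and> U \<subseteq> U' \<and> X * Y \<in> U'" for Y
  proof (induction Y rule: psl_induct)
    case 1
    then show ?case using U0 by auto
  next
    case (S Y)
    then show ?case using convex_edges_extend_S unfolding mult.assoc[symmetric] by (meson subset_trans)
  next
    case (L Y)
    then show ?case using convex_edges_L_iff unfolding mult.assoc[symmetric] by blast
  qed
  from this[of "psl_inv X * W"] show ?thesis by simp
qed

lemma convex_edges_exists:
  assumes "finite F"
  shows "\<exists>U. convex_edges U \<and> F \<subseteq> U"
  using assms
proof (induction F)
  case empty
  then show ?case using convex_edges_empty by auto
next
  case (insert W F)
  then obtain U where "convex_edges U" "F \<subseteq> U" by blast
  then show ?case using convex_edges_extend[of U W] by blast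
qed

text \<open>An edge \<open>W\<close> with the fewest edges of \<open>U\<close> in \<open>W \<cdot> cone\<close> lies at the vertex of an ear.\<close>

lemma convex_edges_ear:
  assumes U: "convex_edges U" and "U \<noteq> {}"
  obtains W where "W \<in> U" "W * L * S \<notin> U" "W * L * L * S \<notin> U"
    "convex_edges (U - {W, W * L, W * L * L})"
proof -
  define c where "c = (\<lambda>W. card {X \<in> U. \<exists>V\<in>cone. X = W * V})"
  obtain W where W: "W \<in> U" and min: "\<And>X. X \<in> U \<Longrightarrow> c W \<le> c X"
    using \<open>U \<noteq> {}\<close> ex_has_least_nat[of "\<lambda>X. X \<in> U" _ c] by blast
  have fin: "finite U" using U by (simp add: convex_edges_def)
  \<comment> \<open>Such a \<open>Y\<close> leads to a branch inside that of \<open>W\<close> which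
    misses \<open>W\<close> itself, so \<open>W * Y\<close> in \<open>U\<close> would contradict the
    minimality of \<open>c W\<close>.\<close>
  have smaller: "W * Y \<notin> U" if Y: "\<And>V. V \<in> cone \<Longrightarrow> Y * V \<in> cone \<and> Y * V \<noteq> 1" for Y
  proof
    assume "W * Y \<in> U"
    have "{X \<in> U. \<exists>V\<in>cone. X = W * Y * V} \<subset> {X \<in> U. \<exists>V\<in>cone. X = W * V}"
    proof (rule psubsetI)
      show "{X \<in> U. \<exists>V\<in>cone. X = W * Y * V} \<subseteq> {X \<in> U. \<exists>V\<in>cone. X = W * V}"
        using Y by (auto simp: mult.assoc)
      have "W \<notin> {X \<in> U. \<exists>V\<in>cone. X = W * Y * V}" using Y by (auto simp: mult.assoc)
      moreover have "W \<in> {X \<in> U. \<exists>V\<in>cone. X = W * V}" using W by (auto intro: bexI[of _ 1])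
      ultimately show "{X \<in> U. \<exists>V\<in>cone. X = W * Y * V} \<noteq> {X \<in> U. \<exists>V\<in>cone. X = W * V}" by blast
    qed
    then have "c (W * Y) < c W" unfolding c_def using fin by (intro psubset_card_mono) auto
    then show False using min[OF \<open>W * Y \<in> U\<close>] by simp
  qed
  have 1: "W * L * S \<notin> U" and 2: "W * L * L * S \<notin> U"
    using smaller[of "L * S"] smaller[of "L * L * S"] cone_subtree by (simp_all add: mult.assoc)
  have "convex_edges (U - {W, W * L, W * L * L})" (is "convex_edges ?U'")
    unfolding convex_edges_def
  proof (intro conjI allI impI ballI)
    fix X assume "X \<in> ?U'"
    then show "X * L \<in> ?U'"
      by (auto simp: convex_edges_L_iff[OF U] psl_simps dest: arg_cong[of _ _ "\<lambda>Z. Z * L"] arg_cong[of _ _ "\<lambda>Z. Z * (L * L)"])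
  next
    fix X V assume X: "X \<notin> ?U'" "X * S \<in> ?U'" and V: "V \<in> cone"
    consider "X \<notin> U" | "X = W" | "X = W * L" | "X = W * L * L" using X by blast
    then show "X * V \<notin> ?U'"
    proof cases
      case 1
      then show ?thesis using convex_edgesD[OF U, of X V] X V by auto
    next
      case 2
      have LS: "W * (L * S) * Y \<notin> U" if "Y \<in> cone" for Y
        using convex_edgesD[OF U, of "W * (L * S)" Y] that W 1
        by (simp add: psl_simps convex_edges_L_iff[OF U, unfolded mult.assoc])
      have LLS: "W * (L * L * S) * Y \<notin> U" if "Y \<in> cone" for Y
        using convex_edgesD[OF U, of "W * (L * L * S)" Y] that W \<open>W * L * L * S \<notin> U\<close>
          convex_edges_L_iff[OF U, of W] convex_edges_L_iff[OF U, of "W * L"]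
        by (simp add: psl_simps)
      show ?thesis using V
      proof (cases rule: cone_cases)
        case 1
        then show ?thesis using 2 by (auto simp: mult.assoc)
      next
        case (2 Y)
        then show ?thesis using \<open>X = W\<close> LS[of Y] by (simp add: mult.assoc)
      next
        case (3 Y)
        then show ?thesis using \<open>X = W\<close> LLS[of Y] by (simp add: mult.assoc)
      qed
    qed (use X 1 2 in auto)
  qed (use fin in auto)
  then show ?thesis using that W 1 2 by blast
qed

text \<open>Every other edge of the tree lies in one of the three branches cut off at this
  star.\<close>

lemma convex_edges_single:
  assumes U: "convex_edges U" and "W \<in> U" "W * S \<notin> U" "W * L * S \<notin> U"
    "W * L * L * S \<notin> U"
  shows "U = {W, W * L, W * L * L}"
proof -
  have L: "W * L \<in> U" "W * L * L \<in> U" using U \<open>W \<in> U\<close> convex_edges_L_iff by auto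
  have "X \<in> {W, W * L, W * L * L}" if "X \<in> U" for X
  proof -
    define V where "V = psl_inv W * X"
    have X: "X = W * V" by (simp add: V_def)
    show ?thesis
    proof (cases "V \<in> cone")
      case False
      then have "W * S * (S * V) \<notin> U"
        using assms by (rule_tac convex_edgesD[OF U]) (simp_all add: psl_simps)
      then show ?thesis using that X by (simp add: psl_simps)
    next
      case True
      then show ?thesis
      proof (cases rule: cone_cases)
        case 1
        then show ?thesis using X by (auto simp: mult.assoc)
      next
        case (2 Y)
        then have "W * L * S * Y \<notin> U"
          using assms L by (rule_tac convex_edgesD[OF U]) (simp_all add: psl_simps)
        then show ?thesis using that X 2 by (simp add: mult.assoc)
      next
        case (3 Y)
        then have "W * L * L * S * Y \<notin> U"
          using assms L by (rule_tac convex_edgesD[OF U]) (simp_all add: psl_simps)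
        then show ?thesis using that X 3 by (simp add: mult.assoc)
      qed
    qed
  qed
  then show ?thesis using L \<open>W \<in> U\<close> by auto
qed

subsection \<open>The flip of the Farey tree as a permutation\<close>

text \<open>The edges beyond the vertex of degree 2 of \<open>1\<close>, together with \<open>1\<close>.\<close>

definition cone2 :: "psl2z set" where "cone2 = insert 1 (- cone)"

lemma cone2_simps [simp]: "1 \<in> cone2" "S \<in> cone2" "S * W \<in> cone2 \<longleftrightarrow> W = S \<or> W \<in> cone"
  using psl_left_cancel[of S W S] by (auto simp: cone2_def psl_S_S simp del: psl_left_cancel)

lemma cone2_mult_S: "W \<in> cone2 \<Longrightarrow> W * S \<in> cone2"
  using not_cone_mult_S[of W] psl_right_cancel[of W S 1]
  by (cases "W = S") (auto simp: cone2_def psl_S_S)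

lemma cone2_mult_L: "W \<in> cone2 \<Longrightarrow> W \<noteq> 1 \<Longrightarrow> W * L \<in> cone2"
  by (auto simp: cone2_def)

lemma L_cone2_in_cone [simp]:
  "W \<in> cone2 \<Longrightarrow> L * W \<in> cone" "W \<in> cone2 \<Longrightarrow> L * (L * W) \<in> cone"
  by (auto simp: cone2_def)

lemma L_cone2_neq [simp]:
  assumes "W \<in> cone2"
  shows "L * W \<noteq> 1" "L * (L * W) \<noteq> 1" "L * W \<notin> cone2" "L * (L * W) \<notin> cone2"
proof -
  have "L * W = 1 \<Longrightarrow> W = L * L" "L * (L * W) = 1 \<Longrightarrow> W = L"
    using psl_L_L_L_left[of W] by simp_all
  then show *: "L * W \<noteq> 1" "L * (L * W) \<noteq> 1" using assms by (auto simp: cone2_def)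
  show "L * W \<notin> cone2" "L * (L * W) \<notin> cone2"
    using assms * by (auto simp: cone2_def)
qed

text \<open>The two flipped edges and the branches at the four sides of the square around them.
  Since 1 belongs to \<open>cone2\<close>, each side \<open>L\<close>, \<open>L * L\<close>,
  \<open>S * L\<close>, \<open>S * (L * L)\<close> is counted with its own branch.\<close>

lemma flip_cases:
  obtains "W = 1" | "W = S" | V where "V \<in> cone2" "W = L * V"
  | V where "V \<in> cone2" "W = L * (L * V)"
  | V where "V \<in> cone2" "W = S * (L * V)"
  | V where "V \<in> cone2" "W = S * (L * (L * V))"
proof -
  have *: "W = 1 \<or> (\<exists>V\<in>cone2. W = L * V \<or> W = L * (L * V))" if "W \<in> cone" for W
    using that
  proof (cases rule: cone_cases)
    case 1
    then show ?thesis by (auto intro: bexI[of _ 1])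
  next
    case (2 V)
    then show ?thesis by (auto simp: mult.assoc intro!: bexI[of _ "S * V"])
  next
    case (3 V)
    then show ?thesis by (auto simp: mult.assoc intro!: bexI[of _ "S * V"])
  qed
  show ?thesis
  proof (cases "W \<in> cone")
    case True
    then show ?thesis using *[OF True] that by blast
  next
    case False
    then have "S * W \<in> cone" by simp
    then have "S * W = 1 \<or> (\<exists>V\<in>cone2. S * W = L * V \<or> S * W = L * (L * V))" by (rule *)
    moreover have "S * W = X \<Longrightarrow> W = S * X" for X using psl_S_S_left by metis
    ultimately show ?thesis using that by (metis mult.right_neutral)
  qed
qed

text \<open>
  An isomorphism from the flip of the Farey tree at \<open>1\<close> to the Farey tree: left multiplication by a
  constant on each of the four branches, and the identity on the two flipped edges.
\<close>

definition flip_map :: "psl2z \<Rightarrow> psl2z" where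
  "flip_map W =
     (if W = 1 \<or> W = S then W
      else if W \<in> cone then
        (if L * (L * W) \<in> cone2 then S * (L * W) else L * (L * W))
      else
        (if L * (L * (S * W)) \<in> cone2 then L * (S * W)
         else S * (L * (L * (S * W)))))"

lemma S_L_cone2_neq:
  assumes "V \<in> cone2"
  shows "S * (L * V) \<noteq> S" "S * (L * (L * V)) \<noteq> S"
    "S * (L * V) \<noteq> 1" "S * (L * (L * V)) \<noteq> 1"
    "L * V \<noteq> S" "L * (L * V) \<noteq> S"
proof -
  show "S * (L * V) \<noteq> S" "S * (L * (L * V)) \<noteq> S" using assms by simp_all
  have "L * V \<in> cone" "L * (L * V) \<in> cone" using assms by simp_all
  then show "S * (L * V) \<noteq> 1" "S * (L * (L * V)) \<noteq> 1" "L * V \<noteq> S" "L * (L * V) \<noteq> S"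
    using psl_cone_complement one_in_cone S_notin_cone by metis+
qed

text \<open>A quarter turn of the sides. For \<open>f = 1\<close> the new cyclic orders
  \<open>(e,c,a)\<close> and \<open>(f,b,d)\<close> are read as the stars of \<open>S\<close> and 1,
  so \<open>c\<close>, \<open>a\<close>, \<open>b\<close>, \<open>d\<close> go to
  \<open>S * L\<close>, \<open>S * (L * L)\<close>, \<open>L\<close>, \<open>L * L\<close>.\<close>

lemma flip_map_simps [simp]:
  "flip_map 1 = 1" "flip_map S = S"
  "V \<in> cone2 \<Longrightarrow> flip_map (L * V) = S * (L * (L * V))"
  "V \<in> cone2 \<Longrightarrow> flip_map (L * (L * V)) = L * V"
  "V \<in> cone2 \<Longrightarrow> flip_map (S * (L * V)) = L * (L * V)"
  "V \<in> cone2 \<Longrightarrow> flip_map (S * (L * (L * V))) = S * (L * V)"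
  by (simp_all add: flip_map_def S_L_cone2_neq psl_simps)

lemma flip_map_L_simps [simp]:
  "flip_map L = S * (L * L)"
  "flip_map (L * L) = L"
  "flip_map (S * L) = L * L"
  "flip_map (S * (L * L)) = S * L"
  using flip_map_simps(3-6)[of 1] by simp_all

lemma flip_map_mult_S: "flip_map (W * S) = flip_map W * S"
  by (cases W rule: flip_cases) (simp_all add: psl_simps cone2_mult_S)

lemma flip_map_mult_L:
  "W \<notin> {1, L, L * L, S, S * L, S * (L * L)} \<Longrightarrow>
   flip_map (W * L) = flip_map W * L"
  by (cases W rule: flip_cases) (auto simp: mult.assoc cone2_mult_L)

text \<open>\<open>S\<close> is the half turn of the square, and it commutes with the quarter
  turn.\<close>

lemma flip_map_S_mult: "flip_map (S * W) = S * flip_map W"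
  by (cases W rule: flip_cases) (simp_all add: psl_simps)

lemma flip_map_4: "flip_map (flip_map (flip_map (flip_map W))) = W"
  by (cases W rule: flip_cases) (simp_all add: psl_simps)

lemma bij_flip_map: "bij flip_map"
  using flip_map_4 by (intro o_bij[of "flip_map \<circ> flip_map \<circ> flip_map"]) (auto simp: fun_eq_iff)

subsection \<open>The group generated by the flip and the automorphisms\<close>

text \<open>Composition on one side with the generators suffices, also for inverses, because the
  fourth power of \<open>flip_map\<close> is the identity.\<close>

inductive_set flip_group :: "(psl2z \<Rightarrow> psl2z) set" where
  id: "id \<in> flip_group"
| mult: "\<pi> \<in> flip_group \<Longrightarrow> (*) W \<circ> \<pi> \<in> flip_group"
| flip: "\<pi> \<in> flip_group \<Longrightarrow> flip_map \<circ> \<pi> \<in> flip_group"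

lemma flip_group_mult: "(*) W \<in> flip_group"
  using flip_group.mult[OF flip_group.id] by simp

lemma flip_group_flip: "flip_map \<in> flip_group"
  using flip_group.flip[OF flip_group.id] by simp

lemma flip_group_comp: "\<pi> \<in> flip_group \<Longrightarrow> \<tau> \<in> flip_group \<Longrightarrow> \<pi> \<circ> \<tau> \<in> flip_group"
  by (induction rule: flip_group.induct) (auto simp: comp_assoc intro: flip_group.intros)

lemma bij_psl_mult: "bij ((*) (W::psl2z))"
  by (rule o_bij[of "(*) (psl_inv W)"]) (auto simp: fun_eq_iff)

lemma inv_psl_mult: "Hilbert_Choice.inv ((*) W) = (*) (psl_inv W)"
  by (rule inv_unique_comp) (auto simp: fun_eq_iff)

lemma flip_group_bij: "\<pi> \<in> flip_group \<Longrightarrow> bij \<pi>"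
  by (induction rule: flip_group.induct) (blast intro: bij_id bij_comp bij_psl_mult bij_flip_map)+

lemma flip_group_inv: "\<pi> \<in> flip_group \<Longrightarrow> Hilbert_Choice.inv \<pi> \<in> flip_group"
proof (induction rule: flip_group.induct)
  case id
  then show ?case by (simp only: inv_id flip_group.id)
next
  case (mult \<pi> W)
  then show ?case
    by (metis o_inv_distrib bij_psl_mult flip_group_bij inv_psl_mult flip_group_comp flip_group_mult)
next
  case (flip \<pi>)
  have "Hilbert_Choice.inv flip_map = flip_map \<circ> flip_map \<circ> flip_map"
    using flip_map_4 by (intro inv_unique_comp) (auto simp: fun_eq_iff)
  then show ?case using flip
    by (metis o_inv_distrib bij_flip_map flip_group_bij flip_group_comp flip_group_flip)
qed

lemma flip_group_mult_S: "\<pi> \<in> flip_group \<Longrightarrow> \<pi> (W * S) = \<pi> W * S"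
  by (induction rule: flip_group.induct) (simp_all add: mult.assoc flip_map_mult_S)

subsection \<open>Permutations of pairs of twins\<close>

text \<open>If \<open>X\<close> and \<open>Y\<close> are twins, this just exchanges \<open>X\<close> and \<open>Y\<close>.\<close>

definition twin_swap :: "psl2z \<Rightarrow> psl2z \<Rightarrow> psl2z \<Rightarrow> psl2z" where
  "twin_swap X Y W = (if W = X then Y else if W = Y then X else
     if W = X * S then Y * S else if W = Y * S then X * S else W)"

lemma psl_mult_S_swap: "W * S = V \<longleftrightarrow> W = V * S"
  by (metis mult.assoc mult.right_neutral psl_S_S)

lemma psl_mult_S_S [simp]: "W * S * S = W"
  by (simp add: psl_simps)

lemma twin_swap_twin_swap: "twin_swap X Y (twin_swap X Y W) = W"
  by (auto simp: twin_swap_def psl_mult_S_swap split: if_splits)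

lemma bij_twin_swap: "bij (twin_swap X Y)"
  by (rule o_bij[of "twin_swap X Y"]) (auto simp: fun_eq_iff twin_swap_twin_swap)

lemma twin_swap_mult_S: "twin_swap X Y (W * S) = twin_swap X Y W * S"
  by (auto simp: twin_swap_def psl_mult_S_swap split: if_splits)

lemma twin_swap_conj:
  assumes "bij \<pi>" and S: "\<And>W. \<pi> (W * S) = \<pi> W * S"
  shows "\<pi> \<circ> twin_swap X Y \<circ> Hilbert_Choice.inv \<pi> = twin_swap (\<pi> X) (\<pi> Y)"
proof
  fix W
  have "\<pi> (twin_swap X Y V) = twin_swap (\<pi> X) (\<pi> Y) (\<pi> V)" for V
    using \<open>bij \<pi>\<close> by (auto simp: twin_swap_def inj_eq bij_is_inj simp flip: S)
  from this[of "Hilbert_Choice.inv \<pi> W"] show "(\<pi> \<circ> twin_swap X Y \<circ> Hilbert_Choice.inv \<pi>) W = twin_swap (\<pi> X) (\<pi> Y) W"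
    using \<open>bij \<pi>\<close> by (simp add: bij_is_surj surj_f_inv_f)
qed

lemma flip_group_conj_swap:
  assumes "\<pi> \<in> flip_group" "twin_swap X Y \<in> flip_group"
  shows "twin_swap (\<pi> X) (\<pi> Y) \<in> flip_group"
  using twin_swap_conj[of \<pi> X Y] assms flip_group_bij flip_group_mult_S flip_group_inv flip_group_comp
  by metis

lemma twin_swap_same: "twin_swap X X = id"
  by (auto simp: twin_swap_def fun_eq_iff)

text \<open>Two flips give the half turn of the four sides but fix 1 and \<open>S\<close>, whereas
  \<open>S\<close> exchanges these as well; the composite is trivial except on them.\<close>

lemma twin_swap_S_1: "twin_swap 1 S \<in> flip_group"
proof -
  have "((*) S \<circ> flip_map \<circ> flip_map) W = twin_swap 1 S W" for W
    by (cases W rule: flip_cases) (auto simp: twin_swap_def S_L_cone2_neq psl_simps)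
  then have "(*) S \<circ> flip_map \<circ> flip_map = twin_swap 1 S" by blast
  then show ?thesis by (metis flip_group_comp flip_group_flip flip_group_mult)
qed

text \<open>A pentagon with the twin pairs of 1 and \<open>L\<close> as diagonals: the branch at
  \<open>L\<close> from \<open>flip_cases\<close> is divided at its next vertex, which makes five
  sides.\<close>

lemma pentagon_cases:
  obtains "W \<in> {1, S, L, L * S}" | V where "V \<in> cone2" "W = L * (L * V)"
  | V where "V \<in> cone2" "W = S * (L * V)"
  | V where "V \<in> cone2" "W = S * (L * (L * V))"
  | V where "V \<in> cone2" "W = L * (S * (L * V))"
  | V where "V \<in> cone2" "W = L * (S * (L * (L * V)))"
proof (cases W rule: flip_cases)
  case (3 V)
  show ?thesis
  proof (cases V rule: flip_cases)
    case (3 X)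
    then show ?thesis using \<open>V \<in> cone2\<close> by simp
  next
    case (4 X)
    then show ?thesis using \<open>V \<in> cone2\<close> by simp
  qed (use 3 that in auto)
qed (use that in auto)

lemma pentagon_neqs:
  assumes "V \<in> cone2"
  shows "L * (L * V) \<notin> {1, S, L, L * S}"
    "S * (L * V) \<notin> {1, S, L, L * S}"
    "S * (L * (L * V)) \<notin> {1, S, L, L * S}"
    "L * (S * (L * V)) \<notin> {1, S, L, L * S}"
    "L * (S * (L * (L * V))) \<notin> {1, S, L, L * S}"
proof -
  have neq: "S * X \<noteq> Y" if "X \<in> cone" "Y \<in> cone" for X Y
    using that psl_cone_complement by metis
  show "L * (L * V) \<notin> {1, S, L, L * S}" using assms S_L_cone2_neq by auto
  show "S * (L * V) \<notin> {1, S, L, L * S}" "S * (L * (L * V)) \<notin> {1, S, L, L * S}"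
    using assms by (simp_all add: neq)
  show "L * (S * (L * V)) \<notin> {1, S, L, L * S}" "L * (S * (L * (L * V))) \<notin> {1, S, L, L * S}"
    using assms L_cone2_neq(1,2)[of "S * (L * V)"] L_cone2_neq(1,2)[of "S * (L * (L * V))"]
      S_L_cone2_neq(5)[of "S * (L * V)"] S_L_cone2_neq(5)[of "S * (L * (L * V))"]
    by (simp_all add: neq)
qed

lemma twin_swap_twin: "twin_swap W (W * S) \<in> flip_group"
  using flip_group_conj_swap[OF flip_group_mult twin_swap_S_1, of W] by simp

text \<open>The pentagon relation: five flips exchange the two inner edges of a pentagon,
  up to exchanging twins.\<close>

lemma twin_swap_1_L_S: "twin_swap 1 (L * S) \<in> flip_group"
proof -
  \<comment> \<open>\<open>F\<close> flips the diagonal at 1 and moves the other one, at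
    \<open>L\<close>, to 1, so its powers flip the diagonals alternately. It permutes the five sides
    in a 5-cycle and \<open>1, L * S, S, L\<close> in a 4-cycle; hence its fifth power fixes the
    sides and acts on the diagonals as \<open>F\<close> does.\<close>
  define F where "F = (*) (L * S) \<circ> flip_map"
  have F: "F \<in> flip_group" unfolding F_def by (intro flip_group_comp flip_group_mult flip_group_flip)
  have "F (F (F (F (F W)))) = twin_swap 1 (L * S) (twin_swap L (L * S) W)" for W
  proof (cases W rule: pentagon_cases)
    case 1
    then show ?thesis by (auto simp: F_def twin_swap_def psl_simps)
  next
    case (2 V)
    with pentagon_neqs[OF 2(1)] show ?thesis by (simp add: F_def twin_swap_def psl_simps)
  next
    case (3 V)
    with pentagon_neqs[OF 3(1)] show ?thesis by (simp add: F_def twin_swap_def psl_simps)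
  next
    case (4 V)
    with pentagon_neqs[OF 4(1)] show ?thesis by (simp add: F_def twin_swap_def psl_simps)
  next
    case (5 V)
    with pentagon_neqs[OF 5(1)] show ?thesis by (simp add: F_def twin_swap_def psl_simps)
  next
    case (6 V)
    with pentagon_neqs[OF 6(1)] show ?thesis by (simp add: F_def twin_swap_def psl_simps)
  qed
  then have "twin_swap 1 (L * S) = F \<circ> F \<circ> F \<circ> F \<circ> F \<circ> twin_swap L (L * S)"
    by (auto simp: fun_eq_iff twin_swap_twin_swap)
  then show ?thesis using F twin_swap_twin[of L] by (metis flip_group_comp)
qed

lemma twin_swap_1_L: "twin_swap 1 L \<in> flip_group"
proof -
  have "twin_swap L (L * S) 1 = 1" by (simp add: twin_swap_def psl_mult_S_swap)
  moreover have "twin_swap L (L * S) (L * S) = L" by (simp add: twin_swap_def)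
  ultimately show ?thesis
    using flip_group_conj_swap[OF twin_swap_twin[of L] twin_swap_1_L_S] by simp
qed

lemma twin_swap_mult_L: "twin_swap W (W * L) \<in> flip_group"
  using flip_group_conj_swap[OF flip_group_mult twin_swap_1_L, of W] by simp

text \<open>As for transpositions along a connected graph: conjugating the swap of 1 and
  \<open>W\<close> by the swap of \<open>W\<close> with a neighbour replaces \<open>W\<close> by the
  neighbour. The cases treated separately are those where the conjugating swap would move 1.\<close>

lemma twin_swap_1: "twin_swap 1 W \<in> flip_group"
proof (induction W rule: psl_induct)
  case 1
  then show ?case by (simp only: twin_swap_same flip_group.id)
next
  case (S W)
  consider "W = 1" | "W = S" | "W \<noteq> 1" "W \<noteq> S" by blast
  then show ?case
  proof cases
    case 1
    then show ?thesis by (simp add: twin_swap_S_1)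
  next
    case 2
    then show ?thesis by (simp only: twin_swap_same flip_group.id psl_S_S)
  next
    case 3
    then have "twin_swap W (W * S) 1 = 1" by (auto simp: twin_swap_def psl_mult_S_swap)
    moreover have "twin_swap W (W * S) W = W * S" by (simp add: twin_swap_def)
    ultimately show ?thesis
      using flip_group_conj_swap[OF twin_swap_twin[of W] S] by simp
  qed
next
  case (L W)
  consider "W = 1" | "W = S" | "W * L = 1" | "W * L = S" | "W \<noteq> 1" "W \<noteq> S" "W * L \<noteq> 1" "W * L \<noteq> S"
    by blast
  then show ?case
  proof cases
    case 1
    then show ?thesis by (simp add: twin_swap_1_L)
  next
    case 2
    have "S * L \<notin> cone" by simp
    then have "S * L \<noteq> 1" "S * L \<noteq> S" by (metis one_in_cone, simp)
    then have "twin_swap 1 S (S * L) = S * L" by (simp add: twin_swap_def psl_S_S)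
    moreover have "twin_swap 1 S S = 1" by (simp add: twin_swap_def)
    ultimately show ?thesis
      using 2 flip_group_conj_swap[OF twin_swap_S_1 twin_swap_mult_L[of S]] by simp
  next
    case 3
    then show ?thesis by (simp only: twin_swap_same flip_group.id)
  next
    case 4
    then show ?thesis by (simp add: twin_swap_S_1)
  next
    case 5
    then have "twin_swap W (W * L) 1 = 1" by (auto simp: twin_swap_def psl_mult_S_swap)
    moreover have "twin_swap W (W * L) W = W * L" by (simp add: twin_swap_def)
    ultimately show ?thesis
      using flip_group_conj_swap[OF twin_swap_mult_L[of W] L] by simp
  qed
qed

lemma twin_swap_in_flip_group: "twin_swap X Y \<in> flip_group"
  using flip_group_conj_swap[OF flip_group_mult twin_swap_1, of X "psl_inv X * Y"] by simp

text \<open>Swapping \<open>\<pi> X\<close> back to \<open>X\<close> moves nothing that was fixed,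
  so the support shrinks.\<close>

lemma finite_twin_perm_in_flip_group:
  assumes "bij \<pi>" "finite {W. \<pi> W \<noteq> W}" "\<And>W. \<pi> (W * S) = \<pi> W * S"
  shows "\<pi> \<in> flip_group"
  using assms
proof (induction "card {W. \<pi> W \<noteq> W}" arbitrary: \<pi> rule: less_induct)
  case less
  show ?case
  proof (cases "\<pi> = id")
    case False
    then obtain X where X: "\<pi> X \<noteq> X" by (auto simp: fun_eq_iff)
    define \<tau> where "\<tau> = twin_swap X (\<pi> X)"
    note inj = bij_is_inj[OF less.prems(1)]
    have fixed: "\<tau> (\<pi> W) = W" if "\<pi> W = W" for W
    proof -
      have "W \<noteq> X" using X that by auto
      moreover have "W \<noteq> \<pi> X" using X that inj by (metis injD)
      moreover have "W \<noteq> X * S" using X that less.prems(3)[of X] by auto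
      moreover have "W \<noteq> \<pi> X * S" using X that inj less.prems(3)[of X] by (metis injD psl_right_cancel)
      ultimately show ?thesis using that by (simp add: \<tau>_def twin_swap_def)
    qed
    have X_fixed: "\<tau> (\<pi> X) = X" by (simp add: \<tau>_def twin_swap_def)
    have "{W. (\<tau> \<circ> \<pi>) W \<noteq> W} \<subset> {W. \<pi> W \<noteq> W}"
      using fixed X_fixed X by auto
    then have "card {W. (\<tau> \<circ> \<pi>) W \<noteq> W} < card {W. \<pi> W \<noteq> W}" "finite {W. (\<tau> \<circ> \<pi>) W \<noteq> W}"
      using less.prems(2) by (auto intro: psubset_card_mono rev_finite_subset)
    then have "\<tau> \<circ> \<pi> \<in> flip_group"
      using less.prems
      by (intro less.hyps) (auto simp: \<tau>_def twin_swap_mult_S intro: bij_comp bij_twin_swap)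
    then have "\<tau> \<circ> (\<tau> \<circ> \<pi>) \<in> flip_group"
      unfolding \<tau>_def by (rule flip_group_comp[OF twin_swap_in_flip_group])
    moreover have "\<tau> \<circ> (\<tau> \<circ> \<pi>) = \<pi>"
      by (auto simp: fun_eq_iff \<tau>_def twin_swap_twin_swap)
    ultimately show ?thesis by (simp only:)
  qed (simp add: flip_group.id)
qed

subsection \<open>Permutations respecting cusps\<close>

lemma psl_T_1: "psl_T 1 = L * S"
  by transfer (simp add: mobius_equiv_def mat22_simps)

lemma psl_T_m1: "psl_T (- 1) = S * L * L"
  by transfer (simp add: mobius_equiv_def mat22_simps)

lemma psl_T_add: "psl_T (i + j) = psl_T i * psl_T j"
  by transfer (simp add: mobius_equiv_def mat22_simps)

lemma psl_T_add_left: "psl_T i * (psl_T j * W) = psl_T (i + j) * W"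
  by (simp add: psl_T_add mult.assoc)

lemmas psl_T_simps = mult.assoc psl_T_add_left psl_T_add[symmetric] psl_T_0

lemma psl_T_in_cone [simp]: "psl_T i \<in> cone \<longleftrightarrow> 0 \<le> i"
proof -
  have "psl_cone (psl_T i) \<longleftrightarrow> 0 \<le> i"
    by transfer (auto simp: mobius_equiv_def mat22_simps)
  then show ?thesis by (simp add: cone_def)
qed

lemma psl_T_eq_iff [simp]: "psl_T i = psl_T j \<longleftrightarrow> i = j"
  by transfer (auto simp: mobius_equiv_def mat22_simps)

lemma psl_L_S_T: "L * (S * psl_T i) = psl_T (i + 1)"
  using psl_T_add[of 1 i] by (simp add: psl_T_1 mult.assoc add.commute)

lemma psl_S_L_L_T: "S * (L * (L * psl_T i)) = psl_T (i - 1)"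
  using psl_T_add[of "-1" i] by (simp add: psl_T_m1 mult.assoc)

lemma psl_L_L_T: "L * (L * psl_T i) = S * psl_T (i - 1)"
  by (simp add: psl_S_S_left flip: psl_S_L_L_T)

lemma psl_T_S: "psl_T i * S = psl_T (i - 1) * L"
  using psl_T_Suc[of "i - 1"] by (simp add: psl_simps)

lemma S_T_in_cone2: "0 \<le> i \<Longrightarrow> S * psl_T i \<in> cone2"
  by (simp add: cone2_def)

lemma T_in_cone2: "i \<le> 0 \<Longrightarrow> psl_T i \<in> cone2"
  by (cases "i = 0") (simp_all add: cone2_def psl_T_0)

text \<open>
  Along the sequence \<open>W \<cdot> psl_T i\<close> the edges turn around a cusp.  A permutation that is an
  automorphism near infinity respects the cyclic order of the ends iff it sends the two ends of
  each such sequence to the two ends of another one.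
\<close>

definition cusp_at :: "(psl2z \<Rightarrow> psl2z) \<Rightarrow> psl2z \<Rightarrow> bool" where
  "cusp_at \<sigma> W \<longleftrightarrow> (\<exists>V k m. \<forall>i\<ge>m. \<sigma> (W * psl_T i) = V * psl_T (k + i) \<and>
     \<sigma> (W * psl_T (- i)) = V * psl_T (- i))"

definition cusp_perm :: "(psl2z \<Rightarrow> psl2z) \<Rightarrow> bool" where
  "cusp_perm \<sigma> \<longleftrightarrow> bij \<sigma> \<and> (\<forall>W. \<sigma> (W * S) = \<sigma> W * S) \<and>
     finite {W. \<sigma> (W * L) \<noteq> \<sigma> W * L} \<and> (\<forall>W. cusp_at \<sigma> W)"

lemma cusp_atI:
  assumes "\<And>i. m \<le> i \<Longrightarrow> \<sigma> (W * psl_T i) = V * psl_T (k + i)"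
    and "\<And>i. m \<le> i \<Longrightarrow> \<sigma> (W * psl_T (- i)) = V * psl_T (- i)"
  shows "cusp_at \<sigma> W"
  using assms unfolding cusp_at_def by blast

text \<open>The condition belongs to the sequence and not to its starting edge, so it has to be
  examined at one edge of each sequence only.\<close>

lemma cusp_at_shift:
  assumes "cusp_at \<sigma> (W * psl_T j)"
  shows "cusp_at \<sigma> W"
proof -
  obtain V k m where *: "\<And>i. i \<ge> m \<Longrightarrow> \<sigma> (W * psl_T (j + i)) = V * psl_T (k + i)"
    "\<And>i. i \<ge> m \<Longrightarrow> \<sigma> (W * psl_T (j - i)) = V * psl_T (- i)"
    using assms unfolding cusp_at_def by (auto simp: psl_T_simps)
  show ?thesis
  proof (rule cusp_atI[of "m + \<bar>j\<bar>" _ _ "V * psl_T (- j)" k])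
    fix i assume "m + \<bar>j\<bar> \<le> i"
    then show "\<sigma> (W * psl_T i) = V * psl_T (- j) * psl_T (k + i)"
      using *(1)[of "i - j"] by (simp add: psl_T_simps algebra_simps)
    show "\<sigma> (W * psl_T (- i)) = V * psl_T (- j) * psl_T (- i)"
      using *(2)[of "i + j"] \<open>m + \<bar>j\<bar> \<le> i\<close> by (simp add: psl_T_simps algebra_simps)
  qed
qed

lemma cusp_at_comp:
  assumes "cusp_at \<tau> W" and \<sigma>: "\<And>V. cusp_at \<sigma> V"
  shows "cusp_at (\<sigma> \<circ> \<tau>) W"
proof -
  obtain V k m where 1: "\<And>i. i \<ge> m \<Longrightarrow> \<tau> (W * psl_T i) = V * psl_T (k + i)"
    "\<And>i. i \<ge> m \<Longrightarrow> \<tau> (W * psl_T (- i)) = V * psl_T (- i)"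
    using assms(1) unfolding cusp_at_def by blast
  obtain V' k' m' where 2: "\<And>i. i \<ge> m' \<Longrightarrow> \<sigma> (V * psl_T i) = V' * psl_T (k' + i)"
    "\<And>i. i \<ge> m' \<Longrightarrow> \<sigma> (V * psl_T (- i)) = V' * psl_T (- i)"
    using \<sigma>[of V] unfolding cusp_at_def by blast
  \<comment> \<open>The outer map is evaluated at the positions \<open>k + i\<close>; the summand
    with the absolute value of \<open>k\<close> keeps them beyond \<open>m'\<close>.\<close>
  show ?thesis
    by (rule cusp_atI[of "max m (m' + \<bar>k\<bar>)" _ _ V' "k' + k"]) (auto simp: 1 2 add.assoc)
qed

lemma cusp_perm_comp:
  assumes "cusp_perm \<sigma>" "cusp_perm \<tau>"
  shows "cusp_perm (\<sigma> \<circ> \<tau>)"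
proof -
  have "{W. \<sigma> (\<tau> (W * L)) \<noteq> \<sigma> (\<tau> W) * L} \<subseteq>
      {W. \<tau> (W * L) \<noteq> \<tau> W * L} \<union> \<tau> -` {W. \<sigma> (W * L) \<noteq> \<sigma> W * L}"
    by auto
  moreover have "finite \<dots>"
    using assms by (intro finite_UnI finite_vimageI) (simp_all add: cusp_perm_def bij_is_inj)
  ultimately have "finite {W. \<sigma> (\<tau> (W * L)) \<noteq> \<sigma> (\<tau> W) * L}" by (rule finite_subset)
  then show ?thesis
    using assms cusp_at_comp[of \<tau> _ \<sigma>] by (auto simp: cusp_perm_def intro: bij_comp)
qed

lemma cusp_perm_mult: "cusp_perm ((*) W)"
  by (auto simp: cusp_perm_def bij_psl_mult mult.assoc
    intro!: cusp_atI[of 0 _ _ "W * V" 0 for V])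

lemma cusp_perm_id: "cusp_perm id"
proof -
  have "(*) (1::psl2z) = id" by auto
  then show ?thesis using cusp_perm_mult[of 1] by simp
qed

text \<open>Away from the six edges \<open>A\<close> at the two flipped vertices the flip commutes
  with \<open>S\<close> and \<open>L\<close>, so a sequence avoiding \<open>A\<close> is merely
  translated. The others pass the four corners of the square: those of \<open>L\<close> and
  \<open>L * L\<close> are computed, with shifts 1 and -1, and the symmetry \<open>S\<close> gives
  the opposite corners.\<close>

lemma cusp_at_flip_map: "cusp_at flip_map W"
proof -
  define A where "A = {1, L, L * L, S, S * L, S * (L * L)}"
  have L: "cusp_at flip_map L"
  proof (rule cusp_atI[of 1 _ _ "psl_T (- 1)" 1])
    fix i :: int assume "1 \<le> i"
    then have "flip_map (L * (L * (S * psl_T (i - 1)))) = L * (S * psl_T (i - 1))"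
      by (intro flip_map_simps S_T_in_cone2) simp
    then show "flip_map (L * psl_T i) = psl_T (- 1) * psl_T (1 + i)"
      by (simp add: psl_L_S_T psl_T_simps)
    show "flip_map (L * psl_T (- i)) = psl_T (- 1) * psl_T (- i)"
      using \<open>1 \<le> i\<close> by (simp add: T_in_cone2 psl_S_L_L_T psl_T_simps)
  qed
  have LL: "cusp_at flip_map (L * L)"
  proof (rule cusp_atI[of 2 _ _ L "- 1"])
    fix i :: int assume "2 \<le> i"
    then have "flip_map (S * (L * (S * psl_T (i - 2)))) = L * (L * (S * psl_T (i - 2)))"
      by (intro flip_map_simps S_T_in_cone2) simp
    moreover have "L * (L * psl_T i) = S * (L * (S * psl_T (i - 2)))"
      by (simp add: psl_L_S_T psl_L_L_T)
    ultimately show "flip_map (L * L * psl_T i) = L * psl_T (- 1 + i)"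
      by (simp add: mult.assoc psl_L_S_T)
    show "flip_map (L * L * psl_T (- i)) = L * psl_T (- i)"
      using \<open>2 \<le> i\<close> by (simp add: T_in_cone2 mult.assoc)
  qed
  have S_mult: "cusp_at flip_map (S * X)" if X: "cusp_at flip_map X" for X
  proof -
    obtain V k m where "\<And>i. i \<ge> m \<Longrightarrow> flip_map (X * psl_T i) = V * psl_T (k + i)"
      "\<And>i. i \<ge> m \<Longrightarrow> flip_map (X * psl_T (- i)) = V * psl_T (- i)"
      using X unfolding cusp_at_def by blast
    then show ?thesis
      by (intro cusp_atI[of m _ _ "S * V" k]) (simp_all add: mult.assoc flip_map_S_mult)
  qed
  have A: "cusp_at flip_map X" if "X \<in> A" for X
  proof -
    have "cusp_at flip_map S"
      using LL by (intro cusp_at_shift[of _ S "- 1"]) (simp add: psl_T_m1 psl_simps)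
    moreover from S_mult[OF this] have "cusp_at flip_map 1" by (simp add: psl_S_S)
    ultimately show ?thesis using that L LL S_mult[OF L] S_mult[OF LL] by (auto simp: A_def)
  qed
  show ?thesis
  proof (cases "\<exists>j. W * psl_T j \<in> A")
    case True
    then show ?thesis using A cusp_at_shift by blast
  next
    case False
    have step: "flip_map (W * psl_T (j + 1)) = flip_map (W * psl_T j) * (L * S)" for j
      using False flip_map_mult_L[of "W * psl_T j"] flip_map_mult_S[of "W * psl_T j * L"]
      by (simp add: psl_T_Suc mult.assoc A_def)
    have "flip_map (W * psl_T j) = flip_map W * psl_T j" for j
    proof (induction j rule: int_induct[of _ 0])
      case (step1 i)
      then show ?case using step[of i] by (simp add: psl_T_Suc mult.assoc)
    next
      case (step2 i)
      then have "flip_map (W * psl_T (i - 1)) * psl_T 1 = flip_map W * psl_T (i - 1) * psl_T 1"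
        using step[of "i - 1"] by (simp add: psl_T_simps psl_T_1[symmetric])
      then show ?case by simp
    qed (simp add: psl_T_0)
    then show ?thesis by (intro cusp_atI[of 0 _ _ "flip_map W" 0]) simp_all
  qed
qed

lemma cusp_perm_flip_map: "cusp_perm flip_map"
proof -
  have "{W. flip_map (W * L) \<noteq> flip_map W * L} \<subseteq> {1, L, L * L, S, S * L, S * (L * L)}"
    using flip_map_mult_L by blast
  then have "finite {W. flip_map (W * L) \<noteq> flip_map W * L}" by (rule finite_subset) simp
  then show ?thesis
    by (simp add: cusp_perm_def bij_flip_map flip_map_mult_S cusp_at_flip_map)
qed

lemma flip_group_cusp_perm: "\<pi> \<in> flip_group \<Longrightarrow> cusp_perm \<pi>"
  by (induction rule: flip_group.induct)
    (blast intro: cusp_perm_id cusp_perm_comp cusp_perm_mult cusp_perm_flip_map)+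

subsection \<open>Generation by flips\<close>

text \<open>A walk inside the branch of \<open>W\<close> uses \<open>L\<close> only at edges outside
  \<open>U\<close>, by convexity.\<close>

lemma cone_mult_equivariant:
  assumes U: "convex_edges U" "\<And>W. W \<notin> U \<Longrightarrow> \<sigma> (W * L) = \<sigma> W * L"
    and S: "\<And>W. \<sigma> (W * S) = \<sigma> W * S"
    and W: "W \<notin> U" "W * S \<in> U" and V: "V \<in> cone"
  shows "\<sigma> (W * V) = \<sigma> W * V"
  using V
proof (induction rule: cone_induct)
  case (S V)
  then show ?case using assms(3)[of "W * V"] by (simp add: mult.assoc)
next
  case (L V)
  then show ?case using U(2)[OF convex_edgesD[OF U(1) W L(1)]] by (simp add: mult.assoc)
qed simp

text \<open>Nothing is known about \<open>\<sigma>\<close> on \<open>U\<close> itself, but stars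
  outside \<open>U\<close> go to stars. Hence the image of \<open>U\<close> is again a union of
  stars, and the branches at its boundary are the images of those at the boundary of
  \<open>U\<close>.\<close>

lemma convex_edges_image:
  assumes U: "convex_edges U" "\<And>W. W \<notin> U \<Longrightarrow> \<sigma> (W * L) = \<sigma> W * L"
    and S: "\<And>W. \<sigma> (W * S) = \<sigma> W * S" and "bij \<sigma>"
  shows "convex_edges (\<sigma> ` U)"
  unfolding convex_edges_def
proof (intro conjI allI impI ballI)
  show "finite (\<sigma> ` U)" using U by (simp add: convex_edges_def)
next
  note inj = bij_is_inj[OF \<open>bij \<sigma>\<close>]
  fix X assume "X \<in> \<sigma> ` U"
  then obtain W where W: "W \<in> U" "X = \<sigma> W" by blast
  obtain V where V: "X * L = \<sigma> V" using bij_is_surj[OF \<open>bij \<sigma>\<close>] by blast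
  have "V \<in> U"
  proof (rule ccontr)
    assume "V \<notin> U"
    then have "\<sigma> (V * L * L) = \<sigma> V * L * L" using U convex_edges_L_iff by simp
    then have "\<sigma> (V * L * L) = X * L * L * L" by (simp only: V)
    then have "\<sigma> (V * L * L) = \<sigma> W" unfolding W(2) by (simp add: psl_simps)
    then have "V * L * L = W" using inj by (simp add: inj_eq)
    then show False using \<open>V \<notin> U\<close> W convex_edges_L_iff[OF U(1)] by metis
  qed
  then show "X * L \<in> \<sigma> ` U" using V by simp
next
  note inj = bij_is_inj[OF \<open>bij \<sigma>\<close>]
  fix X V assume X: "X \<notin> \<sigma> ` U" "X * S \<in> \<sigma> ` U" and V: "V \<in> cone"
  obtain W where W: "X = \<sigma> W" using bij_is_surj[OF \<open>bij \<sigma>\<close>] by blast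
  have "W \<notin> U" "W * S \<in> U" using X inj by (auto simp: W inj_image_mem_iff simp flip: S)
  then have "\<sigma> (W * V) = X * V" "W * V \<notin> U"
    using cone_mult_equivariant[OF assms(1-3) _ _ V] convex_edgesD[OF U(1) _ _ V] W by auto
  then show "X * V \<notin> \<sigma> ` U" using inj by (metis inj_image_mem_iff)
qed

text \<open>The sequence arrives through the branch of \<open>W * S\<close>, crosses
  \<open>U\<close> and leaves in the branch of \<open>W * psl_T k\<close>; on both outer parts
  \<open>\<sigma>\<close> is equivariant. Far out, the cusp condition puts the two images on one
  sequence. An offset \<open>j \<le> 0\<close> would repeat a value already taken on the incoming
  part.\<close>

lemma cusp_successor:
  assumes U: "convex_edges U" "\<And>W. W \<notin> U \<Longrightarrow> \<sigma> (W * L) = \<sigma> W * L"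
    and \<sigma>: "cusp_perm \<sigma>"
    and W: "W \<in> U" "W * S \<notin> U"
    and k: "0 < k" "W * psl_T k \<notin> U" "W * psl_T k * S \<in> U"
  obtains j where "0 < j" "\<sigma> (W * psl_T k) = \<sigma> W * psl_T j"
proof -
  have S: "\<And>W. \<sigma> (W * S) = \<sigma> W * S" and inj: "inj \<sigma>"
    using \<sigma> by (simp_all add: cusp_perm_def bij_is_inj)
  have backward: "\<sigma> (W * psl_T i) = \<sigma> W * psl_T i" if "i \<le> 0" for i
  proof (cases "i = 0")
    case False
    then have "\<sigma> (W * S * (S * psl_T i)) = \<sigma> (W * S) * (S * psl_T i)"
      using W that by (intro cone_mult_equivariant[OF U S]) simp_all
    then show ?thesis by (simp add: S psl_simps)
  qed (simp add: psl_T_0)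
  have forward: "\<sigma> (W * psl_T k * psl_T i) = \<sigma> (W * psl_T k) * psl_T i" if "0 \<le> i" for i
    using k that by (intro cone_mult_equivariant[OF U S]) simp_all
  obtain V k0 m where *: "\<And>i. i \<ge> m \<Longrightarrow> \<sigma> (W * psl_T i) = V * psl_T (k0 + i)"
    "\<And>i. i \<ge> m \<Longrightarrow> \<sigma> (W * psl_T (- i)) = V * psl_T (- i)"
    using \<sigma> unfolding cusp_perm_def cusp_at_def by blast
  define i where "i = max \<bar>m\<bar> k"
  have i: "m \<le> i" "0 \<le> i" "k \<le> i" by (auto simp: i_def)
  have "V = \<sigma> W" using *(2)[OF i(1)] backward[of "- i"] i by simp
  moreover have "\<sigma> (W * psl_T k) * psl_T (i - k) = V * psl_T (k0 + k) * psl_T (i - k)"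
    using *(1)[OF i(1)] forward[of "i - k"] i by (simp add: psl_T_simps algebra_simps)
  ultimately have j: "\<sigma> (W * psl_T k) = \<sigma> W * psl_T (k0 + k)" by simp
  have "0 < k0 + k"
  proof (rule ccontr)
    assume "\<not> 0 < k0 + k"
    then have "\<sigma> (W * psl_T k) = \<sigma> (W * psl_T (k0 + k))" using backward j by simp
    then show False using inj \<open>\<not> 0 < k0 + k\<close> k by (simp add: inj_eq)
  qed
  then show ?thesis using j that by blast
qed

lemma flip_group_cancel:
  assumes "\<pi> \<in> flip_group" "\<pi> \<circ> \<sigma> \<in> flip_group"
  shows "\<sigma> \<in> flip_group"
proof -
  have "Hilbert_Choice.inv \<pi> \<circ> (\<pi> \<circ> \<sigma>) = \<sigma>"
    using flip_group_bij[OF assms(1)] by (auto simp: fun_eq_iff bij_is_inj)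
  then show ?thesis using assms flip_group_inv flip_group_comp by metis
qed

lemma equivariant_imp_mult:
  assumes "\<And>W. \<sigma> (W * S) = \<sigma> W * S" "\<And>W. \<sigma> (W * L) = \<sigma> W * L"
  shows "\<sigma> = (*) (\<sigma> 1)"
proof
  show "\<sigma> W = \<sigma> 1 * W" for W
    by (induction W rule: psl_induct) (simp_all add: assms mult.assoc)
qed

text \<open>Exchanging at most two pairs of twins makes \<open>\<sigma>\<close> preserve the vertex of the ear as well.\<close>

lemma flip_group_remove_ear:
  assumes \<sigma>: "cusp_perm \<sigma>" and U: "convex_edges U" "\<And>X. X \<notin> U \<Longrightarrow> \<sigma> (X * L) = \<sigma> X * L"
    and W: "W \<in> U" "W * L * S \<notin> U" "W * L * L * S \<notin> U"
    and consecutive: "\<sigma> (W * L * L) = \<sigma> (W * L) * L"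
    and IH: "\<And>\<tau>. cusp_perm \<tau> \<Longrightarrow>
      (\<And>X. X \<notin> U - {W, W * L, W * L * L} \<Longrightarrow> \<tau> (X * L) = \<tau> X * L) \<Longrightarrow>
      \<tau> \<in> flip_group"
  shows "\<sigma> \<in> flip_group"
proof -
  have S: "\<And>X. \<sigma> (X * S) = \<sigma> X * S" and inj: "inj \<sigma>" and bij: "bij \<sigma>"
    using \<sigma> by (simp_all add: cusp_perm_def bij_is_inj)
  note image = convex_edges_image[OF U S bij]
  note mem = inj_image_mem_iff[OF inj]
  define h where "h = \<sigma> (W * L)"
  have WL: "W * L \<in> U" "W * L * L \<in> U" using W convex_edges_L_iff[OF U(1)] by simp_all
  have h: "h \<in> \<sigma> ` U" "h * L \<in> \<sigma> ` U" "h * L * L \<in> \<sigma> ` U"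
    using WL convex_edges_L_iff[OF image] by (simp_all add: h_def)
  have hS: "h * S \<notin> \<sigma> ` U" "h * L * S \<notin> \<sigma> ` U"
    using W consecutive by (simp_all add: h_def mem flip: S consecutive)
  \<comment> \<open>Three images in cyclic order make the vertex of \<open>W\<close> equivariant
    too, so \<open>IH\<close> for the smaller set applies.\<close>
  have three: "\<tau> \<in> flip_group"
    if \<tau>: "cusp_perm \<tau>" "\<And>X. X \<notin> U \<Longrightarrow> \<tau> (X * L) = \<tau> X * L"
      "\<tau> (W * L) = h" "\<tau> (W * L * L) = h * L" "\<tau> W = h * L * L" for \<tau>
  proof (rule IH[OF \<tau>(1)])
    fix X assume "X \<notin> U - {W, W * L, W * L * L}"
    then consider "X \<notin> U" | "X = W" | "X = W * L" | "X = W * L * L" by blast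
    then show "\<tau> (X * L) = \<tau> X * L"
      by cases (use \<tau> in \<open>simp_all add: psl_simps\<close>)
  qed
  show ?thesis
  proof (cases "\<sigma> W = h * L * L")
    case True
    then show ?thesis using three[OF \<sigma> U(2)] consecutive by (simp add: h_def)
  next
    case False
    \<comment> \<open>The edge that completes the star of \<open>h\<close> and \<open>h * L\<close>,
      and hence the desired image of \<open>W\<close>.\<close>
    define y where "y = h * L * L"
    define \<pi> where "\<pi> = twin_swap (\<sigma> W) y"
    \<comment> \<open>The swap also moves the twins of \<open>\<sigma> W\<close> and
      \<open>y\<close>. Both lie in the image of \<open>U\<close>: otherwise \<open>U\<close> or its
      image would be a single star, where \<open>y\<close> is the only place left for
      \<open>\<sigma> W\<close>. So the swap does nothing outside the image of
      \<open>U\<close>.\<close>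
    have "W * S \<in> U"
    proof (rule ccontr)
      assume "W * S \<notin> U"
      then have "U = {W, W * L, W * L * L}" using U W by (intro convex_edges_single)
      then have "\<sigma> ` U = {\<sigma> W, h, h * L}" using consecutive by (auto simp: h_def)
      then show False using h False by (auto simp: mult.assoc)
    qed
    have yS: "y * S \<in> \<sigma> ` U"
    proof (rule ccontr)
      assume "y * S \<notin> \<sigma> ` U"
      then have "\<sigma> ` U = {h, h * L, h * L * L}"
        using hS h by (intro convex_edges_single[OF image]) (simp_all add: y_def)
      then have "\<sigma> W \<in> {h, h * L}" using W False by auto
      then have "\<sigma> W \<in> {\<sigma> (W * L), \<sigma> (W * L * L)}" using consecutive by (simp add: h_def)
      then show False using inj by (auto simp: inj_eq mult.assoc)
    qed
    have fix_out: "\<pi> Z = Z" if "Z \<notin> \<sigma> ` U" for Z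
    proof -
      have "Z \<noteq> \<sigma> W" "Z \<noteq> y" "Z \<noteq> \<sigma> W * S" "Z \<noteq> y * S"
        using that W h yS \<open>W * S \<in> U\<close> by (auto simp: y_def simp flip: S)
      then show ?thesis by (simp add: \<pi>_def twin_swap_def)
    qed
    have fix_h: "\<pi> h = h" "\<pi> (h * L) = h * L"
    proof -
      have "h \<noteq> \<sigma> W" "h * L \<noteq> \<sigma> W"
        using inj consecutive by (auto simp: h_def inj_eq mult.assoc simp flip: consecutive)
      moreover have "h \<noteq> y" "h * L \<noteq> y" by (simp_all add: y_def mult.assoc)
      moreover have "h * S \<noteq> \<sigma> W" "h * L * S \<noteq> \<sigma> W" "h * S \<noteq> y" "h * L * S \<noteq> y"
        using hS W h by (auto simp: y_def)
      ultimately show "\<pi> h = h" "\<pi> (h * L) = h * L"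
        by (auto simp: \<pi>_def twin_swap_def psl_mult_S_swap)
    qed
    have \<pi>: "\<pi> \<in> flip_group" by (simp add: \<pi>_def twin_swap_in_flip_group)
    have "\<pi> \<circ> \<sigma> \<in> flip_group"
    proof (rule three)
      show "cusp_perm (\<pi> \<circ> \<sigma>)" by (rule cusp_perm_comp[OF flip_group_cusp_perm[OF \<pi>] \<sigma>])
      show "(\<pi> \<circ> \<sigma>) (X * L) = (\<pi> \<circ> \<sigma>) X * L" if "X \<notin> U" for X
      proof -
        have "\<pi> (\<sigma> X) = \<sigma> X" "\<pi> (\<sigma> (X * L)) = \<sigma> (X * L)"
          using that convex_edges_L_iff[OF U(1)] by (simp_all add: fix_out mem)
        then show ?thesis using U(2)[OF that] by simp
      qed
      show "(\<pi> \<circ> \<sigma>) (W * L) = h" "(\<pi> \<circ> \<sigma>) (W * L * L) = h * L" "(\<pi> \<circ> \<sigma>) W = h * L * L"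
        using fix_h consecutive by (simp_all add: h_def \<pi>_def y_def twin_swap_def)
    qed
    then show ?thesis by (rule flip_group_cancel[OF \<pi>])
  qed
qed

text \<open>Two nested inductions: on the size of \<open>U\<close> and, for a chosen ear, on the
  number of steps along the cusp from the image of \<open>W * L\<close> to that of the exit
  \<open>W * L * L * S\<close>. This number is positive by \<open>cusp_successor\<close>; when it is
  one, the images of \<open>W * L\<close> and \<open>W * L * L\<close> are consecutive at a
  vertex.\<close>

lemma cusp_perm_convex_in_flip_group:
  assumes "cusp_perm \<sigma>" "convex_edges U" "\<And>X. X \<notin> U \<Longrightarrow> \<sigma> (X * L) = \<sigma> X * L"
  shows "\<sigma> \<in> flip_group"
  using assms
proof (induction "card U" arbitrary: U \<sigma> rule: less_induct)
  case less
  show ?case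
  proof (cases "U = {}")
    case True
    then have "\<sigma> = (*) (\<sigma> 1)"
      using less.prems by (intro equivariant_imp_mult) (simp_all add: cusp_perm_def)
    then show ?thesis using flip_group_mult by metis
  next
    case False
    obtain W where W: "W \<in> U" "W * L * S \<notin> U" "W * L * L * S \<notin> U"
      and ear: "convex_edges (U - {W, W * L, W * L * L})"
      using convex_edges_ear[OF less.prems(2) False] .
    have card: "card (U - {W, W * L, W * L * L}) < card U"
      using W less.prems(2) by (intro psubset_card_mono) (auto simp: convex_edges_def)
    have WL: "W * L \<in> U" "W * L * L \<in> U" using W convex_edges_L_iff[OF less.prems(2)] by simp_all
    have shift: "\<sigma> \<in> flip_group"
      if "cusp_perm \<sigma>" "\<And>X. X \<notin> U \<Longrightarrow> \<sigma> (X * L) = \<sigma> X * L"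
        "\<sigma> (W * L * L * S) = \<sigma> (W * L) * psl_T (int n + 1)" for \<sigma> n
      using that
    proof (induction n arbitrary: \<sigma>)
      case 0
      have "\<sigma> (W * L * L) = \<sigma> (W * L) * L"
        using 0(1,3) by (simp add: cusp_perm_def psl_T_1 flip: mult.assoc)
      then show ?case
        using 0 W ear card less.prems(2) by (intro flip_group_remove_ear[of \<sigma> U W] less.hyps) auto
    next
      case (Suc n)
      have S: "\<And>X. \<sigma> (X * S) = \<sigma> X * S" and inj: "inj \<sigma>" and bij: "bij \<sigma>"
        using Suc.prems(1) by (simp_all add: cusp_perm_def bij_is_inj)
      note image = convex_edges_image[OF less.prems(2) Suc.prems(2) S bij]
      define h where "h = \<sigma> (W * L)"
      have h: "h \<in> \<sigma> ` U" "h * L \<in> \<sigma> ` U" "h * L * L \<in> \<sigma> ` U"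
        using WL convex_edges_L_iff[OF image] by (simp_all add: h_def)
      \<comment> \<open>At least two steps remain; if the sequence had already left the image of
        \<open>U\<close>, convexity would put \<open>\<sigma> (W * L * L)\<close> outside it as
        well.\<close>
      have hT: "h * L * S \<in> \<sigma> ` U"
      proof (rule ccontr)
        assume "h * L * S \<notin> \<sigma> ` U"
        then have "h * L * S * (psl_T (int n) * L) \<notin> \<sigma> ` U"
          using h by (rule_tac convex_edgesD[OF image]) simp_all
        moreover have "psl_T (int n) * L = psl_T (int n + 1) * S"
          by (simp add: psl_T_S)
        moreover have "\<sigma> (W * L * L) = h * psl_T (int (Suc n) + 1) * S"
          using Suc.prems(3) S[of "W * L * L"] by (simp add: h_def psl_mult_S_swap)
        ultimately have "\<sigma> (W * L * L) \<notin> \<sigma> ` U"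
          using psl_T_add[of 1 "int n + 1"] by (simp add: psl_T_1 mult.assoc algebra_simps)
        then show False using WL by blast
      qed
      \<comment> \<open>The flip at \<open>h * L\<close>, moved to 1, removes one step between the
        two images. The six edges where it is not equivariant come from the image of
        \<open>U\<close>, so nothing is lost outside \<open>U\<close>.\<close>
      define \<tau> where "\<tau> = flip_map \<circ> (*) (psl_inv (h * L))"
      have \<tau>: "\<tau> \<in> flip_group" unfolding \<tau>_def by (intro flip_group_comp flip_group_mult flip_group_flip)
      have inv: "psl_inv (h * L) * (h * X) = L * (L * X)" for X
        using psl_inv_left(1)[of "h * L" "L * (L * X)"] by (simp add: psl_simps)
      have "\<tau> \<circ> \<sigma> \<in> flip_group"
      proof (rule Suc.IH)
        show "cusp_perm (\<tau> \<circ> \<sigma>)"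
          by (rule cusp_perm_comp[OF flip_group_cusp_perm[OF \<tau>] Suc.prems(1)])
        show "(\<tau> \<circ> \<sigma>) (X * L) = (\<tau> \<circ> \<sigma>) X * L" if "X \<notin> U" for X
        proof -
          have "\<sigma> X \<notin> \<sigma> ` U" using that inj by (simp add: inj_image_mem_iff)
          moreover have "h * L * Y \<in> V" if "V = \<sigma> ` U" "Y \<in> {1, L, L * L, S, S * L, S * (L * L)}" for Y V
            using that(2) h hT convex_edges_L_iff[OF image, of "h * L * S"]
              convex_edges_L_iff[OF image, of "h * L * S * L"]
            unfolding that(1)[symmetric] by (auto simp: psl_simps)
          ultimately have "psl_inv (h * L) * \<sigma> X \<notin> {1, L, L * L, S, S * L, S * (L * L)}"
            by (metis psl_inv_left(2))
          then show ?thesis using Suc.prems(2)[OF that] flip_map_mult_L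
            by (simp add: \<tau>_def flip: mult.assoc)
        qed
        have eq: "int (Suc n) + 1 = int n + 2" by simp
        have "flip_map (S * (L * (S * psl_T (int n)))) = L * (L * (S * psl_T (int n)))"
          by (intro flip_map_simps S_T_in_cone2) simp
        then have "flip_map (L * (L * psl_T (int n + 2))) = L * psl_T (int n + 1)"
          by (simp add: psl_L_S_T psl_L_L_T add.commute)
        moreover have "(\<tau> \<circ> \<sigma>) (W * L * L * S) = flip_map (L * (L * psl_T (int n + 2)))"
          by (simp only: \<tau>_def comp_apply Suc.prems(3) eq inv flip: h_def)
        moreover have "(\<tau> \<circ> \<sigma>) (W * L) = L"
          using inv[of 1] by (simp add: \<tau>_def mult.assoc flip: h_def)
        ultimately show "(\<tau> \<circ> \<sigma>) (W * L * L * S) = (\<tau> \<circ> \<sigma>) (W * L) * psl_T (int n + 1)"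
          by (simp only:)
      qed
      then show ?case by (rule flip_group_cancel[OF \<tau>])
    qed
    have T: "W * L * psl_T 1 = W * L * L * S" by (simp add: psl_T_1 mult.assoc)
    obtain j where j: "0 < j" "\<sigma> (W * L * psl_T 1) = \<sigma> (W * L) * psl_T j"
      using cusp_successor[OF less.prems(2,3,1), of "W * L" 1] W WL unfolding T by auto
    show ?thesis
      using shift[of \<sigma> "nat (j - 1)"] less.prems j T by simp
  qed
qed

lemma flip_group_eq_cusp_perms: "flip_group = Collect cusp_perm"
proof -
  have "\<sigma> \<in> flip_group" if \<sigma>: "cusp_perm \<sigma>" for \<sigma>
  proof -
    have "finite {W. \<sigma> (W * L) \<noteq> \<sigma> W * L}" using \<sigma> by (simp add: cusp_perm_def)
    then obtain U where "convex_edges U" "{W. \<sigma> (W * L) \<noteq> \<sigma> W * L} \<subseteq> U"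
      using convex_edges_exists by blast
    then show ?thesis using \<sigma> by (intro cusp_perm_convex_in_flip_group[of \<sigma> U]) auto
  qed
  then show ?thesis using flip_group_cusp_perm by blast
qed

subsection \<open>Vertices and subtrees of the Farey tree\<close>

lemma farey_simps [simp]:
  "Edges farey = UNIV" "twin farey W = W * S" "nxt farey W = W * L"
  by (simp_all add: farey_def)

lemma vert2_farey: "vert2 farey W = {W, W * S}"
  by (simp add: vert2_def)

lemma vert3_farey: "vert3 farey W = {W, W * L, W * L * L}"
  by (simp add: vert3_def)

lemma vert_farey_self [simp]: "W \<in> vert2 farey W" "W \<in> vert3 farey W"
  by (simp_all add: vert2_def vert3_def)

lemma vert_in_Verts [simp]: "vert2 farey W \<in> Verts farey" "vert3 farey W \<in> Verts farey"
  by (simp_all add: Verts_def)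

lemma vert2_farey_S [simp]: "vert2 farey (W * S) = vert2 farey W"
  by (auto simp: vert2_farey psl_simps)

lemma vert3_farey_L [simp]: "vert3 farey (W * L) = vert3 farey W"
  by (auto simp: vert3_farey psl_simps)

lemma Verts_farey_cases:
  assumes "v \<in> Verts farey" "W \<in> v"
  shows "v = vert2 farey W \<or> v = vert3 farey W"
  using assms vert3_farey_L vert2_farey_S by (auto simp: Verts_def vert2_farey vert3_farey psl_simps)

lemma card_vert_farey: "card (vert2 farey W) = 2" "card (vert3 farey W) = 3"
  by (simp_all add: vert2_farey vert3_farey mult.assoc)

lemma vert2_neq_vert3 [simp]: "vert2 farey W \<noteq> vert3 farey V" "vert3 farey V \<noteq> vert2 farey W"
  using card_vert_farey[of W] card_vert_farey[of V] by auto

lemma rot_farey [simp]: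
  "rot farey (vert2 farey W) W = W * S" "rot farey (vert3 farey W) W = W * L"
  by (simp_all add: rot_def)

text \<open>A walk can leave a branch only at its root. Together with \<open>cone2_vert\<close> this
  makes \<open>X\<close> a cut edge of the tree.\<close>

lemma cone_vert:
  assumes v: "v \<in> Verts farey" "X * V \<in> v" and V: "V \<in> cone" and "v \<noteq> vert2 farey X"
  shows "v \<subseteq> (*) X ` cone"
  using Verts_farey_cases[OF v]
proof
  assume "v = vert2 farey (X * V)"
  moreover from this have "V \<noteq> 1" using assms(4) by auto
  ultimately show ?thesis using V by (auto simp: vert2_farey mult.assoc cone_mult_S)
next
  assume "v = vert3 farey (X * V)"
  then show ?thesis using V cone_mult_L[of V] cone_mult_L[of "V * L"]
    by (auto simp: vert3_farey mult.assoc)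
qed

lemma cone2_vert:
  assumes v: "v \<in> Verts farey" "X * V \<in> v" and V: "V \<in> cone2" and "v \<noteq> vert3 farey X"
  shows "v \<subseteq> (*) X ` cone2"
  using Verts_farey_cases[OF v]
proof
  assume "v = vert2 farey (X * V)"
  then show ?thesis using V by (auto simp: vert2_farey mult.assoc cone2_mult_S)
next
  assume *: "v = vert3 farey (X * V)"
  then have "V \<noteq> 1" using assms(4) by auto
  then have "V * L \<in> cone2" "V * L * L \<in> cone2" using V by (auto simp: cone2_def)
  then show ?thesis using V * by (auto simp: vert3_farey mult.assoc)
qed

lemma mult_cone_Int_cone2: "X * V \<in> (*) X ` cone \<Longrightarrow> X * V \<in> (*) X ` cone2 \<Longrightarrow> V = 1"
  by (auto simp: cone2_def)

abbreviation tree_edge :: "psl2z subgraph \<Rightarrow> (psl2z set \<times> psl2z set) set" where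
  "tree_edge T \<equiv> {(s, t). \<exists>x\<in>snd T. s \<in> fst T \<and> t \<in> fst T \<and> x \<in> s \<and> x \<in> t}"

abbreviation branch_step :: "psl2z subgraph \<Rightarrow> (psl2z \<times> psl2z) set" where
  "branch_step T \<equiv> {(z, z'). \<exists>v\<in>Verts farey - fst T. z \<in> v \<and> z' \<in> v}"

lemma finite_subtreeD:
  assumes "finite_subtree farey T"
  shows "fst T \<subseteq> Verts farey" "finite (fst T)" "finite (snd T)"
    "\<And>x v. x \<in> snd T \<Longrightarrow> v \<in> Verts farey \<Longrightarrow> x \<in> v \<Longrightarrow> v \<in> fst T"
    "\<And>u v. u \<in> fst T \<Longrightarrow> v \<in> fst T \<Longrightarrow> (u, v) \<in> (tree_edge T)\<^sup>*"
  using assms unfolding finite_subtree_def by blast+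

text \<open>\<open>T\<close> is connected without using the edge \<open>X\<close>, whereas every way
  out of this side leads through \<open>X\<close>.\<close>

lemma subtree_in_cone:
  assumes T: "finite_subtree farey T" and X: "X \<notin> snd T" "vert3 farey X \<in> fst T" and v: "v \<in> fst T"
  shows "v \<subseteq> (*) X ` cone"
  using finite_subtreeD(5)[OF T X(2) v]
proof (induction rule: rtrancl_induct)
  case base
  show ?case by (rule cone_vert[of _ _ 1]) simp_all
next
  case (step s t)
  then obtain z where z: "z \<in> snd T" "t \<in> fst T" "z \<in> s" "z \<in> t" by auto
  then obtain V where V: "z = X * V" "V \<in> cone" using step.IH by blast
  have "t \<noteq> vert2 farey X" using z X(1) V by (auto simp: vert2_farey)
  then show ?case using cone_vert z(2,4) V finite_subtreeD(1)[OF T] by blast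
qed

lemma subtree_in_cone2:
  assumes T: "finite_subtree farey T" and X: "X \<notin> snd T" "vert2 farey X \<in> fst T" and v: "v \<in> fst T"
  shows "v \<subseteq> (*) X ` cone2"
  using finite_subtreeD(5)[OF T X(2) v]
proof (induction rule: rtrancl_induct)
  case base
  show ?case by (rule cone2_vert[of _ _ 1]) simp_all
next
  case (step s t)
  then obtain z where z: "z \<in> snd T" "t \<in> fst T" "z \<in> s" "z \<in> t" by auto
  then obtain V where V: "z = X * V" "V \<in> cone2" using step.IH by blast
  have "t \<noteq> vert3 farey X"
    using z X(1) V L_cone2_neq(3,4)[of 1] by (auto simp: vert3_farey mult.assoc)
  then show ?case using cone2_vert z(2,4) V finite_subtreeD(1)[OF T] by blast
qed

lemma subtree_one_endpoint:
  assumes T: "finite_subtree farey T" and X: "X \<notin> snd T"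
  shows "\<not> (vert2 farey X \<in> fst T \<and> vert3 farey X \<in> fst T)"
  using subtree_in_cone[OF T X, of "vert2 farey X"] by (auto simp: vert2_farey)

text \<open>\<open>T\<close> lies on the side of \<open>X\<close> where its endpoint
  \<open>u\<close> is, the branch on the other side, and the two sides share only
  \<open>X\<close>.\<close>

lemma branch_unique_touching:
  assumes T: "finite_subtree farey T" and X: "X \<notin> snd T" "X \<in> u" "u \<in> fst T"
    and Y: "Y \<in> v" "v \<in> fst T" and path: "(X, Y) \<in> (branch_step T)\<^sup>*"
  shows "X = Y"
proof -
  have "u \<in> Verts farey" using X finite_subtreeD(1)[OF T] by blast
  then consider "u = vert3 farey X" | "u = vert2 farey X" using Verts_farey_cases X(2) by blast
  then show ?thesis
  proof cases
    case 1
    have "Y \<in> (*) X ` cone2"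
      using path
    proof (induction rule: rtrancl_induct)
      case base
      then show ?case by (auto intro: image_eqI[of _ _ 1])
    next
      case (step Z Z')
      then obtain w where "w \<in> Verts farey - fst T" "Z \<in> w" "Z' \<in> w" by auto
      then show ?case using step.IH cone2_vert[of w X] X(3) 1 by blast
    qed
    moreover have "Y \<in> (*) X ` cone" using subtree_in_cone[OF T X(1) _ Y(2)] X(3) 1 Y(1) by blast
    ultimately show ?thesis using mult_cone_Int_cone2 by force
  next
    case 2
    have "Y \<in> (*) X ` cone"
      using path
    proof (induction rule: rtrancl_induct)
      case base
      then show ?case by (auto intro: image_eqI[of _ _ 1])
    next
      case (step Z Z')
      then obtain w where "w \<in> Verts farey - fst T" "Z \<in> w" "Z' \<in> w" by auto
      then show ?case using step.IH cone_vert[of w X] X(3) 2 by blast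
    qed
    moreover have "Y \<in> (*) X ` cone2" using subtree_in_cone2[OF T X(1) _ Y(2)] X(3) 2 Y(1) by blast
    ultimately show ?thesis using mult_cone_Int_cone2 by force
  qed
qed

subsection \<open>Near-automorphisms respect cusps\<close>

text \<open>Half steps along a cusp sequence, matching the way \<open>contour\<close> alternates
  between vertices of degree 3 and 2; the parity of the index tells which kind is crossed
  next.\<close>

fun cusp_walk :: "psl2z \<Rightarrow> nat \<Rightarrow> psl2z" where
  "cusp_walk W 0 = W"
| "cusp_walk W (Suc n) = cusp_walk W n * (if even n then L else S)"

definition walk_vert :: "nat \<Rightarrow> psl2z \<Rightarrow> psl2z set" where
  "walk_vert n W = (if even n then vert3 farey W else vert2 farey W)"

lemma cusp_walk_even: "cusp_walk W (2 * n) = W * psl_T (int n)"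
  by (induction n) (simp_all add: psl_T_0 psl_T_Suc add.commute[of 1] mult.assoc)

lemma walk_vert_self [simp]: "W \<in> walk_vert n W" "walk_vert n W \<in> Verts farey"
  by (simp_all add: walk_vert_def)

lemma rot_walk_vert: "rot farey (walk_vert n (cusp_walk W n)) (cusp_walk W n) = cusp_walk W (Suc n)"
  by (simp add: walk_vert_def)

lemma walk_vert_Suc: "walk_vert n (cusp_walk W (Suc n)) = walk_vert n (cusp_walk W n)"
  by (simp add: walk_vert_def)

lemma walk_vert_Suc_neq: "walk_vert (Suc n) W \<noteq> walk_vert n V"
  by (simp add: walk_vert_def)

lemma walk_vert_cases:
  "v \<in> Verts farey \<Longrightarrow> W \<in> v \<Longrightarrow> v = walk_vert n W \<or> v = walk_vert (Suc n) W"
  using Verts_farey_cases by (auto simp: walk_vert_def)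

lemma subtree_walk_vert:
  assumes "finite_subtree farey T" "X \<notin> snd T" "walk_vert m X \<in> fst T" "walk_vert n X \<in> fst T"
  shows "even m \<longleftrightarrow> even n"
  using subtree_one_endpoint[OF assms(1,2)] assms(3,4) by (auto simp: walk_vert_def split: if_splits)

text \<open>A contour has no choice: after each turn it continues at the other endpoint of the new
  edge, which is the vertex crossed next by the walk.\<close>

lemma contour_walk:
  assumes T: "finite_subtree farey T" and "contour farey T v X Y"
    and "v = walk_vert n (cusp_walk V n)" "X = cusp_walk V n"
  shows "\<exists>m\<ge>n. Y = cusp_walk V (Suc m) \<and> walk_vert m Y \<in> fst T \<and> Y \<notin> snd T"
  using assms(2-)
proof (induction arbitrary: n rule: contour.induct)
  case (leave v x)
  then have "rot farey v x = cusp_walk V (Suc n)" by (simp only: rot_walk_vert)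
  then show ?case using leave by (intro exI[of _ n]) (auto simp: walk_vert_Suc simp del: cusp_walk.simps)
next
  case (follow v x w y)
  have rot: "rot farey v x = cusp_walk V (Suc n)" using follow.prems by (simp only: rot_walk_vert)
  have "w \<in> Verts farey" using follow.hyps finite_subtreeD(1)[OF T] by blast
  moreover have "cusp_walk V (Suc n) \<in> w" using follow.hyps rot by metis
  moreover have "w \<noteq> walk_vert n (cusp_walk V (Suc n))"
    using \<open>w \<noteq> v\<close> follow.prems(1) walk_vert_Suc by metis
  ultimately have w: "w = walk_vert (Suc n) (cusp_walk V (Suc n))"
    using walk_vert_cases by blast
  show ?case using follow.IH[OF w rot] Suc_leD by blast
qed

lemma walk_contour:
  assumes T: "finite_subtree farey T" and "j \<le> n" "walk_vert j (cusp_walk W j) \<in> fst T"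
    and "\<And>i. j < i \<Longrightarrow> i \<le> n \<Longrightarrow> cusp_walk W i \<in> snd T" "cusp_walk W (Suc n) \<notin> snd T"
  shows "contour farey T (walk_vert j (cusp_walk W j)) (cusp_walk W j) (cusp_walk W (Suc n))"
  using assms(2-4)
proof (induction j rule: inc_induct)
  case base
  then show ?case
    using contour.leave[of "walk_vert n (cusp_walk W n)" T "cusp_walk W n" farey] assms(5)
    unfolding rot_walk_vert by simp
next
  case (step j)
  have "cusp_walk W (Suc j) \<in> snd T" using step by (simp del: cusp_walk.simps)
  then have "walk_vert (Suc j) (cusp_walk W (Suc j)) \<in> fst T"
    using finite_subtreeD(4)[OF T] walk_vert_self by blast
  then have "contour farey T (walk_vert (Suc j) (cusp_walk W (Suc j))) (cusp_walk W (Suc j)) (cusp_walk W (Suc n))"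
    using step by (simp del: cusp_walk.simps)
  then show ?case
    using contour.follow[of "walk_vert j (cusp_walk W j)" T "cusp_walk W j" farey
        "walk_vert (Suc j) (cusp_walk W (Suc j))" "cusp_walk W (Suc n)"]
      step.prems \<open>cusp_walk W (Suc j) \<in> snd T\<close> \<open>walk_vert (Suc j) (cusp_walk W (Suc j)) \<in> fst T\<close>
    unfolding rot_walk_vert by (simp add: walk_vert_Suc_neq del: cusp_walk.simps)
qed

lemma branch_mem:
  assumes "x \<notin> snd T"
  shows "{y. y \<notin> snd T \<and> (x, y) \<in> (branch_step T)\<^sup>*} \<in> branches farey T"
  unfolding branches_def quotient_def using assms by auto

lemma sym_branch_step: "sym ((branch_step T)\<^sup>*)"
  by (rule sym_rtrancl) (auto simp: sym_def)

lemma branch_connected: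
  assumes "A \<in> branches farey T" "x \<in> A" "y \<in> A"
  shows "x \<notin> snd T" "(x, y) \<in> (branch_step T)\<^sup>*"
proof -
  obtain z where A: "A = {y. z \<notin> snd T \<and> y \<notin> snd T \<and> (z, y) \<in> (branch_step T)\<^sup>*}"
    using assms(1) unfolding branches_def quotient_def by auto
  then show "x \<notin> snd T" using assms by blast
  have "(z, x) \<in> (branch_step T)\<^sup>*" "(z, y) \<in> (branch_step T)\<^sup>*" using assms A by blast+
  then show "(x, y) \<in> (branch_step T)\<^sup>*"
    using sym_branch_step[of T] by (meson rtrancl_trans symD)
qed

context
  fixes \<sigma> T1 T2
  assumes bij: "bij \<sigma>" and twin: "\<And>W. \<sigma> (W * S) = \<sigma> W * S"
    and T1: "finite_subtree farey T1" and T2: "finite_subtree farey T2"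
    and iso: "branch_iso farey T1 T2 \<sigma>"
begin

lemma near_edges_iff: "\<sigma> X \<in> snd T2 \<longleftrightarrow> X \<in> snd T1"
proof -
  have img: "\<sigma> ` (- snd T1) = - snd T2"
    using iso by (simp add: branch_iso_def bij_betw_def Compl_eq_Diff_UNIV)
  have "\<sigma> X \<in> - snd T2 \<longleftrightarrow> X \<in> - snd T1"
    unfolding img[symmetric] using bij by (simp add: inj_image_mem_iff bij_is_inj)
  then show ?thesis by simp
qed

text \<open>\<open>branch_iso\<close> does not mention degrees of vertices; that they are preserved
  follows by counting edges.\<close>

lemma near_vert:
  assumes "vert3 farey X \<notin> fst T1"
  shows "\<sigma> (X * L) = \<sigma> X * L" "vert3 farey (\<sigma> X) \<notin> fst T2" "\<sigma> ` vert3 farey X = vert3 farey (\<sigma> X)"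
proof -
  have v: "\<sigma> ` vert3 farey X \<in> Verts farey - fst T2"
    using iso assms by (auto simp: branch_iso_def bij_betw_def)
  have "card (\<sigma> ` vert3 farey X) = 3"
    using bij card_vert_farey(2)[of X] by (metis bij_is_inj card_image inj_on_subset subset_UNIV)
  then show eq: "\<sigma> ` vert3 farey X = vert3 farey (\<sigma> X)"
    using Verts_farey_cases[of "\<sigma> ` vert3 farey X" "\<sigma> X"] v card_vert_farey(1)[of "\<sigma> X"] by auto
  then show "vert3 farey (\<sigma> X) \<notin> fst T2" using v by auto
  have "\<sigma> (rot farey (vert3 farey X) X) = rot farey (\<sigma> ` vert3 farey X) (\<sigma> X)"
    using iso assms vert_in_Verts(2)[of X] vert_farey_self(2)[of X] unfolding branch_iso_def by blast
  then show "\<sigma> (X * L) = \<sigma> X * L" by (simp add: eq)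
qed

lemma near_vert3_iff: "vert3 farey (\<sigma> X) \<in> fst T2 \<longleftrightarrow> vert3 farey X \<in> fst T1"
proof
  assume *: "vert3 farey X \<in> fst T1"
  show "vert3 farey (\<sigma> X) \<in> fst T2"
  proof (rule ccontr)
    assume "vert3 farey (\<sigma> X) \<notin> fst T2"
    then obtain v where v: "v \<in> Verts farey - fst T1" "\<sigma> ` v = vert3 farey (\<sigma> X)"
      using iso unfolding branch_iso_def bij_betw_def by (metis (no_types, lifting) Diff_iff imageE vert_in_Verts(2))
    then have "X \<in> v" using bij by (metis bij_is_inj inj_image_mem_iff vert_farey_self(2))
    moreover have "card v = 3"
      using v(2) bij card_vert_farey(2)[of "\<sigma> X"] by (metis bij_is_inj card_image inj_on_subset subset_UNIV)
    ultimately have "v = vert3 farey X"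
      using v Verts_farey_cases[of v X] card_vert_farey(1)[of X] by auto
    then show False using v * by simp
  qed
qed (use near_vert(2) in blast)

lemma near_vert2_iff: "vert2 farey (\<sigma> X) \<in> fst T2 \<longleftrightarrow> vert2 farey X \<in> fst T1"
proof -
  have img: "image \<sigma> ` (Verts farey - fst T1) = Verts farey - fst T2"
    using iso by (simp add: branch_iso_def bij_betw_def)
  have eq: "vert2 farey (\<sigma> X) = \<sigma> ` vert2 farey X" by (simp add: vert2_farey twin)
  have "\<sigma> ` vert2 farey X \<in> Verts farey - fst T2 \<longleftrightarrow> vert2 farey X \<in> Verts farey - fst T1"
    unfolding img[symmetric] using bij by (auto simp: inj_image_eq_iff bij_is_inj)
  then show ?thesis unfolding eq[symmetric] by simp
qed

lemma near_walk_vert_iff: "walk_vert n (\<sigma> X) \<in> fst T2 \<longleftrightarrow> walk_vert n X \<in> fst T1"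
  by (simp add: walk_vert_def near_vert3_iff near_vert2_iff)

text \<open>Here the cyclic order of the branches enters. The contour makes the branch of
  \<open>Y\<close> the successor of the starting branch, so the same holds for the images at
  \<open>T2\<close>. Since a branch touches the subtree in one edge only, the contour found there
  joins the images of the two edges, and it is a stretch of a cusp walk.\<close>

lemma near_contour_walk:
  assumes x: "cusp_walk W j \<notin> snd T1" "walk_vert j (cusp_walk W j) \<in> fst T1"
    and y: "Y \<notin> snd T1" "walk_vert n Y \<in> fst T1"
    and c: "contour farey T1 (walk_vert j (cusp_walk W j)) (cusp_walk W j) Y"
    and V: "\<sigma> (cusp_walk W j) = cusp_walk V m" "even m \<longleftrightarrow> even j"
  shows "\<exists>k. \<sigma> Y = cusp_walk V (Suc k) \<and> (even k \<longleftrightarrow> even n)"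
proof -
  define X where "X = cusp_walk W j"
  define A where "A = {z. z \<notin> snd T1 \<and> (X, z) \<in> (branch_step T1)\<^sup>*}"
  define B where "B = {z. z \<notin> snd T1 \<and> (Y, z) \<in> (branch_step T1)\<^sup>*}"
  have mem: "A \<in> branches farey T1" "B \<in> branches farey T1" "X \<in> A" "Y \<in> B"
    using x y branch_mem[of X T1] branch_mem[of Y T1] by (auto simp: A_def B_def X_def)
  then have "next_branch farey T1 A B"
    unfolding next_branch_def using c x walk_vert_self(1)[of X j] unfolding X_def by blast
  then have "next_branch farey T2 (\<sigma> ` A) (\<sigma> ` B)"
    using iso mem unfolding branch_iso_def by blast
  then obtain v x' y' where *: "\<sigma> ` A \<in> branches farey T2" "\<sigma> ` B \<in> branches farey T2"
    "v \<in> fst T2" "x' \<in> \<sigma> ` A" "x' \<in> v" "y' \<in> \<sigma> ` B" "contour farey T2 v x' y'"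
    unfolding next_branch_def by blast
  have X2: "walk_vert j (\<sigma> X) \<in> fst T2" "\<sigma> X \<notin> snd T2"
    and Y2: "walk_vert n (\<sigma> Y) \<in> fst T2" "\<sigma> Y \<notin> snd T2"
    using x y by (simp_all add: near_walk_vert_iff near_edges_iff X_def)
  have x': "x' = \<sigma> X"
    using branch_unique_touching[OF T2 _ *(5,3) walk_vert_self(1) X2(1)]
      branch_connected[OF *(1,4), of "\<sigma> X"] mem by blast
  have "v \<in> Verts farey" using *(3) finite_subtreeD(1)[OF T2] by blast
  then have v: "v = walk_vert m (cusp_walk V m)"
    using walk_vert_cases[of v "\<sigma> X" m] *(3,5) subtree_walk_vert[OF T2 X2(2,1), of "Suc m"] V x'
    by (auto simp: X_def)
  obtain k where k: "k \<ge> m" "y' = cusp_walk V (Suc k)" "walk_vert k y' \<in> fst T2" "y' \<notin> snd T2"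
    using contour_walk[OF T2 *(7) v] x' V X_def by blast
  have "y' = \<sigma> Y"
    using branch_unique_touching[OF T2 k(4) walk_vert_self(1) k(3) walk_vert_self(1) Y2(1)]
      branch_connected[OF *(2,6), of "\<sigma> Y"] mem by blast
  then show ?thesis using k subtree_walk_vert[OF T2 Y2(2) _ Y2(1), of k] by blast
qed

lemma near_walk:
  assumes "W \<notin> snd T1" "cusp_walk W n \<notin> snd T1"
  shows "\<exists>m. \<sigma> (cusp_walk W n) = cusp_walk (\<sigma> W) m \<and> (even m \<longleftrightarrow> even n)"
  using assms(2)
proof (induction n rule: less_induct)
  case (less n)
  show ?case
  proof (cases n)
    case 0
    then show ?thesis by (intro exI[of _ 0]) simp
  next
    case (Suc n')
    show ?thesis
    proof (cases "cusp_walk W n' \<notin> snd T1 \<and> walk_vert n' (cusp_walk W n') \<notin> fst T1")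
      case True
      then obtain m where m: "\<sigma> (cusp_walk W n') = cusp_walk (\<sigma> W) m" "even m \<longleftrightarrow> even n'"
        using less.IH[of n'] Suc by auto
      have "\<sigma> (cusp_walk W n) = cusp_walk (\<sigma> W) (Suc m)"
        using m True near_vert(1)[of "cusp_walk W n'"] by (auto simp: Suc twin walk_vert_def)
      then show ?thesis using m Suc by (intro exI[of _ "Suc m"]) auto
    next
      case False
      \<comment> \<open>The last edge outside \<open>T1\<close> before position \<open>n\<close>.
        From there to \<open>n\<close> the walk is a contour of \<open>T1\<close>, which is crossed
        in one go.\<close>
      define j where "j = (GREATEST j. j \<le> n' \<and> cusp_walk W j \<notin> snd T1)"
      have ex: "0 \<le> n' \<and> cusp_walk W 0 \<notin> snd T1" using assms(1) by simp
      have j: "j \<le> n'" "cusp_walk W j \<notin> snd T1"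
        using GreatestI_nat[of "\<lambda>j. j \<le> n' \<and> cusp_walk W j \<notin> snd T1", OF ex, of n'] by (auto simp: j_def)
      have inside: "cusp_walk W i \<in> snd T1" if "j < i" "i \<le> n'" for i
      proof (rule ccontr)
        assume "cusp_walk W i \<notin> snd T1"
        then have "i \<le> j"
          using Greatest_le_nat[of "\<lambda>j. j \<le> n' \<and> cusp_walk W j \<notin> snd T1" i n'] that by (simp add: j_def)
        then show False using that by simp
      qed
      have vert_inside: "walk_vert i (cusp_walk W (Suc i)) \<in> fst T1" if "j \<le> i" "i \<le> n'" for i
      proof (cases "i = n'")
        case True
        show ?thesis
        proof (cases "j = n'")
          case True
          then show ?thesis using False j \<open>i = n'\<close> walk_vert_Suc by metis
        next
          case False
          then have "cusp_walk W i \<in> snd T1" using inside[of i] that j \<open>i = n'\<close> by simp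
          then show ?thesis unfolding walk_vert_Suc using finite_subtreeD(4)[OF T1] walk_vert_self by blast
        qed
      next
        case False
        then have "cusp_walk W (Suc i) \<in> snd T1" using inside[of "Suc i"] that by simp
        then show ?thesis using finite_subtreeD(4)[OF T1] walk_vert_self by blast
      qed
      obtain m where m: "\<sigma> (cusp_walk W j) = cusp_walk (\<sigma> W) m" "even m \<longleftrightarrow> even j"
        using less.IH[of j] j Suc by auto
      have "contour farey T1 (walk_vert j (cusp_walk W j)) (cusp_walk W j) (cusp_walk W n)"
        unfolding Suc
        using j inside vert_inside[of j] less.prems Suc by (intro walk_contour[OF T1]) (auto simp: walk_vert_Suc simp del: cusp_walk.simps)
      then obtain k where "\<sigma> (cusp_walk W n) = cusp_walk (\<sigma> W) (Suc k)" "even k \<longleftrightarrow> even n'"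
        using near_contour_walk[OF j(2) _ less.prems, of n'] vert_inside[of j] vert_inside[of n'] j m Suc
        unfolding walk_vert_Suc by (auto simp: walk_vert_Suc simp del: cusp_walk.simps)
      then show ?thesis using Suc by (intro exI[of _ "Suc k"]) simp
    qed
  qed
qed

text \<open>Beyond \<open>M\<close> in both directions the sequence avoids \<open>T1\<close> and is
  only translated; \<open>near_walk\<close> shows that the two translated parts lie on one
  sequence.\<close>

lemma near_cusp_at: "cusp_at \<sigma> W"
proof -
  define F where "F = snd T1 \<union> {X. vert3 farey X \<in> fst T1}"
  have "{X. vert3 farey X \<in> fst T1} \<subseteq> \<Union> {v \<in> fst T1. finite v}"
    by (auto intro!: exI[of _ "vert3 farey X" for X] simp: vert3_farey)
  moreover have "finite (\<Union> {v \<in> fst T1. finite v})" using finite_subtreeD(2)[OF T1] by auto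
  ultimately have "finite F" using finite_subtreeD(3)[OF T1] finite_subset by (auto simp: F_def)
  then have fin: "finite (abs ` ((\<lambda>i. W * psl_T i) -` F))"
    by (intro finite_imageI finite_vimageI) (auto simp: inj_def)
  define m where "m = Max (insert 0 (abs ` ((\<lambda>i. W * psl_T i) -` F))) + 1"
  have m: "\<bar>i\<bar> < m" if "W * psl_T i \<in> F" for i
  proof -
    have "\<bar>i\<bar> \<le> Max (insert 0 (abs ` ((\<lambda>i. W * psl_T i) -` F)))"
      using that fin by (intro Max_ge) auto
    then show ?thesis by (simp add: m_def)
  qed
  have succ: "\<sigma> (W * psl_T (i + 1)) = \<sigma> (W * psl_T i) * psl_T 1" if "m \<le> \<bar>i\<bar>" for i
    using near_vert(1)[of "W * psl_T i"] m[of i] that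
    by (auto simp: F_def psl_T_Suc twin psl_T_1 simp flip: mult.assoc)
  define M where "M = \<bar>m\<bar>"
  have M: "m \<le> M" "0 \<le> M" by (auto simp: M_def)
  have fwd: "\<sigma> (W * psl_T i) = \<sigma> (W * psl_T M) * psl_T (i - M)" if "M \<le> i" for i
    using that
  proof (induction i rule: int_ge_induct)
    case (step i)
    then show ?case using succ[of i] M by (simp add: psl_T_simps algebra_simps)
  qed (simp add: psl_T_0)
  have bwd: "\<sigma> (W * psl_T i) = \<sigma> (W * psl_T (- M)) * psl_T (i + M)" if "i \<le> - M" for i
    using that
  proof (induction i rule: int_le_induct)
    case (step i)
    have "\<sigma> (W * psl_T i) = \<sigma> (W * psl_T (i - 1)) * psl_T 1"
      using succ[of "i - 1"] M step by simp
    then have "\<sigma> (W * psl_T (i - 1)) = \<sigma> (W * psl_T i) * psl_T (- 1)" by (simp add: psl_T_simps)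
    then show ?case using step by (simp add: psl_T_simps algebra_simps)
  qed (simp add: psl_T_0)
  have out: "W * psl_T M \<notin> snd T1" "W * psl_T (- M) \<notin> snd T1"
    using m[of M] m[of "- M"] M by (auto simp: F_def)
  \<comment> \<open>There are \<open>2 * M\<close> positions in between and two half steps for each;
    evenness turns the half steps in the image into a power of the translation.\<close>
  have walk: "cusp_walk (W * psl_T (- M)) (2 * nat (2 * M)) = W * psl_T M"
    unfolding cusp_walk_even using M by (simp add: psl_T_simps)
  obtain k where "\<sigma> (W * psl_T M) = cusp_walk (\<sigma> (W * psl_T (- M))) k" "even k"
    using near_walk[of "W * psl_T (- M)" "2 * nat (2 * M)"] out unfolding walk by auto
  then obtain n where n: "\<sigma> (W * psl_T M) = \<sigma> (W * psl_T (- M)) * psl_T (int n)"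
    using cusp_walk_even by (metis evenE)
  \<comment> \<open>\<open>V\<close> is chosen so that the negative end has no shift;
    \<open>2 * M\<close> steps in the source become \<open>n\<close> steps in the image, which gives
    the shift of the positive end.\<close>
  show ?thesis
  proof (rule cusp_atI[of M _ _ "\<sigma> (W * psl_T (- M)) * psl_T M" "int n - 2 * M"])
    fix i assume i: "M \<le> i"
    show "\<sigma> (W * psl_T i) = \<sigma> (W * psl_T (- M)) * psl_T M * psl_T (int n - 2 * M + i)"
      unfolding fwd[OF i] n by (simp add: psl_T_simps algebra_simps)
    have "- i \<le> - M" using i by simp
    show "\<sigma> (W * psl_T (- i)) = \<sigma> (W * psl_T (- M)) * psl_T M * psl_T (- i)"
      unfolding bwd[OF \<open>- i \<le> - M\<close>] by (simp add: psl_T_simps algebra_simps)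
  qed
qed

lemma near_finite: "finite {W. \<sigma> (W * L) \<noteq> \<sigma> W * L}"
proof -
  have "{W. \<sigma> (W * L) \<noteq> \<sigma> W * L} \<subseteq> \<Union> {v \<in> fst T1. finite v}"
    using near_vert(1) by (auto intro!: exI[of _ "vert3 farey X" for X] simp: vert3_farey)
  moreover have "finite (\<Union> {v \<in> fst T1. finite v})" using finite_subtreeD(2)[OF T1] by auto
  ultimately show ?thesis by (rule finite_subset)
qed

end

lemma near_aut_cusp_perm: "near_aut \<sigma> \<Longrightarrow> cusp_perm \<sigma>"
  unfolding near_aut_def cusp_perm_def using near_cusp_at near_finite by (auto simp: farey_simps)

subsection \<open>Subtrees spanned by convex sets\<close>

text \<open>Since all vertices meeting \<open>U\<close> are taken, for convex \<open>U\<close> the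
  subtree ends in vertices of degree 2, and its branches begin with the edges \<open>W\<close>
  outside \<open>U\<close> whose twins are in \<open>U\<close>.\<close>

definition spanned_subtree :: "psl2z set \<Rightarrow> psl2z subgraph" where
  "spanned_subtree U = ({v \<in> Verts farey. v \<inter> U \<noteq> {}}, U)"

lemma spanned_subtree_simps [simp]:
  "snd (spanned_subtree U) = U"
  "v \<in> fst (spanned_subtree U) \<longleftrightarrow> v \<in> Verts farey \<and> v \<inter> U \<noteq> {}"
  by (simp_all add: spanned_subtree_def)

lemma vert_meets [simp]:
  "X \<in> U \<Longrightarrow> vert2 farey X \<inter> U \<noteq> {}" "X \<in> U \<Longrightarrow> vert3 farey X \<inter> U \<noteq> {}"
  by (auto simp: vert2_farey vert3_farey)

lemma convex_vert3_disjoint_iff: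
  "convex_edges U \<Longrightarrow> vert3 farey X \<inter> U = {} \<longleftrightarrow> X \<notin> U"
  by (auto simp: vert3_farey convex_edges_L_iff)

text \<open>A walk that leaves \<open>U\<close> enters a branch and can return only where it left.
  Remembering \<open>P\<close> at that edge keeps an invariant of the steps inside \<open>U\<close>
  available on return.\<close>

lemma convex_edges_walk:
  assumes U: "convex_edges U" "X \<in> U" and P: "P X"
    "\<And>Z. Z \<in> U \<Longrightarrow> P Z \<Longrightarrow> P (Z * L)" "\<And>Z. Z \<in> U \<Longrightarrow> Z * S \<in> U \<Longrightarrow> P Z \<Longrightarrow> P (Z * S)"
  shows "X * V \<in> U \<and> P (X * V) \<or>
    (\<exists>W Y. W \<notin> U \<and> W * S \<in> U \<and> P (W * S) \<and> Y \<in> cone \<and> X * V = W * Y)"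
proof (induction V rule: psl_induct)
  case (S V)
  then show ?case
  proof (elim disjE exE conjE)
    assume *: "X * V \<in> U" "P (X * V)"
    show ?thesis
    proof (cases "X * (V * S) \<in> U")
      case True
      then show ?thesis using P(3)[of "X * V"] * by (simp add: mult.assoc)
    next
      case False
      moreover have "X * (V * S) * S = X * V" by (simp add: psl_simps)
      ultimately show ?thesis using * by (intro disjI2 exI[of _ "X * (V * S)"] exI[of _ 1]) simp
    qed
  next
    fix W Y
    assume *: "W \<notin> U" "W * S \<in> U" "P (W * S)" "Y \<in> cone" "X * V = W * Y"
    show ?thesis
    proof (cases "Y = 1")
      case True
      then have "X * (V * S) = W * S" using * by (simp flip: mult.assoc)
      then show ?thesis using * by simp
    next
      case False
      then have "Y * S \<in> cone" "X * (V * S) = W * (Y * S)" using * cone_mult_S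
        by (simp_all flip: mult.assoc)
      then show ?thesis using * by blast
    qed
  qed
next
  case (L V)
  then show ?case
  proof (elim disjE exE conjE)
    assume *: "X * V \<in> U" "P (X * V)"
    then show ?thesis using convex_edges_L_iff[OF U(1), of "X * V"] P(2)[of "X * V"]
      by (simp add: mult.assoc)
  next
    fix W Y
    assume *: "W \<notin> U" "W * S \<in> U" "P (W * S)" "Y \<in> cone" "X * V = W * Y"
    then have "Y * L \<in> cone" "X * (V * L) = W * (Y * L)" by (simp_all flip: mult.assoc)
    then show ?thesis using * by blast
  qed
qed (use U P in simp)

lemma convex_edges_enter:
  assumes "convex_edges U" "X \<in> U" "X * V \<notin> U"
  obtains W Y where "W \<notin> U" "W * S \<in> U" "Y \<in> cone" "X * V = W * Y"
  using convex_edges_walk[of U X "\<lambda>_. True" V] assms by blast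

lemma finite_subtree_spanned:
  assumes U: "convex_edges U" "U \<noteq> {}"
  shows "finite_subtree farey (spanned_subtree U)"
proof -
  let ?T = "spanned_subtree U"
  define R where "R = (tree_edge ?T)\<^sup>*"
  have trans: "(s, u) \<in> R" if "(s, t) \<in> R" "(t, u) \<in> R" for s t u
    using that unfolding R_def by (rule rtrancl_trans)
  have same: "(s, t) \<in> R" if "x \<in> U" "x \<in> s" "x \<in> t" "s \<in> Verts farey" "t \<in> Verts farey" for x s t
    using that unfolding R_def by (intro r_into_rtrancl) auto
  have "(vert3 farey Z, vert3 farey (Z * S)) \<in> R" if "Z \<in> U" "Z * S \<in> U" for Z
  proof (rule trans)
    show "(vert3 farey Z, vert2 farey Z) \<in> R" using that by (intro same[of Z]) simp_all
    have "Z * S \<in> vert2 farey Z" by (simp add: vert2_farey)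
    then show "(vert2 farey Z, vert3 farey (Z * S)) \<in> R" using that by (intro same[of "Z * S"]) simp_all
  qed
  then have conn: "(vert3 farey X, vert3 farey (X * V)) \<in> R"
    if "X \<in> U" "X * V \<in> U" for X V
    using convex_edges_walk[OF U(1) that(1), of "\<lambda>Z. (vert3 farey X, vert3 farey Z) \<in> R" V] trans that
      convex_edgesD[OF U(1)] by (auto simp: R_def)
  have conn3: "(vert3 farey X, vert3 farey Y) \<in> R" if "X \<in> U" "Y \<in> U" for X Y
    using conn[of X "psl_inv X * Y"] that by simp
  show ?thesis
    unfolding finite_subtree_def
  proof (intro conjI ballI impI)
    show "fst ?T \<subseteq> Verts farey" by (auto simp: spanned_subtree_def)
    have "fst ?T \<subseteq> vert2 farey ` U \<union> vert3 farey ` U"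
    proof
      fix v assume "v \<in> fst ?T"
      then obtain x where "v \<in> Verts farey" "x \<in> v" "x \<in> U" by auto
      then show "v \<in> vert2 farey ` U \<union> vert3 farey ` U" using Verts_farey_cases[of v x] by blast
    qed
    moreover have "finite U" using U by (simp add: convex_edges_def)
    ultimately show "finite (fst ?T)" by (auto intro: finite_subset)
    show "finite (snd ?T)" using \<open>finite U\<close> by simp
    obtain x where "x \<in> U" using U by blast
    then have "vert3 farey x \<in> fst ?T" by auto
    then show "fst ?T \<noteq> {}" by blast
  next
    fix u v assume "u \<in> fst ?T" "v \<in> fst ?T"
    then obtain x y where x: "x \<in> U" "x \<in> u" "y \<in> U" "y \<in> v" and uv: "u \<in> Verts farey" "v \<in> Verts farey"
      by auto
    have "(u, vert3 farey x) \<in> R" "(vert3 farey y, v) \<in> R"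
      using x uv same[of x u "vert3 farey x"] same[of y "vert3 farey y" v] by simp_all
    then show "(u, v) \<in> (tree_edge ?T)\<^sup>*"
      using conn3[OF x(1,3)] trans unfolding R_def[symmetric] by blast
  qed auto
qed

lemma finite_subtree_exists:
  assumes "finite F"
  obtains T where "finite_subtree farey T" "F \<subseteq> snd T"
  using convex_edges_exists[of "insert 1 F"] finite_subtree_spanned assms
  by (metis empty_iff finite_insert insert_subset spanned_subtree_simps(1))

lemma boundary_unique:
  assumes U: "convex_edges U" and "X \<notin> U" "X * S \<in> U" "V \<in> cone" "X * V * S \<in> U"
  shows "V = 1"
  using convex_edgesD[OF U assms(2,3), of "V * S"] assms(4,5) cone_mult_S[of V]
  by (auto simp: mult.assoc)

lemma branch_stepI:
  "v \<in> Verts farey \<Longrightarrow> v \<inter> U = {} \<Longrightarrow> X \<in> v \<Longrightarrow> Y \<in> v \<Longrightarrow>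
   (X, Y) \<in> branch_step (spanned_subtree U)"
  by auto

text \<open>Induction over the cone connects all of it outside the subtree, and the only vertex
  leading out of it belongs to the subtree.\<close>

lemma branches_spanned:
  assumes U: "convex_edges U" "U \<noteq> {}"
  shows "branches farey (spanned_subtree U) = {(*) W ` cone |W. W \<notin> U \<and> W * S \<in> U}"
proof -
  let ?T = "spanned_subtree U"
  have cls: "{y. y \<notin> snd ?T \<and> (W * Y, y) \<in> (branch_step ?T)\<^sup>*} = (*) W ` cone"
    if W: "W \<notin> U" "W * S \<in> U" and Y: "Y \<in> cone" for W Y
  proof -
    have reach: "(W, W * V) \<in> (branch_step ?T)\<^sup>*" if "V \<in> cone" for V
      using that
    proof (induction rule: cone_induct)
      case (S V)
      have "W * (V * S) \<notin> U" "W * V \<notin> U"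
        using convex_edgesD[OF U(1) W] S cone_mult_S[of V] by auto
      then have "(W * V, W * (V * S)) \<in> branch_step ?T"
        by (intro branch_stepI[of "vert2 farey (W * V)"] vert_in_Verts) (simp_all add: vert2_farey mult.assoc)
      then show ?case using S by (meson rtrancl.rtrancl_into_rtrancl)
    next
      case (L V)
      have "W * V \<notin> U" using convex_edgesD[OF U(1) W] L by auto
      then have "vert3 farey (W * V) \<inter> U = {}" using convex_vert3_disjoint_iff[OF U(1)] by blast
      then have "(W * V, W * (V * L)) \<in> branch_step ?T"
        by (intro branch_stepI[of "vert3 farey (W * V)"] vert_in_Verts) (simp_all add: vert3_farey mult.assoc)
      then show ?case using L by (meson rtrancl.rtrancl_into_rtrancl)
    qed simp
    have "y \<in> (*) W ` cone" if "(W * Y, y) \<in> (branch_step ?T)\<^sup>*" for y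
      using that
    proof (induction rule: rtrancl_induct)
      case (step z z')
      then obtain v where v: "v \<in> Verts farey" "v \<inter> U = {}" "z \<in> v" "z' \<in> v" by auto
      have "v \<noteq> vert2 farey W" using v W by (auto simp: vert2_farey)
      then show ?case using cone_vert[of v W] v step.IH by blast
    qed (use Y in simp)
    moreover have "(W * Y, W * V) \<in> (branch_step ?T)\<^sup>*" if "V \<in> cone" for V
      using reach[OF that] reach[OF Y] sym_branch_step[of ?T] by (meson rtrancl_trans symD)
    ultimately show ?thesis using convex_edgesD[OF U(1) W] by auto
  qed
  have eq: "branches farey ?T = (\<lambda>x. {y. y \<notin> snd ?T \<and> (x, y) \<in> (branch_step ?T)\<^sup>*}) ` (- U)"
    unfolding branches_def quotient_def by (auto simp: Compl_eq_Diff_UNIV)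
  show ?thesis
    unfolding eq
  proof (intro equalityI subsetI)
    fix A assume "A \<in> (\<lambda>x. {y. y \<notin> snd ?T \<and> (x, y) \<in> (branch_step ?T)\<^sup>*}) ` (- U)"
    then obtain x where x: "x \<notin> U" "A = {y. y \<notin> snd ?T \<and> (x, y) \<in> (branch_step ?T)\<^sup>*}" by blast
    obtain X where "X \<in> U" using U by blast
    then obtain W Y where "W \<notin> U" "W * S \<in> U" "Y \<in> cone" "x = W * Y"
      using convex_edges_enter[OF U(1), of X "psl_inv X * x"] x by auto
    then show "A \<in> {(*) W ` cone |W. W \<notin> U \<and> W * S \<in> U}" using cls x(2) by blast
  next
    fix A assume "A \<in> {(*) W ` cone |W. W \<notin> U \<and> W * S \<in> U}"
    then obtain W where "W \<notin> U" "W * S \<in> U" "A = (*) W ` cone" by blast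
    then show "A \<in> (\<lambda>x. {y. y \<notin> snd ?T \<and> (x, y) \<in> (branch_step ?T)\<^sup>*}) ` (- U)"
      using cls[of W 1] by (auto simp del: spanned_subtree_simps)
  qed
qed

text \<open>\<open>Y\<close> is the first edge outside \<open>U\<close> on the way from \<open>X\<close> around its cusp.\<close>

definition cusp_exit :: "psl2z set \<Rightarrow> psl2z \<Rightarrow> psl2z \<Rightarrow> bool" where
  "cusp_exit U X Y \<longleftrightarrow> Y \<notin> U \<and> (\<exists>n::nat. Y = X * psl_T (int n + 1) \<and> (\<forall>i\<le>n. X * psl_T (int i) \<in> U))"

lemma cusp_exit_unique:
  assumes "cusp_exit U X Y" "cusp_exit U X Y'"
  shows "Y = Y'"
proof -
  have *: "n \<le> m" if "X * psl_T (int n + 1) \<notin> U" "\<forall>i\<le>m. X * psl_T (int i) \<in> U"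
    "X * psl_T (int m + 1) \<notin> U" "\<forall>i\<le>n. X * psl_T (int i) \<in> U" for n m :: nat
    using that(3,4) by (metis not_less_eq_eq add.commute of_nat_Suc)
  then show ?thesis using assms unfolding cusp_exit_def by (metis le_antisym)
qed

lemma cusp_exit_exists:
  assumes U: "convex_edges U" "X \<in> U"
  obtains Y where "cusp_exit U X Y"
proof -
  have "\<exists>n::nat. X * psl_T (int n + 1) \<notin> U"
  proof (rule ccontr)
    assume "\<not> (\<exists>n::nat. X * psl_T (int n + 1) \<notin> U)"
    then have "range (\<lambda>n::nat. X * psl_T (int n + 1)) \<subseteq> U" by blast
    moreover have "finite U" using U by (simp add: convex_edges_def)
    moreover have "inj (\<lambda>n::nat. X * psl_T (int n + 1))" by (auto simp: inj_def)
    ultimately show False using finite_imageD finite_subset infinite_UNIV_nat by metis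
  qed
  define n where "n = (LEAST n::nat. X * psl_T (int n + 1) \<notin> U)"
  have n: "X * psl_T (int n + 1) \<notin> U"
    using LeastI_ex[OF \<open>\<exists>n::nat. X * psl_T (int n + 1) \<notin> U\<close>] by (simp add: n_def)
  have "X * psl_T (int i) \<in> U" if "i \<le> n" for i
  proof (cases i)
    case (Suc i')
    then have "X * psl_T (int i' + 1) \<in> U"
      using not_less_Least[of i' "\<lambda>n::nat. X * psl_T (int n + 1) \<notin> U"] that by (auto simp: n_def)
    then show ?thesis by (simp add: Suc add.commute)
  qed (use U in \<open>simp add: psl_T_0\<close>)
  then show ?thesis using n that unfolding cusp_exit_def by blast
qed

lemma cusp_exit_step:
  assumes "X \<in> U" "cusp_exit U (X * L * S) Y"
  shows "cusp_exit U X Y"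
proof -
  have T: "X * L * S * psl_T i = X * psl_T (1 + i)" for i
    by (simp add: psl_T_add psl_T_1 mult.assoc)
  obtain n where n: "Y \<notin> U" "Y = X * psl_T (1 + (int n + 1))" "\<forall>i\<le>n. X * psl_T (1 + int i) \<in> U"
    using assms(2) unfolding cusp_exit_def T by blast
  have "X * psl_T (int i) \<in> U" if "i \<le> Suc n" for i
    using n(3) that assms(1) by (cases i) (simp_all add: psl_T_0)
  then show ?thesis using n(1,2) unfolding cusp_exit_def by (intro conjI exI[of _ "Suc n"]) (simp_all add: add.commute)
qed

lemma cusp_exit_1:
  "X \<in> U \<Longrightarrow> X * L * S \<notin> U \<Longrightarrow> cusp_exit U X (X * L * S)"
  unfolding cusp_exit_def by (auto intro!: exI[of _ 0] simp: psl_T_1 psl_T_0 mult.assoc)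

text \<open>Contours meet both kinds of vertices in turn, so the induction needs clauses for both;
  the middle one is the contour that ends at once.\<close>

lemma contour_cusp_exit:
  assumes U: "convex_edges U" and "contour farey (spanned_subtree U) v X Y"
  shows "(v = vert2 farey X \<longrightarrow> X * S \<in> U \<longrightarrow> cusp_exit U (X * S) Y) \<and>
     (v = vert2 farey X \<longrightarrow> X * S \<notin> U \<longrightarrow> Y = X * S) \<and>
     (v = vert3 farey X \<longrightarrow> X \<in> U \<longrightarrow> cusp_exit U X Y)"
  using assms(2)
proof (induction rule: contour.induct)
  case (leave v x)
  have "x * S \<notin> U" if "v = vert2 farey x" using leave.hyps(3) that by simp
  moreover have "x \<notin> U" if "v = vert3 farey x"
    using leave.hyps(3) that convex_edges_L_iff[OF U] by simp
  moreover have "rot farey v x = x * S" if "v = vert2 farey x" using that by simp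
  ultimately show ?case by blast
next
  case (follow v x w y)
  note IH = follow.IH
  have w: "w = vert2 farey (rot farey v x) \<or> w = vert3 farey (rot farey v x)"
    using follow.hyps(4,6) by (intro Verts_farey_cases) simp_all
  have 1: "x * S \<in> U" "cusp_exit U (x * S) y" if "v = vert2 farey x"
  proof -
    have rot: "rot farey v x = x * S" using that by simp
    show "x * S \<in> U" using follow.hyps(3) unfolding rot by simp
    have "w = vert3 farey (x * S)" using w that \<open>w \<noteq> v\<close> unfolding rot by simp
    then show "cusp_exit U (x * S) y" using IH \<open>x * S \<in> U\<close> unfolding rot by blast
  qed
  have 2: "cusp_exit U x y" if "v = vert3 farey x" "x \<in> U"
  proof -
    have rot: "rot farey v x = x * L" using that by simp
    have "w = vert2 farey (x * L)" using w that \<open>w \<noteq> v\<close> unfolding rot by simp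
    then have "x * L * S \<in> U \<longrightarrow> cusp_exit U (x * L * S) y" "x * L * S \<notin> U \<longrightarrow> y = x * L * S"
      using IH unfolding rot by blast+
    then show ?thesis using cusp_exit_step cusp_exit_1 that(2) by blast
  qed
  show ?case using 1 2 by blast
qed

lemma spanned_contour:
  "X \<in> U \<Longrightarrow> X * S \<notin> U \<Longrightarrow> contour farey (spanned_subtree U) (vert2 farey X) X (X * S)"
  "X * S \<in> U \<Longrightarrow> contour farey (spanned_subtree U) (vert3 farey (X * S)) (X * S) Y \<Longrightarrow>
    contour farey (spanned_subtree U) (vert2 farey X) X Y"
  "X \<in> U \<Longrightarrow> X * L \<in> U \<Longrightarrow>
    contour farey (spanned_subtree U) (vert2 farey (X * L)) (X * L) Y \<Longrightarrow>
    contour farey (spanned_subtree U) (vert3 farey X) X Y"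
proof -
  let ?T = "spanned_subtree U"
  assume "X \<in> U" "X * S \<notin> U"
  then show "contour farey ?T (vert2 farey X) X (X * S)"
    using contour.leave[of "vert2 farey X" ?T X farey] unfolding rot_farey by simp
next
  let ?T = "spanned_subtree U"
  assume "X * S \<in> U" "contour farey ?T (vert3 farey (X * S)) (X * S) Y"
  moreover from this have "vert2 farey X \<inter> U \<noteq> {}" using vert_meets(1)[of "X * S" U] by simp
  ultimately show "contour farey ?T (vert2 farey X) X Y"
    using contour.follow[of "vert2 farey X" ?T X farey "vert3 farey (X * S)" Y] unfolding rot_farey by simp
next
  let ?T = "spanned_subtree U"
  assume "X \<in> U" "X * L \<in> U" "contour farey ?T (vert2 farey (X * L)) (X * L) Y"
  then show "contour farey ?T (vert3 farey X) X Y"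
    using contour.follow[of "vert3 farey X" ?T X farey "vert2 farey (X * L)" Y]
      vert_farey_self(1)[of "X * L"] vert3_farey_L[of X] unfolding rot_farey by simp
qed

lemma cusp_exit_contour:
  assumes U: "convex_edges U" and "X \<in> U" "cusp_exit U X Y"
  shows "contour farey (spanned_subtree U) (vert2 farey (X * S)) (X * S) Y"
proof -
  let ?T = "spanned_subtree U"
  have *: "contour farey ?T (vert3 farey X) X (X * psl_T (int n + 1))"
    if "X * psl_T (int n + 1) \<notin> U" "\<forall>i\<le>n. X * psl_T (int i) \<in> U" for X n
    using that
  proof (induction n arbitrary: X)
    case 0
    then have X: "X \<in> U" "X * L \<in> U" "X * L * S \<notin> U"
      using convex_edges_L_iff[OF U] by (simp_all add: psl_T_0 psl_T_1 mult.assoc)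
    have "contour farey ?T (vert3 farey X) X (X * L * S)"
      using X by (intro spanned_contour(3) spanned_contour(1))
    then show ?case by (simp add: psl_T_1 mult.assoc)
  next
    case (Suc n)
    have T: "X * L * S * psl_T i = X * psl_T (1 + i)" for i
      by (simp add: psl_T_add psl_T_1 mult.assoc)
    have X: "X \<in> U" "X * L \<in> U" "X * L * S \<in> U"
      using Suc.prems(2)[rule_format, of 0] Suc.prems(2)[rule_format, of 1] convex_edges_L_iff[OF U]
      by (simp_all add: psl_T_0 psl_T_1 mult.assoc)
    have "X * L * S * psl_T (int i) \<in> U" if "i \<le> n" for i
      unfolding T using Suc.prems(2)[rule_format, of "Suc i"] that by simp
    moreover have "X * L * S * psl_T (int n + 1) \<notin> U"
      unfolding T using Suc.prems(1) by (simp add: add.commute)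
    ultimately have "contour farey ?T (vert3 farey (X * L * S)) (X * L * S) (X * L * S * psl_T (int n + 1))"
      by (intro Suc.IH) blast+
    then have "contour farey ?T (vert3 farey X) X (X * L * S * psl_T (int n + 1))"
      by (rule spanned_contour(3)[OF X(1,2) spanned_contour(2)[OF X(3)]])
    moreover have "X * L * S * psl_T (int n + 1) = X * psl_T (int (Suc n) + 1)"
      unfolding T by (simp add: add.commute)
    ultimately show ?case by simp
  qed
  have "contour farey ?T (vert3 farey X) X Y" using assms(3) * unfolding cusp_exit_def by blast
  then show ?thesis
    using \<open>X \<in> U\<close> by (intro spanned_contour(2)) simp_all
qed

text \<open>A contour can start only at the root \<open>X\<close>, the one edge of its branch at a
  vertex of the subtree. It ends at an edge whose twin is in \<open>U\<close>, and in the branch of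
  \<open>Y\<close> this is \<open>Y\<close> alone.\<close>

lemma next_branch_spanned:
  assumes U: "convex_edges U" "U \<noteq> {}" and X: "X \<notin> U" "X * S \<in> U" and Y: "Y \<notin> U" "Y * S \<in> U"
  shows "next_branch farey (spanned_subtree U) ((*) X ` cone) ((*) Y ` cone) \<longleftrightarrow>
    cusp_exit U (X * S) Y"
proof
  assume "next_branch farey (spanned_subtree U) ((*) X ` cone) ((*) Y ` cone)"
  then obtain v x y where "v \<in> fst (spanned_subtree U)" and x: "x \<in> v" "x \<in> (*) X ` cone"
    and y: "y \<in> (*) Y ` cone" and c: "contour farey (spanned_subtree U) v x y"
    unfolding next_branch_def by blast
  then have v: "v \<in> Verts farey" "v \<inter> U \<noteq> {}" by simp_all
  have v2: "v = vert2 farey X"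
  proof (rule ccontr)
    assume "v \<noteq> vert2 farey X"
    then have "v \<subseteq> (*) X ` cone" using cone_vert[of v X] v x by blast
    then show False using v convex_edgesD[OF U(1) X] by auto
  qed
  have "x = X"
    using x X v2 convex_edgesD[OF U(1) X] by (auto simp: vert2_farey)
  then have exit: "cusp_exit U (X * S) y" using contour_cusp_exit[OF U(1) c] X v2 by blast
  then obtain n where n: "y = X * S * psl_T (int n + 1)" "X * S * psl_T (int n) \<in> U"
    unfolding cusp_exit_def by blast
  then have "y * S = X * S * psl_T (int n) * L" by (simp add: psl_T_Suc psl_simps)
  then have "y * S \<in> U" using n convex_edges_L_iff[OF U(1)] by simp
  then have "y = Y" using y boundary_unique[OF U(1) Y] by force
  then show "cusp_exit U (X * S) Y" using exit by simp
next
  assume "cusp_exit U (X * S) Y"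
  then have "contour farey (spanned_subtree U) (vert2 farey X) X Y"
    using cusp_exit_contour[OF U(1) X(2)] by (simp add: psl_simps)
  moreover have "vert2 farey X \<in> fst (spanned_subtree U)"
    using X(2) vert_meets(1)[of "X * S" U] by simp
  moreover have "X \<in> (*) X ` cone \<inter> vert2 farey X" "Y \<in> (*) Y ` cone"
    by (auto intro: image_eqI[of _ _ 1])
  ultimately show "next_branch farey (spanned_subtree U) ((*) X ` cone) ((*) Y ` cone)"
    unfolding next_branch_def branches_spanned[OF U] using X Y by blast
qed

subsection \<open>Permutations respecting cusps are near-automorphisms\<close>

lemma cusp_exit_image:
  assumes U: "convex_edges U" "\<And>W. W \<notin> U \<Longrightarrow> \<sigma> (W * L) = \<sigma> W * L" and \<sigma>: "cusp_perm \<sigma>"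
    and X: "X \<in> U" "X * S \<notin> U" and exit: "cusp_exit U X Y"
  shows "cusp_exit (\<sigma> ` U) (\<sigma> X) (\<sigma> Y)"
proof -
  have S: "\<And>W. \<sigma> (W * S) = \<sigma> W * S" and bij: "bij \<sigma>" and inj: "inj \<sigma>"
    using \<sigma> by (simp_all add: cusp_perm_def bij_is_inj)
  note image = convex_edges_image[OF U S bij]
  obtain n where n: "Y \<notin> U" "Y = X * psl_T (int n + 1)" "X * psl_T (int n) \<in> U"
    using exit unfolding cusp_exit_def by blast
  have "Y * S = X * psl_T (int n) * L" using n by (simp add: psl_T_Suc psl_simps)
  then have YS: "Y * S \<in> U" using n convex_edges_L_iff[OF U(1)] by simp
  obtain j where j: "0 < j" "\<sigma> Y = \<sigma> X * psl_T j"
    using cusp_successor[OF U \<sigma> X, of "int n + 1"] n YS by auto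
  obtain Y' where Y': "cusp_exit (\<sigma> ` U) (\<sigma> X) Y'"
    using cusp_exit_exists[OF image] X by blast
  then obtain m where m: "Y' \<notin> \<sigma> ` U" "Y' = \<sigma> X * psl_T (int m + 1)"
    "\<And>i. i \<le> m \<Longrightarrow> \<sigma> X * psl_T (int i) \<in> \<sigma> ` U"
    unfolding cusp_exit_def by blast
  have "Y' * S = \<sigma> X * psl_T (int m) * L" using m by (simp add: psl_T_Suc psl_simps)
  then have Y'S: "Y' * S \<in> \<sigma> ` U" using m(3) convex_edges_L_iff[OF image] by simp
  \<comment> \<open>A smaller \<open>j\<close> would put \<open>\<sigma> Y\<close> inside the image
    of \<open>U\<close>; a larger one would put its twin into the branch of \<open>Y'\<close>, which
    is outside.\<close>
  have "j = int m + 1"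
  proof (rule ccontr)
    assume "j \<noteq> int m + 1"
    then consider "j \<le> int m" | "int m + 1 < j" by linarith
    then show False
    proof cases
      case 1
      then have "\<sigma> Y \<in> \<sigma> ` U" using m(3)[of "nat j"] j by simp
      then show False using n inj by (simp add: inj_image_mem_iff)
    next
      case 2
      have "\<sigma> Y * S = Y' * (psl_T (j - int m - 2) * L)"
        unfolding j(2) m(2) by (simp add: psl_T_S psl_T_simps algebra_simps)
      moreover have "psl_T (j - int m - 2) * L \<in> cone"
        unfolding cone_mult_L_iff psl_T_in_cone using 2 by linarith
      then have "Y' * (psl_T (j - int m - 2) * L) \<notin> \<sigma> ` U"
        by (rule_tac convex_edgesD[OF image m(1) Y'S])
      moreover have "\<sigma> Y * S \<in> \<sigma> ` U" using YS by (simp flip: S)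
      ultimately show False by simp
    qed
  qed
  then show ?thesis using j m Y' by simp
qed

lemma cusp_perm_near_aut:
  assumes \<sigma>: "cusp_perm \<sigma>"
  shows "near_aut \<sigma>"
proof -
  have S: "\<And>W. \<sigma> (W * S) = \<sigma> W * S" and bij: "bij \<sigma>" and inj: "inj \<sigma>"
    and fin: "finite {W. \<sigma> (W * L) \<noteq> \<sigma> W * L}"
    using \<sigma> by (simp_all add: cusp_perm_def bij_is_inj)
  \<comment> \<open>Inserting 1 makes \<open>U\<close> nonempty, as \<open>finite_subtree\<close>
    demands a vertex.\<close>
  obtain U where U: "convex_edges U" "insert 1 {W. \<sigma> (W * L) \<noteq> \<sigma> W * L} \<subseteq> U"
    using convex_edges_exists[of "insert 1 {W. \<sigma> (W * L) \<noteq> \<sigma> W * L}"] fin by auto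
  have L: "\<sigma> (W * L) = \<sigma> W * L" if "W \<notin> U" for W using U that by blast
  have ne: "U \<noteq> {}" "\<sigma> ` U \<noteq> {}" using U by auto
  note image = convex_edges_image[OF U(1) L S bij]
  note mem = inj_image_mem_iff[OF inj]
  let ?T1 = "spanned_subtree U" and ?T2 = "spanned_subtree (\<sigma> ` U)"
  have Verts: "v \<in> Verts farey - fst ?T1 \<longleftrightarrow> v \<in> Verts farey \<and> v \<inter> U = {}" for v by auto
  have img: "\<sigma> ` vert2 farey X = vert2 farey (\<sigma> X)" "X \<notin> U \<Longrightarrow> \<sigma> ` vert3 farey X = vert3 farey (\<sigma> X)" for X
    using L convex_edges_L_iff[OF U(1)] by (simp_all add: vert2_farey vert3_farey S)
  have vert_cases: "v = vert2 farey x \<or> v = vert3 farey x \<and> x \<notin> U"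
    if "v \<in> Verts farey - fst ?T1" "x \<in> v" for v x
    using that Verts_farey_cases[of v x] by auto
  have "branch_iso farey ?T1 ?T2 \<sigma>"
    unfolding branch_iso_def
  proof (intro conjI ballI)
    show "bij_betw \<sigma> (Edges farey - snd ?T1) (Edges farey - snd ?T2)"
      using bij by (auto simp: bij_betw_def inj_on_def image_set_diff)
    show "bij_betw ((`) \<sigma>) (Verts farey - fst ?T1) (Verts farey - fst ?T2)"
    proof (rule bij_betw_imageI)
      show "inj_on ((`) \<sigma>) (Verts farey - fst ?T1)"
        using inj by (auto simp: inj_on_def inj_image_eq_iff)
      show "(`) \<sigma> ` (Verts farey - fst ?T1) = Verts farey - fst ?T2"
      proof (intro equalityI subsetI)
        fix w assume "w \<in> (`) \<sigma> ` (Verts farey - fst ?T1)"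
        then obtain v where v: "v \<in> Verts farey - fst ?T1" "w = \<sigma> ` v" by blast
        then obtain x where "x \<in> v" by (auto simp: Verts_def vert2_def vert3_def)
        then have "w \<in> Verts farey" using vert_cases[OF v(1)] img v(2) by (metis vert_in_Verts)
        moreover have "w \<inter> \<sigma> ` U = {}"
          using v inj by (auto simp: image_Int[symmetric])
        ultimately show "w \<in> Verts farey - fst ?T2" by simp
      next
        fix w assume w: "w \<in> Verts farey - fst ?T2"
        then obtain y where "y \<in> w" by (auto simp: Verts_def vert2_def vert3_def)
        moreover obtain x where "y = \<sigma> x" using bij_is_surj[OF bij] by blast
        moreover have "w \<inter> \<sigma> ` U = {}" using w by auto
        ultimately have x: "\<sigma> x \<in> w" "x \<notin> U" by auto
        then obtain v where v: "v \<in> Verts farey" "w = \<sigma> ` v"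
          using Verts_farey_cases[of w "\<sigma> x"] w img[of x] by (metis DiffD1 vert_in_Verts)
        then have "v \<inter> U = {}" using \<open>w \<inter> \<sigma> ` U = {}\<close> by auto
        then show "w \<in> (`) \<sigma> ` (Verts farey - fst ?T1)" using v by auto
      qed
    qed
  next
    fix v x assume v: "v \<in> Verts farey - fst ?T1" "x \<in> v"
    then show "\<sigma> (rot farey v x) = rot farey (\<sigma> ` v) (\<sigma> x)"
      using vert_cases[OF v] img[of x] by (auto simp: S L)
  next
    fix A B assume A: "A \<in> branches farey ?T1" and B: "B \<in> branches farey ?T1"
    then obtain X Y where X: "X \<notin> U" "X * S \<in> U" "A = (*) X ` cone"
      and Y: "Y \<notin> U" "Y * S \<in> U" "B = (*) Y ` cone"
      unfolding branches_spanned[OF U(1) ne(1)] by blast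
    have imgs: "\<sigma> ` A = (*) (\<sigma> X) ` cone" "\<sigma> ` B = (*) (\<sigma> Y) ` cone"
      unfolding X(3) Y(3)
      by (auto simp: image_image cone_mult_equivariant[OF U(1) L S X(1,2)] cone_mult_equivariant[OF U(1) L S Y(1,2)])
    have 1: "next_branch farey ?T1 A B \<longleftrightarrow> cusp_exit U (X * S) Y"
      unfolding X(3) Y(3) by (rule next_branch_spanned[OF U(1) ne(1) X(1,2) Y(1,2)])
    have 2: "next_branch farey ?T2 (\<sigma> ` A) (\<sigma> ` B) \<longleftrightarrow> cusp_exit (\<sigma> ` U) (\<sigma> (X * S)) (\<sigma> Y)"
      unfolding imgs using next_branch_spanned[OF image ne(2), of "\<sigma> X" "\<sigma> Y"] X Y
      by (simp add: mem flip: S)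
    have exit: "cusp_exit (\<sigma> ` U) (\<sigma> (X * S)) (\<sigma> Z)" if "cusp_exit U (X * S) Z" for Z
      using that X by (intro cusp_exit_image[OF U(1) L \<sigma>]) (simp_all add: psl_simps)
    \<comment> \<open>The converse direction avoids the inverse of \<open>\<sigma>\<close>: the true
      exit \<open>Z\<close> is mapped to the exit of the image, exits are unique, and
      \<open>\<sigma>\<close> is injective.\<close>
    obtain Z where Z: "cusp_exit U (X * S) Z" using cusp_exit_exists[OF U(1) X(2)] .
    have "cusp_exit U (X * S) Y" if "cusp_exit (\<sigma> ` U) (\<sigma> (X * S)) (\<sigma> Y)"
      using cusp_exit_unique[OF that exit[OF Z]] Z inj by (simp add: inj_eq)
    then show "next_branch farey ?T1 A B = next_branch farey ?T2 (\<sigma> ` A) (\<sigma> ` B)"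
      unfolding 1 2 using exit by blast
  qed
  then show ?thesis
    unfolding near_aut_def farey_simps
    using bij S finite_subtree_spanned[OF U(1) ne(1)] finite_subtree_spanned[OF image ne(2)] by blast
qed

lemma near_aut_iff_flip_group: "near_aut \<sigma> \<longleftrightarrow> \<sigma> \<in> flip_group"
  using flip_group_eq_cusp_perms near_aut_cusp_perm cusp_perm_near_aut by blast

subsection \<open>Groupoids of simply connected graphs\<close>

lemma modular_graphD:
  assumes "modular_graph G" "x \<in> Edges G"
  shows "twin G x \<in> Edges G" "twin G x \<noteq> x" "twin G (twin G x) = x"
    "nxt G x \<in> Edges G" "nxt G x \<noteq> x" "nxt G (nxt G (nxt G x)) = x"
  using assms unfolding modular_graph_def by blast+

lemma Verts_subset_Edges:
  "modular_graph G \<Longrightarrow> v \<in> Verts G \<Longrightarrow> x \<in> v \<Longrightarrow> x \<in> Edges G"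
  by (auto simp: Verts_def vert2_def vert3_def modular_graphD)

lemma is_path_Edges:
  "modular_graph G \<Longrightarrow> is_path G x p y \<Longrightarrow> x \<in> Edges G \<and> y \<in> Edges G"
  by (induction p arbitrary: x) (auto simp: Verts_subset_Edges)

lemma is_path_append:
  "modular_graph G \<Longrightarrow> is_path G x (p @ q) z \<longleftrightarrow> (\<exists>y. is_path G x p y \<and> is_path G y q z)"
  by (induction p arbitrary: x) (auto dest: is_path_Edges)

lemma is_path_unique_end: "is_path G x p y \<Longrightarrow> is_path G x p z \<Longrightarrow> y = z"
  by (induction p arbitrary: x) auto

lemma reduces_is_path:
  assumes G: "modular_graph G" and "reduces G x p p'"
  shows "\<exists>z. is_path G x p z \<and> is_path G x p' z"
  using assms(2)
proof cases
  case (stay r y v q z)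
  have "is_path G x (r @ (v, y) # q) z" "is_path G x (r @ q) z"
    unfolding is_path_append[OF G] is_path.simps using stay(3-6) by blast+
  then show ?thesis unfolding stay by blast
next
  case (shortcut r y v w w' q z)
  have "is_path G x (r @ (v, w) # (v, w') # q) z" "is_path G x (r @ (v, w') # q) z"
    unfolding is_path_append[OF G] is_path.simps using shortcut(3-8) by blast+
  then show ?thesis unfolding shortcut by blast
qed

lemma homotopic_is_path:
  assumes G: "modular_graph G" and "homotopic G x p q" "is_path G x p y"
  shows "is_path G x q y"
  using assms(2) unfolding homotopic_def
proof (induction rule: equivclp_induct)
  case (step q q')
  then show ?case using reduces_is_path[OF G] is_path_unique_end by metis
qed (rule assms(3))

definition simply_connected :: "'e mgraph \<Rightarrow> bool" where
  "simply_connected G \<longleftrightarrow> modular_graph G \<and>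
     (\<forall>x p q y. is_path G x p y \<longrightarrow> is_path G x q y \<longrightarrow> homotopic G x p q)"

text \<open>In a simply connected graph this is the only arrow from \<open>x\<close> to
  \<open>y\<close>, so arrows can be handled as pairs of edges.\<close>

definition arrow :: "'e mgraph \<Rightarrow> 'e \<Rightarrow> 'e \<Rightarrow> 'e arrow" where
  "arrow G x y = {(x, p) |p. is_path G x p y}"

lemma pclass_eq_arrow:
  assumes "simply_connected G" "is_path G x p y"
  shows "pclass G x p = arrow G x y"
  using assms homotopic_is_path[of G x p _ y]
  by (auto simp: simply_connected_def pclass_def arrow_def)

lemma path_exists:
  assumes "modular_graph G" "x \<in> Edges G" "y \<in> Edges G"
  obtains p where "is_path G x p y"
  using assms unfolding modular_graph_def by blast

lemma Hom_eq_arrow: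
  assumes "simply_connected G" "x \<in> Edges G" "y \<in> Edges G"
  shows "Hom G x y = {arrow G x y}"
proof -
  obtain p where "is_path G x p y"
    using path_exists[of G x y] assms by (auto simp: simply_connected_def)
  moreover from this have "arrow G x y = pclass G x p" using pclass_eq_arrow[OF assms(1)] by simp
  ultimately show ?thesis using pclass_eq_arrow[OF assms(1)] unfolding Hom_def by blast
qed

lemma Arr_eq_arrow:
  "simply_connected G \<Longrightarrow> Arr G = (\<Union>x\<in>Edges G. \<Union>y\<in>Edges G. {arrow G x y})"
  unfolding Arr_def using Hom_eq_arrow[of G] by simp

lemma arrow_eq_iff:
  assumes "modular_graph G" "x \<in> Edges G" "y \<in> Edges G"
  shows "arrow G x y = arrow G x' y' \<longleftrightarrow> x = x' \<and> y = y'"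
proof
  assume *: "arrow G x y = arrow G x' y'"
  obtain p where "is_path G x p y" using path_exists[OF assms] .
  then have "(x, p) \<in> arrow G x' y'" unfolding *[symmetric] by (simp add: arrow_def)
  then show "x = x' \<and> y = y'"
    using \<open>is_path G x p y\<close> is_path_unique_end by (auto simp: arrow_def)
qed simp

lemma arr_comp_arrow:
  assumes G: "simply_connected G" and xyz: "x \<in> Edges G" "y \<in> Edges G" "z \<in> Edges G"
  shows "arr_comp G (arrow G x y) (arrow G y z) = arrow G x z"
proof -
  have mg: "modular_graph G" using G by (simp add: simply_connected_def)
  have *: "pclass G x (p @ q) = arrow G x z" if "is_path G x p y" "is_path G y q z" for p q
    using that by (intro pclass_eq_arrow[OF G]) (auto simp: is_path_append[OF mg])
  obtain p q where "is_path G x p y" "is_path G y q z" using path_exists[OF mg] xyz by metis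
  then show ?thesis
    using * unfolding arr_comp_def arrow_def[of G x y] arrow_def[of G y z] by fastforce
qed

text \<open>The analogue of \<open>perm_to_auto\<close> between two graphs, needed because a flip
  changes the graph.\<close>

definition pair_map :: "'e mgraph \<Rightarrow> 'e mgraph \<Rightarrow> ('e \<Rightarrow> 'e) \<Rightarrow> 'e gmap" where
  "pair_map G H \<sigma> = (restrict \<sigma> (Edges G),
     \<lambda>\<alpha>\<in>Arr G. THE \<beta>. \<exists>x\<in>Edges G. \<exists>y\<in>Edges G. \<alpha> = arrow G x y \<and> \<beta> = arrow H (\<sigma> x) (\<sigma> y))"

lemma snd_pair_map:
  assumes "simply_connected G" "x \<in> Edges G" "y \<in> Edges G"
  shows "snd (pair_map G H \<sigma>) (arrow G x y) = arrow H (\<sigma> x) (\<sigma> y)"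
proof -
  have mg: "modular_graph G" using assms by (simp add: simply_connected_def)
  have "arrow G x y \<in> Arr G" using assms by (auto simp: Arr_eq_arrow)
  then show ?thesis
    unfolding pair_map_def using assms arrow_eq_iff[OF mg] by (auto intro!: the_equality)
qed

lemma groupoid_iso_pair_map:
  assumes G: "simply_connected G" and H: "simply_connected H" and \<sigma>: "bij_betw \<sigma> (Edges G) (Edges H)"
  shows "groupoid_iso G H (pair_map G H \<sigma>)"
proof -
  have mg: "modular_graph G" "modular_graph H" using G H by (simp_all add: simply_connected_def)
  have in_H: "\<sigma> x \<in> Edges H" if "x \<in> Edges G" for x using \<sigma> that by (auto simp: bij_betw_def)
  have fst: "fst (pair_map G H \<sigma>) x = \<sigma> x" if "x \<in> Edges G" for x using that by (simp add: pair_map_def)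
  have bij_arr: "bij_betw (snd (pair_map G H \<sigma>)) (Arr G) (Arr H)"
    unfolding bij_betw_def
  proof
    show "inj_on (snd (pair_map G H \<sigma>)) (Arr G)"
    proof (rule inj_onI)
      fix \<alpha> \<beta> assume "\<alpha> \<in> Arr G" "\<beta> \<in> Arr G" and eq: "snd (pair_map G H \<sigma>) \<alpha> = snd (pair_map G H \<sigma>) \<beta>"
      then obtain x y x' y' where *: "x \<in> Edges G" "y \<in> Edges G" "x' \<in> Edges G" "y' \<in> Edges G"
        "\<alpha> = arrow G x y" "\<beta> = arrow G x' y'" by (auto simp: Arr_eq_arrow[OF G])
      then have "\<sigma> x = \<sigma> x'" "\<sigma> y = \<sigma> y'"
        using eq arrow_eq_iff[OF mg(2)] by (simp_all add: snd_pair_map[OF G] in_H)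
      then show "\<alpha> = \<beta>" using * \<sigma> by (auto simp: bij_betw_def inj_on_eq_iff)
    qed
    have img: "Edges H = \<sigma> ` Edges G" using \<sigma> by (simp add: bij_betw_def)
    show "snd (pair_map G H \<sigma>) ` Arr G = Arr H"
      unfolding Arr_eq_arrow[OF G] Arr_eq_arrow[OF H] img
      by (auto simp: snd_pair_map[OF G] image_UN)
  qed
  have id: "pclass G x [] = arrow G x x" "pclass H (\<sigma> x) [] = arrow H (\<sigma> x) (\<sigma> x)" if "x \<in> Edges G" for x
    using that in_H by (auto intro!: pclass_eq_arrow G H)
  have ext: "fst (pair_map G H \<sigma>) \<in> extensional (Edges G)" "snd (pair_map G H \<sigma>) \<in> extensional (Arr G)"
    by (simp_all add: pair_map_def)
  have bij: "bij_betw (fst (pair_map G H \<sigma>)) (Edges G) (Edges H)"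
    using \<sigma> by (simp add: pair_map_def)
  show ?thesis
    unfolding groupoid_iso_def using ext bij bij_arr
    by (simp add: Hom_eq_arrow[OF G] Hom_eq_arrow[OF H] in_H fst snd_pair_map[OF G] id
        arr_comp_arrow[OF G] arr_comp_arrow[OF H])
qed

lemma groupoid_iso_arrow:
  assumes "simply_connected G" "simply_connected H" "groupoid_iso G H \<Phi>" "x \<in> Edges G" "y \<in> Edges G"
  shows "snd \<Phi> (arrow G x y) = arrow H (fst \<Phi> x) (fst \<Phi> y)"
proof -
  have "bij_betw (fst \<Phi>) (Edges G) (Edges H)"
    and Hom: "\<forall>\<alpha>\<in>Hom G x y. snd \<Phi> \<alpha> \<in> Hom H (fst \<Phi> x) (fst \<Phi> y)"
    using assms unfolding groupoid_iso_def by blast+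
  then have "fst \<Phi> x \<in> Edges H" "fst \<Phi> y \<in> Edges H" using assms by (auto simp: bij_betw_def)
  then show ?thesis using Hom assms by (simp add: Hom_eq_arrow)
qed

subsection \<open>Isomorphisms of modular graphs\<close>

definition graph_iso :: "('e \<Rightarrow> 'f) \<Rightarrow> 'e mgraph \<Rightarrow> 'f mgraph \<Rightarrow> bool" where
  "graph_iso \<phi> G H \<longleftrightarrow> bij_betw \<phi> (Edges G) (Edges H) \<and>
     (\<forall>x\<in>Edges G. \<phi> (twin G x) = twin H (\<phi> x) \<and> \<phi> (nxt G x) = nxt H (\<phi> x))"

abbreviation map_path :: "('e \<Rightarrow> 'f) \<Rightarrow> 'e path \<Rightarrow> 'f path" where
  "map_path \<phi> \<equiv> map (map_prod (image \<phi>) \<phi>)"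

lemma graph_isoD:
  assumes "graph_iso \<phi> G H"
  shows "bij_betw \<phi> (Edges G) (Edges H)" "x \<in> Edges G \<Longrightarrow> \<phi> x \<in> Edges H"
    "x \<in> Edges G \<Longrightarrow> \<phi> (twin G x) = twin H (\<phi> x)" "x \<in> Edges G \<Longrightarrow> \<phi> (nxt G x) = nxt H (\<phi> x)"
    "x \<in> Edges G \<Longrightarrow> y \<in> Edges G \<Longrightarrow> \<phi> x = \<phi> y \<longleftrightarrow> x = y"
  using assms by (auto simp: graph_iso_def bij_betw_def inj_on_eq_iff)

lemma graph_iso_comp:
  "graph_iso \<phi> G H \<Longrightarrow> graph_iso \<psi> H K \<Longrightarrow> graph_iso (\<psi> \<circ> \<phi>) G K"
  by (auto simp: graph_iso_def bij_betw_apply intro: bij_betw_trans)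

lemma graph_iso_inv:
  assumes G: "modular_graph G" and \<phi>: "graph_iso \<phi> G H"
  shows "graph_iso (inv_into (Edges G) \<phi>) H G"
proof -
  note bij = graph_isoD(1)[OF \<phi>]
  have *: "inv_into (Edges G) \<phi> (\<phi> x) = x" if "x \<in> Edges G" for x
    using that bij by (simp add: bij_betw_def)
  show ?thesis
    unfolding graph_iso_def
  proof (intro conjI ballI)
    fix y assume "y \<in> Edges H"
    then obtain x where x: "x \<in> Edges G" "y = \<phi> x" using bij by (auto simp: bij_betw_def)
    show "inv_into (Edges G) \<phi> (twin H y) = twin G (inv_into (Edges G) \<phi> y)"
      "inv_into (Edges G) \<phi> (nxt H y) = nxt G (inv_into (Edges G) \<phi> y)"
      using x modular_graphD[OF G] * by (simp_all flip: graph_isoD(3,4)[OF \<phi>])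
  qed (rule bij_betw_inv_into[OF bij])
qed

lemma graph_iso_vert:
  assumes "modular_graph G" "graph_iso \<phi> G H" "x \<in> Edges G"
  shows "\<phi> ` vert2 G x = vert2 H (\<phi> x)" "\<phi> ` vert3 G x = vert3 H (\<phi> x)"
  using assms modular_graphD[OF assms(1)] by (simp_all add: vert2_def vert3_def graph_isoD)

lemma graph_iso_Verts:
  "modular_graph G \<Longrightarrow> graph_iso \<phi> G H \<Longrightarrow> v \<in> Verts G \<Longrightarrow> \<phi> ` v \<in> Verts H"
  using graph_iso_vert[of G \<phi> H] graph_isoD(2)[of \<phi> G H] by (auto simp: Verts_def)

lemma graph_iso_path:
  assumes "modular_graph G" "graph_iso \<phi> G H" "is_path G x p y"
  shows "is_path H (\<phi> x) (map_path \<phi> p) (\<phi> y)"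
  using assms(3)
  by (induction p arbitrary: x) (auto simp: graph_isoD[OF assms(2)] graph_iso_Verts[OF assms(1,2)])

lemma map_path_inv:
  assumes G: "modular_graph G" and H: "modular_graph H" and \<phi>: "graph_iso \<phi> G H" and "is_path H x p y"
  shows "map_path \<phi> (map_path (inv_into (Edges G) \<phi>) p) = p"
  using assms(4)
proof (induction p arbitrary: x)
  case (Cons s p)
  obtain v z where s: "s = (v, z)" by (cases s)
  then have v: "v \<subseteq> Edges H" "z \<in> v" using Cons.prems Verts_subset_Edges[OF H] by auto
  have img: "\<phi> ` Edges G = Edges H" using graph_isoD(1)[OF \<phi>] by (simp add: bij_betw_def)
  then have "\<phi> ` inv_into (Edges G) \<phi> ` v = v" "\<phi> (inv_into (Edges G) \<phi> z) = z"
    using v by (auto simp: image_inv_into_cancel f_inv_into_f)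
  then show ?case using Cons s by auto
qed simp

lemma graph_iso_modular:
  assumes G: "modular_graph G" and \<phi>: "graph_iso \<phi> G H"
  shows "modular_graph H"
proof -
  have surj: "\<exists>x\<in>Edges G. y = \<phi> x" if "y \<in> Edges H" for y
    using that graph_isoD(1)[OF \<phi>] by (auto simp: bij_betw_def)
  have "Edges H \<noteq> {}" using G graph_isoD(2)[OF \<phi>] by (auto simp: modular_graph_def)
  moreover have "twin H y \<in> Edges H \<and> twin H y \<noteq> y \<and> twin H (twin H y) = y"
    "nxt H y \<in> Edges H \<and> nxt H y \<noteq> y \<and> nxt H (nxt H (nxt H y)) = y" if "y \<in> Edges H" for y
  proof -
    obtain x where x: "x \<in> Edges G" "y = \<phi> x" using surj \<open>y \<in> Edges H\<close> by blast
    show "twin H y \<in> Edges H \<and> twin H y \<noteq> y \<and> twin H (twin H y) = y"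
      "nxt H y \<in> Edges H \<and> nxt H y \<noteq> y \<and> nxt H (nxt H (nxt H y)) = y"
      using x modular_graphD[OF G] by (simp_all add: graph_isoD(2,5)[OF \<phi>] flip: graph_isoD(3,4)[OF \<phi>])
  qed
  moreover have "\<exists>p. is_path H y p y'" if "y \<in> Edges H" "y' \<in> Edges H" for y y'
  proof -
    obtain x x' where x: "x \<in> Edges G" "y = \<phi> x" "x' \<in> Edges G" "y' = \<phi> x'" using surj \<open>y \<in> _\<close> \<open>y' \<in> _\<close> by blast
    obtain p where "is_path G x p x'" using path_exists[OF G x(1,3)] .
    then show ?thesis using graph_iso_path[OF G \<phi>] x by blast
  qed
  ultimately show ?thesis unfolding modular_graph_def by blast
qed

lemma graph_iso_reduces:
  assumes G: "modular_graph G" and \<phi>: "graph_iso \<phi> G H" and "reduces G x p p'"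
  shows "reduces H (\<phi> x) (map_path \<phi> p) (map_path \<phi> p')"
  using assms(3)
proof cases
  case (stay r y v q z)
  have "reduces H (\<phi> x) (map_path \<phi> r @ (\<phi> ` v, \<phi> y) # map_path \<phi> q) (map_path \<phi> r @ map_path \<phi> q)"
    using reduces.stay[OF graph_iso_path[OF G \<phi> stay(3)] graph_iso_Verts[OF G \<phi> stay(4)] _
        graph_iso_path[OF G \<phi> stay(6)]] stay(5) by blast
  then show ?thesis unfolding stay by simp
next
  case (shortcut r y v w w' q z)
  have "reduces H (\<phi> x) (map_path \<phi> r @ (\<phi> ` v, \<phi> w) # (\<phi> ` v, \<phi> w') # map_path \<phi> q)
      (map_path \<phi> r @ (\<phi> ` v, \<phi> w') # map_path \<phi> q)"
    using reduces.shortcut[OF graph_iso_path[OF G \<phi> shortcut(3)] graph_iso_Verts[OF G \<phi> shortcut(4)] _ _ _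
        graph_iso_path[OF G \<phi> shortcut(8)]] shortcut(5-7) by blast
  then show ?thesis unfolding shortcut by simp
qed

lemma graph_iso_homotopic:
  assumes "modular_graph G" "graph_iso \<phi> G H" "homotopic G x p q"
  shows "homotopic H (\<phi> x) (map_path \<phi> p) (map_path \<phi> q)"
  using assms(3) unfolding homotopic_def
proof (induction rule: equivclp_induct)
  case (step q q')
  then show ?case using graph_iso_reduces[OF assms(1,2)] by (blast intro: equivclp_into_equivclp)
qed simp

lemma graph_iso_simply_connected:
  assumes G: "simply_connected G" and \<phi>: "graph_iso \<phi> G H"
  shows "simply_connected H"
proof -
  have mG: "modular_graph G" using G by (simp add: simply_connected_def)
  then have mH: "modular_graph H" using \<phi> by (rule graph_iso_modular)
  define \<psi> where "\<psi> = inv_into (Edges G) \<phi>"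
  have \<psi>: "graph_iso \<psi> H G" unfolding \<psi>_def using mG \<phi> by (rule graph_iso_inv)
  have "homotopic H x p q" if "is_path H x p y" "is_path H x q y" for x p q y
  proof -
    have "homotopic G (\<psi> x) (map_path \<psi> p) (map_path \<psi> q)"
      using G graph_iso_path[OF mH \<psi>] that unfolding simply_connected_def by blast
    then have "homotopic H (\<phi> (\<psi> x)) (map_path \<phi> (map_path \<psi> p)) (map_path \<phi> (map_path \<psi> q))"
      by (rule graph_iso_homotopic[OF mG \<phi>])
    moreover have "\<phi> (\<psi> x) = x"
      using is_path_Edges[OF mH that(1)] graph_isoD(1)[OF \<phi>] by (simp add: \<psi>_def bij_betw_def f_inv_into_f)
    ultimately show ?thesis using map_path_inv[OF mG mH \<phi>] that by (simp add: \<psi>_def)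
  qed
  then show ?thesis using mH by (simp add: simply_connected_def)
qed

lemma iso_induced_arrow:
  assumes G: "modular_graph G" and \<phi>: "graph_iso \<phi> G H" and x: "x \<in> Edges G" "y \<in> Edges G"
  shows "map_prod \<phi> (map_path \<phi>) ` arrow G x y = arrow H (\<phi> x) (\<phi> y)"
proof -
  have mH: "modular_graph H" using G \<phi> by (rule graph_iso_modular)
  define \<psi> where "\<psi> = inv_into (Edges G) \<phi>"
  have \<psi>: "graph_iso \<psi> H G" unfolding \<psi>_def using G \<phi> by (rule graph_iso_inv)
  have inv: "\<psi> (\<phi> z) = z" if "z \<in> Edges G" for z
    using that graph_isoD(1)[OF \<phi>] by (simp add: \<psi>_def bij_betw_def)
  show ?thesis
  proof (intro equalityI subsetI)
    fix s assume "s \<in> map_prod \<phi> (map_path \<phi>) ` arrow G x y"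
    then show "s \<in> arrow H (\<phi> x) (\<phi> y)" using graph_iso_path[OF G \<phi>] by (auto simp: arrow_def)
  next
    fix s assume "s \<in> arrow H (\<phi> x) (\<phi> y)"
    then obtain p where p: "s = (\<phi> x, p)" "is_path H (\<phi> x) p (\<phi> y)" by (auto simp: arrow_def)
    then have "is_path G x (map_path \<psi> p) y" using graph_iso_path[OF mH \<psi>] inv x by metis
    moreover have "map_path \<phi> (map_path \<psi> p) = p" using map_path_inv[OF G mH \<phi>] p by (simp add: \<psi>_def)
    ultimately show "s \<in> map_prod \<phi> (map_path \<phi>) ` arrow G x y"
      using p(1) by (intro image_eqI[of _ _ "(x, map_path \<psi> p)"]) (simp_all add: arrow_def)
  qed
qed

lemma flip_simps [simp]: "Edges (flip G f) = Edges G" "twin (flip G f) = twin G"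
  by (simp_all add: flip_def Let_def)

lemma graph_iso_flip:
  assumes G: "modular_graph G" and \<phi>: "graph_iso \<phi> G H" and f: "f \<in> Edges G"
  shows "graph_iso \<phi> (flip G f) (flip H (\<phi> f))"
proof -
  note D = modular_graphD[OF G]
  have inj: "inj_on \<phi> (Edges G)" using graph_isoD(1)[OF \<phi>] by (simp add: bij_betw_def)
  have sub: "vert3 G x \<subseteq> Edges G" if "x \<in> Edges G" for x using that D by (simp add: vert3_def)
  have trivial: "flip_trivial H (\<phi> f) \<longleftrightarrow> flip_trivial G f"
    unfolding flip_trivial_def using f D graph_iso_vert(2)[OF G \<phi>] inj_on_image_eq_iff[OF inj] sub
    by (metis graph_isoD(3)[OF \<phi>])
  show ?thesis
  proof (cases "flip_trivial G f")
    case True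
    then show ?thesis using \<phi> trivial by (simp add: flip_def)
  next
    case False
    define e a where "e = twin G f" and "a = nxt G f"
    define b d where "b = nxt G a" and "d = nxt G e"
    define c where "c = nxt G d"
    have E: "e \<in> Edges G" "a \<in> Edges G" "b \<in> Edges G" "d \<in> Edges G" "c \<in> Edges G"
      using f D by (simp_all add: e_def a_def b_def d_def c_def)
    have H: "twin H (\<phi> f) = \<phi> e" "nxt H (\<phi> f) = \<phi> a" "nxt H (\<phi> a) = \<phi> b" "nxt H (\<phi> e) = \<phi> d"
      "nxt H (\<phi> d) = \<phi> c"
      using f E graph_isoD(3,4)[OF \<phi>] by (simp_all add: e_def a_def b_def d_def c_def)
    have nxtG: "nxt (flip G f) = (nxt G)(e := c, c := a, a := e, f := b, b := d, d := f)"
      using False by (simp add: flip_def Let_def e_def a_def b_def d_def c_def)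
    have nxtH: "nxt (flip H (\<phi> f)) =
        (nxt H)(\<phi> e := \<phi> c, \<phi> c := \<phi> a, \<phi> a := \<phi> e, \<phi> f := \<phi> b, \<phi> b := \<phi> d, \<phi> d := \<phi> f)"
      using False trivial H by (simp add: flip_def Let_def)
    show ?thesis
      unfolding graph_iso_def
    proof (intro conjI ballI)
      fix x assume "x \<in> Edges (flip G f)"
      then have x: "x \<in> Edges G" by simp
      show "\<phi> (twin (flip G f) x) = twin (flip H (\<phi> f)) (\<phi> x)"
        using x graph_isoD(3)[OF \<phi>] by simp
      show "\<phi> (nxt (flip G f) x) = nxt (flip H (\<phi> f)) (\<phi> x)"
        unfolding nxtG nxtH using x f E graph_isoD(4,5)[OF \<phi>] by simp
    qed (use graph_isoD(1)[OF \<phi>] in simp)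
  qed
qed

subsection \<open>The Farey tree is simply connected\<close>

fun reduced_path :: "'e \<Rightarrow> 'e path \<Rightarrow> bool" where
  "reduced_path x [] \<longleftrightarrow> True"
| "reduced_path x ((v, z) # p) \<longleftrightarrow>
    z \<noteq> x \<and> (case p of [] \<Rightarrow> True | (w, _) # _ \<Rightarrow> w \<noteq> v) \<and> reduced_path z p"

lemma reduces_Cons:
  assumes "reduces G z p p'" "v \<in> Verts G" "x \<in> v" "z \<in> v"
  shows "reduces G x ((v, z) # p) ((v, z) # p')"
  using assms(1)
proof cases
  case (stay r y w q z')
  then show ?thesis using reduces.stay[of G x "(v, z) # r" y w q z'] assms(2-) by simp
next
  case (shortcut r y u w w' q z')
  then show ?thesis using reduces.shortcut[of G x "(v, z) # r" y u w w' q z'] assms(2-) by simp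
qed

lemma not_reduced_shorten:
  assumes G: "modular_graph G" and "is_path G x p y" "\<not> reduced_path x p"
  shows "\<exists>p'. reduces G x p p' \<and> length p' < length p"
  using assms(2,3)
proof (induction p arbitrary: x)
  case (Cons s p)
  obtain v z where s: "s = (v, z)" by (cases s)
  have v: "v \<in> Verts G" "x \<in> v" "z \<in> v" and p: "is_path G z p y" using Cons.prems s by simp_all
  have x: "is_path G x [] x" using Verts_subset_Edges[OF G v(1,2)] by simp
  consider "z = x" | z' q where "p = (v, z') # q" | "\<not> reduced_path z p"
  proof (cases p)
    case Nil
    then show ?thesis using Cons.prems(2) s that(1) by auto
  next
    case (Cons t q)
    obtain w z' where "t = (w, z')" by (cases t)
    then show ?thesis using Cons.prems(2) Cons s that by (cases "w = v") auto
  qed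
  then show ?case
  proof cases
    case 1
    then have "reduces G x ([] @ (v, x) # p) ([] @ p)" using p by (intro reduces.stay[OF x v(1,2)]) simp
    then show ?thesis using s 1 by auto
  next
    case 2
    then have "reduces G x ([] @ (v, z) # (v, z') # q) ([] @ (v, z') # q)"
      using p 2 by (intro reduces.shortcut[where q = q and z = y, OF x v(1,2,3)]) simp_all
    then show ?thesis using s 2 by (intro exI[of _ p]) simp
  next
    case 3
    then obtain p' where "reduces G z p p'" "length p' < length p" using Cons.IH[OF p] by blast
    then show ?thesis using reduces_Cons[OF _ v] s by (intro exI[of _ "(v, z) # p'"]) simp
  qed
qed simp

lemma homotopic_reduced:
  assumes G: "modular_graph G" and "is_path G x p y"
  shows "\<exists>q. homotopic G x p q \<and> is_path G x q y \<and> reduced_path x q"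
  using assms(2)
proof (induction p rule: length_induct)
  case (1 p)
  show ?case
  proof (cases "reduced_path x p")
    case False
    then obtain p' where p': "reduces G x p p'" "length p' < length p"
      using not_reduced_shorten[OF G 1(2)] by blast
    then have p: "homotopic G x p p'" unfolding homotopic_def by blast
    then have "is_path G x p' y" using homotopic_is_path[OF G _ 1(2)] by blast
    then obtain q where "homotopic G x p' q" "is_path G x q y" "reduced_path x q"
      using 1(1) p'(2) by blast
    then show ?thesis using p unfolding homotopic_def by (meson equivclp_trans)
  next
    case True
    then show ?thesis using 1(2) by (intro exI[of _ p]) (simp add: homotopic_def)
  qed
qed

text \<open>The edges beyond the vertex \<open>v\<close> of the edge \<open>x\<close>.\<close>

definition far_side :: "psl2z set \<Rightarrow> psl2z \<Rightarrow> psl2z set" where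
  "far_side v x = (if v = vert3 farey x then (*) x ` (cone - {1}) else (*) x ` (cone2 - {1}))"

lemma far_side_self: "x \<notin> far_side v x"
  by (auto simp: far_side_def)

lemma far_side_simps:
  "far_side (vert3 farey x) x = (*) x ` (cone - {1})" "far_side (vert2 farey x) x = (*) x ` (cone2 - {1})"
  by (simp_all add: far_side_def)

lemma far_side_disjoint:
  assumes "v \<in> Verts farey" "v' \<in> Verts farey" "x \<in> v" "x \<in> v'" "y \<in> far_side v x" "y \<in> far_side v' x"
  shows "v = v'"
proof (rule ccontr)
  assume "v \<noteq> v'"
  then have "y \<in> (*) x ` (cone - {1})" "y \<in> (*) x ` (cone2 - {1})"
    using assms Verts_farey_cases[of v x] Verts_farey_cases[of v' x] by (auto simp: far_side_simps)
  then show False by (auto simp: cone2_def)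
qed

lemma vert_mem_far_side:
  assumes "v \<in> Verts farey" "x \<in> v" "z \<in> v" "z \<noteq> x"
  shows "z \<in> far_side v x"
  using Verts_farey_cases[OF assms(1,2)]
proof
  assume v: "v = vert2 farey x"
  then have z: "z = x * S" using assms by (auto simp: vert2_farey)
  show ?thesis unfolding v z far_side_simps by (rule imageI) simp
next
  assume v: "v = vert3 farey x"
  then have z: "z = x * L \<or> z = x * (L * L)" using assms by (auto simp: vert3_farey mult.assoc)
  show ?thesis unfolding v far_side_simps using z by (auto intro: image_eqI[of _ _ L] image_eqI[of _ _ "L * L"])
qed

lemma mult_image_subset:
  "(\<And>V. V \<in> A \<Longrightarrow> W * V \<in> B) \<Longrightarrow> (*) (x * W) ` A \<subseteq> (*) (x::psl2z) ` B"
  by (auto simp: mult.assoc)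

text \<open>Successive steps of a reduced path lead into nested sides, so the path never returns to
  its start.\<close>

lemma far_side_step:
  assumes v: "v \<in> Verts farey" "x \<in> v" "z \<in> v" "z \<noteq> x" and w: "w \<in> Verts farey" "z \<in> w" "w \<noteq> v"
  shows "far_side w z \<subseteq> far_side v x"
  using Verts_farey_cases[OF v(1,2)]
proof
  assume *: "v = vert2 farey x"
  then have z: "z = x * S" using v by (auto simp: vert2_farey)
  have "w = vert3 farey z" using Verts_farey_cases[OF w(1,2)] w(3) * z by auto
  then have eq: "far_side w z = (*) (x * S) ` (cone - {1})" by (simp add: far_side_simps z)
  have "S * V \<in> cone2 - {1}" if "V \<in> cone - {1}" for V
  proof -
    have "S * V \<notin> cone" using that by simp
    then show ?thesis by (auto simp: cone2_def)
  qed
  then show ?thesis unfolding * far_side_simps eq by (rule mult_image_subset)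
next
  assume *: "v = vert3 farey x"
  then have z: "z = x * L \<or> z = x * (L * L)" using v by (auto simp: vert3_farey mult.assoc)
  have "v = vert3 farey z"
    using z vert3_farey_L[of x] vert3_farey_L[of "x * L"] unfolding * mult.assoc by metis
  then have "w = vert2 farey z" using Verts_farey_cases[OF w(1,2)] w(3) by blast
  then have eq: "far_side w z = (*) z ` (cone2 - {1})" by (simp add: far_side_simps)
  have L: "L * V \<in> cone - {1}" "L * L * V \<in> cone - {1}" if "V \<in> cone2 - {1}" for V
    using that by (simp_all add: mult.assoc)
  from z show ?thesis
  proof
    assume "z = x * L"
    show ?thesis unfolding * far_side_simps eq unfolding \<open>z = x * L\<close> by (rule mult_image_subset) (rule L(1))
  next
    assume "z = x * (L * L)"
    show ?thesis unfolding * far_side_simps eq unfolding \<open>z = x * (L * L)\<close> by (rule mult_image_subset) (rule L(2))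
  qed
qed

lemma reduced_far_side:
  "is_path farey x ((v, z) # p) y \<Longrightarrow> reduced_path x ((v, z) # p) \<Longrightarrow> y \<in> far_side v x"
proof (induction p arbitrary: x v z)
  case Nil
  then show ?case using vert_mem_far_side[of v x z] by auto
next
  case (Cons s p)
  obtain w z' where s: "s = (w, z')" by (cases s)
  have "y \<in> far_side w z" using Cons.IH[of z w z'] Cons.prems s by simp
  then show ?case using far_side_step[of v x z w] Cons.prems s by auto
qed

text \<open>The end \<open>y\<close> determines the first step: the vertex because the two far sides
  of \<open>x\<close> are disjoint, the edge because the branches behind the other two edges at a
  vertex of degree 3 are disjoint.\<close>

lemma reduced_path_unique:
  "is_path farey x p y \<Longrightarrow> is_path farey x q y \<Longrightarrow> reduced_path x p \<Longrightarrow> reduced_path x q \<Longrightarrow> p = q"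
proof (induction p arbitrary: x q)
  case Nil
  then have y: "y = x" by simp
  have "q = []"
  proof (rule ccontr)
    assume "q \<noteq> []"
    then obtain v z q' where "q = (v, z) # q'" by (metis neq_Nil_conv surj_pair)
    then have "y \<in> far_side v x" using reduced_far_side Nil.prems(2,4) by blast
    then show False using y far_side_self by simp
  qed
  then show ?case by simp
next
  case (Cons s p)
  obtain v z where s: "s = (v, z)" by (cases s)
  have y: "y \<in> far_side v x" using reduced_far_side Cons.prems(1,3) unfolding s by blast
  have "q \<noteq> []"
  proof
    assume "q = []"
    then have "y = x" using Cons.prems(2) by simp
    then show False using y far_side_self by simp
  qed
  then obtain v' z' q' where q: "q = (v', z') # q'" by (metis neq_Nil_conv surj_pair)
  have "y \<in> far_side v' x" using reduced_far_side Cons.prems(2,4) unfolding q by blast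
  moreover have 1: "v \<in> Verts farey" "x \<in> v" "z \<in> v" "is_path farey z p y"
    using Cons.prems(1) unfolding s by simp_all
  moreover have 2: "v' \<in> Verts farey" "x \<in> v'" "z' \<in> v'" "is_path farey z' q' y"
    using Cons.prems(2) unfolding q by simp_all
  ultimately have v': "v' = v" using far_side_disjoint y by blast
  have 3: "z \<noteq> x" "reduced_path z p" "z' \<noteq> x" "reduced_path z' q'"
    using Cons.prems(3,4) unfolding s q by simp_all
  \<comment> \<open>The far side of \<open>x\<close> does not distinguish the two candidates for the
    first edge. Behind \<open>u\<close> the end lies in the translate of \<open>cone2\<close>, with
    \<open>u\<close> itself allowed in case the path stops there.\<close>
  have branch: "y \<in> (*) u ` cone2"
    if u: "is_path farey u r y" "reduced_path x ((v, u) # r)" "v = vert3 farey u" for u r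
  proof (cases "r = []")
    case True
    then have "y = u * 1" using u(1) by simp
    then show ?thesis using cone2_simps(1) by blast
  next
    case False
    then obtain w u' r' where r: "r = (w, u') # r'" by (metis neq_Nil_conv surj_pair)
    have "w \<in> Verts farey" "u \<in> w" using u(1) unfolding r by simp_all
    moreover have "w \<noteq> v" using u(2) unfolding r by simp
    ultimately have "w = vert2 farey u" using Verts_farey_cases[of w u] u(3) by blast
    moreover have "reduced_path u ((w, u') # r')" using u(2) unfolding r by simp
    then have "y \<in> far_side w u" using reduced_far_side u(1) unfolding r by blast
    ultimately have "y \<in> (*) u ` (cone2 - {1})" by (simp only: far_side_simps)
    then show ?thesis by blast
  qed
  have "z = z'"
  proof (rule ccontr)
    assume "z \<noteq> z'"
    have "v \<noteq> vert2 farey x"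
    proof
      assume "v = vert2 farey x"
      then have "z = x * S" "z' = x * S" using 1(3) 2(3) 3(1,3) unfolding v' vert2_farey by blast+
      then show False using \<open>z \<noteq> z'\<close> by simp
    qed
    then have v3: "v = vert3 farey x" using Verts_farey_cases[OF 1(1,2)] by blast
    then have zz: "z = x * L \<and> z' = x * L * L \<or> z = x * L * L \<and> z' = x * L"
      using 1(3) 2(3) 3(1,3) \<open>z \<noteq> z'\<close> unfolding v' v3 vert3_farey by blast
    then have v3': "v = vert3 farey z" "v = vert3 farey z'" using v3 vert3_farey_L by metis+
    have "y \<in> (*) z ` cone2" "y \<in> (*) z' ` cone2"
      using branch[OF 1(4) _ v3'(1)] branch[OF 2(4) _ v3'(2)] Cons.prems(3,4) unfolding s q v' by blast+
    then have "y \<in> (*) (x * L) ` cone2" "y \<in> (*) (x * L * L) ` cone2" using zz by blast+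
    then obtain V V' where V: "V \<in> cone2" "V' \<in> cone2" "x * L * V = x * L * L * V'" by blast
    then have "V = L * V'" by (simp add: mult.assoc)
    then show False using L_cone2_neq(3)[OF V(2)] V(1) by simp
  qed
  then show ?case using Cons.IH[OF 1(4) _ 3(2)] 2(4) 3(4) unfolding s q v' by blast
qed

lemma is_path_snoc:
  "is_path G x p y \<Longrightarrow> v \<in> Verts G \<Longrightarrow> y \<in> v \<Longrightarrow> z \<in> v \<Longrightarrow> z \<in> Edges G \<Longrightarrow> is_path G x (p @ [(v, z)]) z"
  by (induction p arbitrary: x) auto

lemma modular_farey: "modular_graph farey"
proof -
  have "\<exists>p. is_path farey x p (x * V)" for x V
  proof (induction V rule: psl_induct)
    case 1
    show ?case by (intro exI[of _ "[]"]) simp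
  next
    case (S V)
    then obtain p where p: "is_path farey x p (x * V)" by blast
    have "x * (V * S) \<in> vert2 farey (x * V)" by (simp add: vert2_farey mult.assoc)
    then have "is_path farey x (p @ [(vert2 farey (x * V), x * (V * S))]) (x * (V * S))"
      using is_path_snoc[OF p vert_in_Verts(1) vert_farey_self(1)] by simp
    then show ?case by blast
  next
    case (L V)
    then obtain p where p: "is_path farey x p (x * V)" by blast
    have "x * (V * L) \<in> vert3 farey (x * V)" by (simp add: vert3_farey mult.assoc)
    then have "is_path farey x (p @ [(vert3 farey (x * V), x * (V * L))]) (x * (V * L))"
      using is_path_snoc[OF p vert_in_Verts(2) vert_farey_self(2)] by simp
    then show ?case by blast
  qed
  from this[of x "psl_inv x * y" for x y] show ?thesis
    unfolding modular_graph_def by (simp add: psl_simps)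
qed

lemma simply_connected_farey: "simply_connected farey"
proof -
  have "homotopic farey x p q" if pq: "is_path farey x p y" "is_path farey x q y" for x p q y
  proof -
    obtain p' where p': "homotopic farey x p p'" "is_path farey x p' y" "reduced_path x p'"
      using homotopic_reduced[OF modular_farey pq(1)] by blast
    obtain q' where q': "homotopic farey x q q'" "is_path farey x q' y" "reduced_path x q'"
      using homotopic_reduced[OF modular_farey pq(2)] by blast
    have "p' = q'" using reduced_path_unique p' q' by blast
    then show ?thesis using p'(1) q'(1) unfolding homotopic_def by (metis equivclp_sym equivclp_trans)
  qed
  then show ?thesis using modular_farey by (simp add: simply_connected_def)
qed

subsection \<open>Flips of the Farey tree\<close>

lemma psl_six_distinct: "distinct [1, S, L, L * L, S * L, S * (L * L)]"
  using S_L_cone2_neq[of 1] pentagon_neqs(2,3)[of 1] psl_cone_complement[of L] psl_cone_complement[of "L * L"]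
  by (auto simp del: psl_cone_complement)

lemma flip_trivial_farey: "\<not> flip_trivial farey f"
proof -
  have "f * S \<notin> vert3 farey f" by (simp add: vert3_farey mult.assoc)
  then show ?thesis unfolding flip_trivial_def by (metis farey_simps(2) vert_farey_self(2))
qed

lemma nxt_flip_farey:
  "nxt (flip farey 1) = (\<lambda>W. W * L)(S := S * (L * L), S * (L * L) := L,
     L := S, 1 := L * L, L * L := S * L, S * L := 1)"
  using flip_trivial_farey by (simp add: flip_def Let_def farey_def mult.assoc)

text \<open>This identification lets flips be seen as permutations of the edges of one fixed
  tree.\<close>

lemma graph_iso_flip_map: "graph_iso flip_map (flip farey 1) farey"
  unfolding graph_iso_def
proof (intro conjI ballI)
  show "bij_betw flip_map (Edges (flip farey 1)) (Edges farey)" by (simp add: bij_flip_map)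
next
  fix x
  show "flip_map (twin (flip farey 1) x) = twin farey (flip_map x)" by (simp add: flip_map_mult_S)
  show "flip_map (nxt (flip farey 1) x) = nxt farey (flip_map x)"
  proof (cases "x \<in> {1, L, L * L, S, S * L, S * (L * L)}")
    case True
    then show ?thesis using psl_six_distinct by (auto simp: nxt_flip_farey psl_simps)
  next
    case False
    then show ?thesis using flip_map_mult_L[of x] by (simp add: nxt_flip_farey)
  qed
qed

lemma graph_iso_inv_flip_map: "graph_iso (Hilbert_Choice.inv flip_map) farey (flip farey 1)"
  unfolding graph_iso_def
proof (intro conjI ballI)
  show "bij_betw (Hilbert_Choice.inv flip_map) (Edges farey) (Edges (flip farey 1))"
    by (simp add: bij_flip_map bij_imp_bij_inv)
next
  fix y
  obtain x where x: "y = flip_map x" using bij_is_surj[OF bij_flip_map] by blast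
  note inv = inv_f_f[OF bij_is_inj[OF bij_flip_map]]
  show "Hilbert_Choice.inv flip_map (twin farey y) = twin (flip farey 1) (Hilbert_Choice.inv flip_map y)"
    "Hilbert_Choice.inv flip_map (nxt farey y) = nxt (flip farey 1) (Hilbert_Choice.inv flip_map y)"
    unfolding x inv using graph_isoD(3,4)[OF graph_iso_flip_map, of x] inv by (metis UNIV_I farey_simps(1) flip_simps(1))+
qed

lemma graph_iso_mult: "graph_iso ((*) W) farey farey"
  by (simp add: graph_iso_def bij_psl_mult mult.assoc)

lemma graph_iso_farey_imp_mult: "graph_iso \<psi> farey farey \<Longrightarrow> \<psi> = (*) (\<psi> 1)"
  by (rule equivariant_imp_mult) (simp_all add: graph_iso_def)

text \<open>Flips are natural, so the automorphism taking 1 to \<open>W\<close> reduces the flip at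
  \<open>\<psi> W\<close> to the flip at 1.\<close>

lemma graph_iso_flip_farey:
  assumes \<psi>: "graph_iso \<psi> farey G"
  shows "graph_iso (\<psi> \<circ> (*) W \<circ> Hilbert_Choice.inv flip_map) farey (flip G (\<psi> W))"
proof -
  have "graph_iso (\<psi> \<circ> (*) W) farey G" using graph_iso_comp[OF graph_iso_mult \<psi>] .
  then have "graph_iso (\<psi> \<circ> (*) W) (flip farey 1) (flip G ((\<psi> \<circ> (*) W) 1))"
    by (intro graph_iso_flip modular_farey) simp_all
  from graph_iso_comp[OF graph_iso_inv_flip_map this] show ?thesis by simp
qed

section \<open>Permutations of edges as groupoid automorphisms\<close>

lemma perm_to_auto_eq:
  assumes "\<Phi> = (\<pi>, \<Psi>)" "\<Psi> \<in> extensional (Arr farey)"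
    and "\<And>x y. \<Psi> (arrow farey x y) = arrow farey (\<pi> x) (\<pi> y)"
  shows "\<Phi> = perm_to_auto \<pi>"
proof -
  note sc = simply_connected_farey
  have "\<Psi> \<alpha> = snd (perm_to_auto \<pi>) \<alpha>" for \<alpha>
  proof (cases "\<alpha> \<in> Arr farey")
    case True
    then obtain x y where \<alpha>: "\<alpha> = arrow farey x y" by (auto simp: Arr_eq_arrow[OF sc])
    have "(THE \<beta>. \<exists>x' y'. \<alpha> \<in> Hom farey x' y' \<and> \<beta> \<in> Hom farey (\<pi> x') (\<pi> y')) = arrow farey (\<pi> x) (\<pi> y)"
      by (rule the_equality) (auto simp: Hom_eq_arrow[OF sc] \<alpha> arrow_eq_iff[OF modular_farey])
    then show ?thesis using True assms(3) by (simp add: perm_to_auto_def \<alpha>)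
  qed (use assms(2) in \<open>simp add: perm_to_auto_def extensional_def\<close>)
  then show ?thesis using assms(1) by (simp add: perm_to_auto_def fun_eq_iff)
qed

lemma fst_perm_to_auto [simp]: "fst (perm_to_auto \<pi>) = \<pi>"
  by (simp add: perm_to_auto_def)

lemma perm_to_auto_eq_pair_map: "perm_to_auto \<pi> = pair_map farey farey \<pi>"
proof (rule perm_to_auto_eq[symmetric])
  show "pair_map farey farey \<pi> = (\<pi>, snd (pair_map farey farey \<pi>))"
    by (simp add: pair_map_def restrict_def)
  show "snd (pair_map farey farey \<pi>) \<in> extensional (Arr farey)" by (simp add: pair_map_def)
  show "snd (pair_map farey farey \<pi>) (arrow farey x y) = arrow farey (\<pi> x) (\<pi> y)" for x y
    by (rule snd_pair_map[OF simply_connected_farey]) simp_all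
qed

lemma snd_perm_to_auto: "snd (perm_to_auto \<pi>) (arrow farey x y) = arrow farey (\<pi> x) (\<pi> y)"
  by (simp add: perm_to_auto_eq_pair_map snd_pair_map[OF simply_connected_farey])

lemma gcomp_perm_to_auto:
  assumes "fst \<Psi> \<circ> \<pi> = \<tau>" "\<And>x y. snd \<Psi> (arrow farey x y) = arrow farey (fst \<Psi> x) (fst \<Psi> y)"
  shows "gcomp farey \<Psi> (perm_to_auto \<pi>) = perm_to_auto \<tau>"
proof (rule perm_to_auto_eq)
  show "gcomp farey \<Psi> (perm_to_auto \<pi>) = (\<tau>, compose (Arr farey) (snd \<Psi>) (snd (perm_to_auto \<pi>)))"
    using assms(1) by (auto simp: gcomp_def compose_def fun_eq_iff)
  show "compose (Arr farey) (snd \<Psi>) (snd (perm_to_auto \<pi>)) \<in> extensional (Arr farey)"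
    by simp
  fix x y
  have "arrow farey x y \<in> Arr farey" by (auto simp: Arr_eq_arrow[OF simply_connected_farey])
  then show "compose (Arr farey) (snd \<Psi>) (snd (perm_to_auto \<pi>)) (arrow farey x y) = arrow farey (\<tau> x) (\<tau> y)"
    using assms by (auto simp: compose_eq snd_perm_to_auto fun_eq_iff)
qed

lemma perm_to_auto_comp:
  "gcomp farey (perm_to_auto \<pi>) (perm_to_auto \<tau>) = perm_to_auto (\<pi> \<circ> \<tau>)"
  by (rule gcomp_perm_to_auto) (simp_all add: snd_perm_to_auto)

lemma gid_farey: "gid farey = perm_to_auto id"
proof (rule perm_to_auto_eq)
  show "gid farey = (id, restrict id (Arr farey))" by (auto simp: gid_def fun_eq_iff)
  fix x y
  have "arrow farey x y \<in> Arr farey" by (auto simp: Arr_eq_arrow[OF simply_connected_farey])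
  then show "restrict id (Arr farey) (arrow farey x y) = arrow farey (id x) (id y)" by simp
qed simp

subsection \<open>Morphisms induced by flips\<close>

text \<open>Intermediate graphs are not the Farey tree itself, so the object map is kept in the form
  \<open>\<psi> \<circ> \<pi>\<close>: \<open>\<psi>\<close> identifies the tree with the current
  graph, and \<open>\<pi>\<close> collects the generators. When the sequence returns to the tree,
  \<open>\<psi>\<close> is an automorphism and hence a left multiplication.\<close>

lemma induced_imp_flip_group:
  assumes "induced (farey, l) Y \<Phi>"
  shows "\<exists>\<psi> \<pi>. graph_iso \<psi> farey (fst Y) \<and> \<pi> \<in> flip_group \<and> fst \<Phi> = \<psi> \<circ> \<pi> \<and>
     snd \<Phi> \<in> extensional (Arr farey) \<and>
     (\<forall>x y. snd \<Phi> (arrow farey x y) = arrow (fst Y) (\<psi> (\<pi> x)) (\<psi> (\<pi> y)))"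
  using assms
proof (induction rule: induced.induct)
  case start
  have "graph_iso id farey farey" by (simp add: graph_iso_def)
  moreover have "snd (gid farey) \<in> extensional (Arr farey)" by (simp add: gid_def)
  ultimately have "graph_iso id farey farey \<and> id \<in> flip_group \<and> fst (gid farey) = id \<circ> id \<and>
      snd (gid farey) \<in> extensional (Arr farey) \<and>
      (\<forall>x y. snd (gid farey) (arrow farey x y) = arrow farey (id (id x)) (id (id y)))"
    using flip_group.id snd_perm_to_auto[of id] fst_perm_to_auto[of id] unfolding gid_farey by simp
  then show ?case unfolding fst_conv by blast
next
  case (flip G l' \<Phi> f \<Psi>)
  then obtain \<psi> \<pi> where *: "graph_iso \<psi> farey G" "\<pi> \<in> flip_group" "fst \<Phi> = \<psi> \<circ> \<pi>"
    "\<And>x y. snd \<Phi> (arrow farey x y) = arrow G (\<psi> (\<pi> x)) (\<psi> (\<pi> y))" unfolding fst_conv by blast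
  have G: "simply_connected G" using graph_iso_simply_connected[OF simply_connected_farey *(1)] .
  obtain W where W: "f = \<psi> W" using flip.hyps graph_isoD(1)[OF *(1)] by (auto simp: bij_betw_def)
  \<comment> \<open>The flip fixes every edge in this model, so the object map must not change: the
    inverse of \<open>flip_map\<close> in \<open>\<psi>'\<close> cancels against
    \<open>flip_map\<close> in \<open>\<pi>'\<close>.\<close>
  define \<psi>' where "\<psi>' = \<psi> \<circ> (*) W \<circ> Hilbert_Choice.inv flip_map"
  define \<pi>' where "\<pi>' = flip_map \<circ> (*) (psl_inv W) \<circ> \<pi>"
  have \<psi>': "graph_iso \<psi>' farey (flip G f)" unfolding \<psi>'_def W by (rule graph_iso_flip_farey[OF *(1)])
  have G': "simply_connected (flip G f)" using graph_iso_simply_connected[OF simply_connected_farey \<psi>'] .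
  have "\<pi>' \<in> flip_group" unfolding \<pi>'_def using *(2) by (intro flip_group_comp flip_group_flip flip_group_mult)
  have eq: "\<psi>' (\<pi>' x) = \<psi> (\<pi> x)" for x
    using bij_flip_map by (simp add: \<psi>'_def \<pi>'_def bij_is_inj)
  have in_G: "\<psi> x \<in> Edges G" for x using graph_isoD(2)[OF *(1)] by simp
  \<comment> \<open>Twins of the Farey tree share no vertex of degree 3, and \<open>\<psi>\<close>
    carries this over to \<open>G\<close>.\<close>
  have "\<not> flip_trivial G f"
  proof -
    have "W * S \<notin> vert3 farey W" by (simp add: vert3_farey mult.assoc)
    then have "\<psi> (W * S) \<notin> \<psi> ` vert3 farey W" using graph_isoD(5)[OF *(1)] by auto
    then have "twin G f \<notin> vert3 G f"
      using graph_iso_vert(2)[OF modular_farey *(1), of W] graph_isoD(3)[OF *(1), of W] by (simp add: W)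
    then show ?thesis unfolding flip_trivial_def vert3_def[of G "twin G f"] by blast
  qed
  then have \<Psi>: "groupoid_iso G (flip G f) \<Psi>" "\<And>x. x \<in> Edges G \<Longrightarrow> fst \<Psi> x = x"
    using flip.hyps unfolding flip_induced_def by (simp_all add: Let_def)
  show ?case
  proof (intro exI conjI allI)
    show "graph_iso \<psi>' farey (fst (flip G f, l'))" using \<psi>' by simp
    show "\<pi>' \<in> flip_group" by fact
    show "fst (gcomp (fst (farey, l)) \<Psi> \<Phi>) = \<psi>' \<circ> \<pi>'"
      using *(3) \<Psi>(2) in_G by (auto simp: gcomp_def compose_def eq fun_eq_iff)
    show "snd (gcomp (fst (farey, l)) \<Psi> \<Phi>) \<in> extensional (Arr farey)" by (simp add: gcomp_def)
    fix x y
    have "arrow farey x y \<in> Arr farey" by (auto simp: Arr_eq_arrow[OF simply_connected_farey])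
    then show "snd (gcomp (fst (farey, l)) \<Psi> \<Phi>) (arrow farey x y) = arrow (fst (flip G f, l')) (\<psi>' (\<pi>' x)) (\<psi>' (\<pi>' y))"
      using groupoid_iso_arrow[OF G G' \<Psi>(1) in_G in_G] \<Psi>(2)[OF in_G] by (simp add: gcomp_def compose_eq *(4) eq)
  qed
next
  case (relabel G l' \<Phi> \<rho>)
  then show ?case by simp
next
  case (transport Y \<Phi> \<phi> Z)
  then obtain \<psi> \<pi> where *: "graph_iso \<psi> farey (fst Y)" "\<pi> \<in> flip_group" "fst \<Phi> = \<psi> \<circ> \<pi>"
    "\<And>x y. snd \<Phi> (arrow farey x y) = arrow (fst Y) (\<psi> (\<pi> x)) (\<psi> (\<pi> y))" by blast
  have \<phi>: "graph_iso \<phi> (fst Y) (fst Z)" using transport.hyps by (auto simp: label_iso_def graph_iso_def)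
  have G: "simply_connected (fst Y)" using graph_iso_simply_connected[OF simply_connected_farey *(1)] .
  then have mG: "modular_graph (fst Y)" by (simp add: simply_connected_def)
  have in_G: "\<psi> x \<in> Edges (fst Y)" for x using graph_isoD(2)[OF *(1)] by simp
  show ?case
  proof (intro exI conjI allI)
    show "graph_iso (\<phi> \<circ> \<psi>) farey (fst Z)" using *(1) \<phi> by (rule graph_iso_comp)
    show "\<pi> \<in> flip_group" by fact
    show "fst (gcomp (fst (farey, l)) (iso_induced \<phi> (fst Y)) \<Phi>) = \<phi> \<circ> \<psi> \<circ> \<pi>"
      using *(3) in_G by (auto simp: gcomp_def compose_def iso_induced_def fun_eq_iff)
    show "snd (gcomp (fst (farey, l)) (iso_induced \<phi> (fst Y)) \<Phi>) \<in> extensional (Arr farey)"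
      by (simp add: gcomp_def)
    fix x y
    have "arrow farey x y \<in> Arr farey" by (auto simp: Arr_eq_arrow[OF simply_connected_farey])
    moreover have "arrow (fst Y) (\<psi> (\<pi> x)) (\<psi> (\<pi> y)) \<in> Arr (fst Y)"
      using in_G by (auto simp: Arr_eq_arrow[OF G])
    ultimately show "snd (gcomp (fst (farey, l)) (iso_induced \<phi> (fst Y)) \<Phi>) (arrow farey x y) =
        arrow (fst Z) ((\<phi> \<circ> \<psi>) (\<pi> x)) ((\<phi> \<circ> \<psi>) (\<pi> y))"
      using iso_induced_arrow[OF mG \<phi> in_G in_G] by (simp add: gcomp_def compose_eq *(4) iso_induced_def)
  qed
qed

lemma PMG_imp_flip_group:
  assumes "induced (farey, l) (farey, l') \<Phi>"
  shows "fst \<Phi> \<in> flip_group" "\<Phi> = perm_to_auto (fst \<Phi>)"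
proof -
  obtain \<psi> \<pi> where *: "graph_iso \<psi> farey farey" "\<pi> \<in> flip_group" "fst \<Phi> = \<psi> \<circ> \<pi>"
    "snd \<Phi> \<in> extensional (Arr farey)"
    "\<And>x y. snd \<Phi> (arrow farey x y) = arrow farey (\<psi> (\<pi> x)) (\<psi> (\<pi> y))"
    using induced_imp_flip_group[OF assms] unfolding fst_conv by blast
  show "fst \<Phi> \<in> flip_group"
    using *(2) graph_iso_farey_imp_mult[OF *(1)] unfolding *(3) by (metis flip_group.mult)
  show "\<Phi> = perm_to_auto (fst \<Phi>)"
  proof (rule perm_to_auto_eq[OF _ *(4)])
    show "\<Phi> = (fst \<Phi>, snd \<Phi>)" by simp
    show "snd \<Phi> (arrow farey x y) = arrow farey (fst \<Phi> x) (fst \<Phi> y)" for x y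
      unfolding *(3) using *(5) by simp
  qed
qed

lemma label_perm_conj:
  assumes l: "labeling farey l" and "bij \<sigma>" and S: "\<And>W. \<sigma> (W * S) = \<sigma> W * S"
  shows "label_perm (l \<circ> \<sigma> \<circ> Hilbert_Choice.inv l)"
proof -
  have bij: "bij l" using l by (simp add: labeling_def)
  have pair: "\<exists>k. {l x, l (x * S)} = {(k, Plus), (k, Minus)}" for x using l by (simp add: labeling_def)
  have "\<exists>k. (l \<circ> \<sigma> \<circ> Hilbert_Choice.inv l) ` {(m, Plus), (m, Minus)} = {(k, Plus), (k, Minus)}" for m
  proof -
    obtain x where x: "l x = (m, Plus)" using bij by (metis bij_pointE)
    obtain k where k: "{l x, l (x * S)} = {(k, Plus), (k, Minus)}" using pair by blast
    then have "l x \<in> {(k, Plus), (k, Minus)}" by (metis insertI1)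
    then have eq: "{l x, l (x * S)} = {(m, Plus), (m, Minus)}" using k x by simp
    then have "(l \<circ> \<sigma> \<circ> Hilbert_Choice.inv l) ` {(m, Plus), (m, Minus)} = {l (\<sigma> x), l (\<sigma> x * S)}"
      using bij by (simp add: bij_is_inj S flip: eq)
    then show ?thesis using pair[of "\<sigma> x"] by simp
  qed
  moreover have "bij (l \<circ> \<sigma> \<circ> Hilbert_Choice.inv l)"
    using bij \<open>bij \<sigma>\<close> by (intro bij_comp bij_imp_bij_inv)
  ultimately show ?thesis by (simp add: label_perm_def)
qed

text \<open>Any isomorphism back to the tree closes up a sequence of flips: conjugating
  \<open>\<sigma>\<close> by \<open>l\<close> gives a permutation of labels, as
  \<open>\<sigma>\<close> respects twins, and after this relabeling \<open>\<sigma>\<close>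
  preserves labels.\<close>

lemma induced_relabel_transport:
  assumes l: "labeling farey l" and "induced (farey, l) (G, l) \<Phi>" and \<sigma>: "graph_iso \<sigma> G farey"
    and G: "Edges G = UNIV" "\<And>x. twin G x = x * S"
  shows "induced (farey, l) (farey, l) (gcomp farey (iso_induced \<sigma> G) \<Phi>)"
proof -
  have S: "\<sigma> (W * S) = \<sigma> W * S" for W using \<sigma> G by (simp add: graph_iso_def)
  have bij: "bij \<sigma>" "bij l" using \<sigma> G l by (simp_all add: graph_iso_def labeling_def)
  define \<rho> where "\<rho> = l \<circ> \<sigma> \<circ> Hilbert_Choice.inv l"
  have "label_perm \<rho>" unfolding \<rho>_def using l bij(1) S by (rule label_perm_conj)
  with assms(2) have "induced (farey, l) (G, \<rho> \<circ> l) \<Phi>" by (rule induced.relabel)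
  moreover have "label_iso \<sigma> (G, \<rho> \<circ> l) (farey, l)"
    using \<sigma> bij by (simp add: label_iso_def graph_iso_def \<rho>_def bij_is_inj)
  ultimately show ?thesis using induced.transport by fastforce
qed

lemma iso_induced_simps:
  assumes "graph_iso \<sigma> G H" "simply_connected G" "x \<in> Edges G" "y \<in> Edges G"
  shows "fst (iso_induced \<sigma> G) x = \<sigma> x"
    "snd (iso_induced \<sigma> G) (arrow G x y) = arrow H (\<sigma> x) (\<sigma> y)"
proof -
  have "arrow G x y \<in> Arr G" using assms by (auto simp: Arr_eq_arrow)
  then show "fst (iso_induced \<sigma> G) x = \<sigma> x"
    "snd (iso_induced \<sigma> G) (arrow G x y) = arrow H (\<sigma> x) (\<sigma> y)"
    using assms iso_induced_arrow[of G \<sigma> H x y] by (simp_all add: iso_induced_def simply_connected_def)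
qed

text \<open>All prescribed values are forced: with one arrow between any two edges, it remains to
  see that on both sides of each equation there is a path and that the ends agree.\<close>

lemma flip_induced_exists:
  assumes G': "simply_connected (flip farey 1)"
  shows "flip_induced farey 1 (pair_map farey (flip farey 1) id)" (is "flip_induced _ _ ?\<Phi>")
proof -
  let ?G = "flip farey 1"
  let ?six = "{1, L, L * L, S, S * L, S * (L * L)}"
  note sc = simply_connected_farey
  have pclass: "snd ?\<Phi> (pclass farey x p) = pclass ?G x q"
    if "is_path farey x p y" "is_path ?G x q y" for x p q y
    using that by (simp add: pclass_eq_arrow[OF sc] pclass_eq_arrow[OF G'] snd_pair_map[OF sc])
  have nxt_other: "nxt ?G x = x * L" if "x \<notin> ?six" for x using that by (simp add: nxt_flip_farey)
  have nxt_six: "nxt ?G S = S * (L * L)" "nxt ?G (S * (L * L)) = L" "nxt ?G L = S"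
    "nxt ?G 1 = L * L" "nxt ?G (L * L) = S * L" "nxt ?G (S * L) = 1"
    using psl_six_distinct by (auto simp: nxt_flip_farey)
  have v2: "vert2 ?G x = vert2 farey x" for x by (simp add: vert2_def)
  have "vert3 farey 1 = {1, L, L * L}" "vert3 farey S = {S, S * L, S * (L * L)}" by (simp_all add: vert3_farey mult.assoc)
  have "vert3 ?G 1 = {1, L * L, S * L}" "vert3 ?G S = {S, S * (L * L), L}"
    by (simp_all add: vert3_def nxt_six)
  moreover have "vert3 ?G x \<in> Verts ?G" "vert2 ?G x \<in> Verts ?G" for x by (simp_all add: Verts_def)
  ultimately have vG: "{1, L * L, S * L} \<in> Verts ?G" "{S, S * (L * L), L} \<in> Verts ?G" "{S, 1} \<in> Verts ?G"
    using v2[of 1] by (metis, metis, metis insert_commute vert2_farey mult.left_neutral)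
  have vF: "{1, L, L * L} \<in> Verts farey" "{S, S * L, S * (L * L)} \<in> Verts farey" "{S, 1} \<in> Verts farey"
    using vert_in_Verts(2)[of 1] vert_in_Verts(2)[of S] vert_in_Verts(1)[of S]
    by (simp_all add: vert2_farey vert3_farey psl_simps)
  \<comment> \<open>Vertices of degree 2 are untouched, and a further vertex of degree 3 contains
    none of the six edges whose successor changes.\<close>
  have other: "t \<in> Verts ?G" if t: "t \<in> Verts farey" "t \<noteq> {1, L, L * L}" "t \<noteq> {S, S * L, S * (L * L)}" for t
  proof -
    obtain x where "t = vert2 farey x \<or> t = vert3 farey x" using t(1) by (auto simp: Verts_def)
    then show ?thesis
    proof
      assume "t = vert2 farey x"
      then show ?thesis using v2[of x] \<open>\<And>x. vert2 ?G x \<in> Verts ?G\<close> by metis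
    next
      assume *: "t = vert3 farey x"
      have "y \<notin> ?six" if "y \<in> t" for y
      proof
        assume "y \<in> ?six"
        moreover have "t = vert3 farey y"
          using that Verts_farey_cases[OF t(1), of y] * by auto
        ultimately have "t = vert3 farey 1 \<or> t = vert3 farey S"
          using vert3_farey_L[of 1] vert3_farey_L[of L] vert3_farey_L[of S] vert3_farey_L[of "S * L"]
          by (auto simp: mult.assoc)
        then show False using t(2,3) by (auto simp: vert3_farey mult.assoc)
      qed
      then have "vert3 ?G x = t" unfolding * by (simp add: vert3_def vert3_farey nxt_other)
      then show ?thesis using \<open>\<And>x. vert3 ?G x \<in> Verts ?G\<close> by metis
    qed
  qed
  have "groupoid_iso farey ?G ?\<Phi>" by (rule groupoid_iso_pair_map[OF sc G']) simp
  moreover have "fst ?\<Phi> x = x" for x by (simp add: pair_map_def)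
  moreover have "snd ?\<Phi> (pclass farey L [({1, L, L * L}, 1)]) = pclass ?G L [({S, S * (L * L), L}, S), ({S, 1}, 1)]"
    "snd ?\<Phi> (pclass farey (L * L) [({1, L, L * L}, 1)]) = pclass ?G (L * L) [({1, L * L, S * L}, 1)]"
    "snd ?\<Phi> (pclass farey (S * (L * L)) [({S, S * L, S * (L * L)}, S)]) = pclass ?G (S * (L * L)) [({S, S * (L * L), L}, S)]"
    "snd ?\<Phi> (pclass farey (S * L) [({S, S * L, S * (L * L)}, S)]) = pclass ?G (S * L) [({1, L * L, S * L}, 1), ({S, 1}, S)]"
    "snd ?\<Phi> (pclass farey 1 [({S, 1}, S)]) = pclass ?G 1 [({S, 1}, S)]"
    by (rule pclass; simp add: vF vG; fail)+
  moreover have "snd ?\<Phi> (pclass farey x [(t, y)]) = pclass ?G x [(t, y)]"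
    if "t \<in> Verts farey - {{S, 1}, {1, L, L * L}, {S, S * L, S * (L * L)}}" "x \<in> t" "y \<in> t" for t x y
    by (rule pclass[of _ _ y]) (use that other[of t] in simp_all)
  ultimately show ?thesis
    unfolding flip_induced_def using flip_trivial_farey[of 1]
    by (simp add: Let_def mult.assoc)
qed

lemma flip_group_induced:
  assumes l: "labeling farey l" and "\<pi> \<in> flip_group"
  shows "induced (farey, l) (farey, l) (perm_to_auto \<pi>)"
  using assms(2)
proof (induction rule: flip_group.induct)
  case id
  show ?case
    using induced.start[of "(farey, l)"] modular_farey l unfolding fst_conv snd_conv gid_farey by blast
next
  case (mult \<pi> W)
  have "induced (farey, l) (farey, l) (gcomp farey (iso_induced ((*) W) farey) (perm_to_auto \<pi>))"
    by (rule induced_relabel_transport[OF l mult.IH graph_iso_mult]) simp_all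
  moreover have "gcomp farey (iso_induced ((*) W) farey) (perm_to_auto \<pi>) = perm_to_auto ((*) W \<circ> \<pi>)"
    by (rule gcomp_perm_to_auto)
      (simp_all add: iso_induced_simps[OF graph_iso_mult simply_connected_farey] fun_eq_iff)
  ultimately show ?case by (simp only:)
next
  case (flip \<pi>)
  let ?G = "flip farey 1"
  have G: "simply_connected ?G"
    using graph_iso_flip_farey[OF graph_iso_mult, of 1 1] by (intro graph_iso_simply_connected[OF simply_connected_farey]) simp_all
  define \<Psi> where "\<Psi> = gcomp farey (iso_induced flip_map ?G) (gcomp farey (pair_map farey ?G id) (perm_to_auto \<pi>))"
  have "induced (farey, l) (?G, l) (gcomp farey (pair_map farey ?G id) (perm_to_auto \<pi>))"
    using induced.flip[OF flip.IH _ flip_induced_exists[OF G]] by simp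
  then have "induced (farey, l) (farey, l) \<Psi>"
    unfolding \<Psi>_def by (intro induced_relabel_transport[OF l] graph_iso_flip_map) simp_all
  moreover have "\<Psi> = perm_to_auto (flip_map \<circ> \<pi>)"
  proof (rule perm_to_auto_eq)
    show "\<Psi> = (flip_map \<circ> \<pi>, snd \<Psi>)"
      using iso_induced_simps(1)[OF graph_iso_flip_map G]
      by (auto simp: \<Psi>_def gcomp_def compose_def pair_map_def fun_eq_iff)
    show "snd \<Psi> \<in> extensional (Arr farey)" by (simp add: \<Psi>_def gcomp_def)
    fix x y
    have "arrow farey x y \<in> Arr farey" by (auto simp: Arr_eq_arrow[OF simply_connected_farey])
    then show "snd \<Psi> (arrow farey x y) = arrow farey ((flip_map \<circ> \<pi>) x) ((flip_map \<circ> \<pi>) y)"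
      using iso_induced_simps(2)[OF graph_iso_flip_map G]
      by (simp add: \<Psi>_def gcomp_def compose_eq snd_perm_to_auto snd_pair_map[OF simply_connected_farey])
  qed
  ultimately show ?case by (simp only:)
qed

subsection \<open>The three groups\<close>

text \<open>The twin relation is symmetric, so the unordered condition already gives equivariance
  under \<open>S\<close>.\<close>

lemma sym_pm_iff:
  "\<pi> \<in> sym_pm \<longleftrightarrow> bij \<pi> \<and> finite {W. \<pi> W \<noteq> W} \<and> (\<forall>W. \<pi> (W * S) = \<pi> W * S)"
proof -
  have "(\<exists>W'. {\<pi> W, \<pi> (W * S)} = {W', W' * S}) \<longleftrightarrow> \<pi> (W * S) = \<pi> W * S" if "bij \<pi>" for W
  proof
    assume "\<exists>W'. {\<pi> W, \<pi> (W * S)} = {W', W' * S}"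
    then obtain W' where "{\<pi> W, \<pi> (W * S)} = {W', W' * S}" by blast
    then consider "\<pi> W = W'" "\<pi> (W * S) = W' * S" | "\<pi> W = W' * S" "\<pi> (W * S) = W'"
      by (auto simp: doubleton_eq_iff)
    then show "\<pi> (W * S) = \<pi> W * S" by cases simp_all
  qed auto
  then show ?thesis unfolding sym_pm_def by auto
qed

lemma sym_pm_flip_group: "\<pi> \<in> sym_pm \<Longrightarrow> \<pi> \<in> flip_group"
  by (auto simp: sym_pm_iff intro: finite_twin_perm_in_flip_group)

lemma flip_group_sym_pm_iff: "\<pi> \<in> flip_group \<Longrightarrow> \<pi> \<in> sym_pm \<longleftrightarrow> finite {W. \<pi> W \<noteq> W}"
  by (auto simp: sym_pm_iff flip_group_bij flip_group_mult_S)

lemma sym_pm_id: "id \<in> sym_pm"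
  unfolding flip_group_sym_pm_iff[OF flip_group.id] by simp

lemma sym_pm_comp:
  assumes "\<pi> \<in> sym_pm" "\<tau> \<in> sym_pm"
  shows "\<pi> \<circ> \<tau> \<in> sym_pm"
proof -
  have "{W. (\<pi> \<circ> \<tau>) W \<noteq> W} \<subseteq> {W. \<pi> W \<noteq> W} \<union> {W. \<tau> W \<noteq> W}" by auto
  moreover have "finite \<dots>" using assms by (simp add: sym_pm_iff)
  ultimately have "finite {W. (\<pi> \<circ> \<tau>) W \<noteq> W}" by (rule finite_subset)
  then show ?thesis using assms sym_pm_flip_group flip_group_comp flip_group_sym_pm_iff by metis
qed

lemma inv_comp_bij: "bij \<pi> \<Longrightarrow> Hilbert_Choice.inv \<pi> \<circ> \<pi> = id"
  by (auto simp: fun_eq_iff bij_is_inj)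

lemma sym_pm_inv:
  assumes "\<pi> \<in> sym_pm"
  shows "Hilbert_Choice.inv \<pi> \<in> sym_pm"
proof -
  have bij: "bij \<pi>" using assms by (simp add: sym_pm_iff)
  have "{W. Hilbert_Choice.inv \<pi> W \<noteq> W} \<subseteq> {W. \<pi> W \<noteq> W}"
    using bij by (auto simp: bij_is_inj dest: arg_cong[of _ _ "Hilbert_Choice.inv \<pi>"])
  moreover have "finite \<dots>" using assms by (simp add: sym_pm_iff)
  ultimately have "finite {W. Hilbert_Choice.inv \<pi> W \<noteq> W}" by (rule finite_subset)
  then show ?thesis using assms sym_pm_flip_group flip_group_inv flip_group_sym_pm_iff by metis
qed

lemma Sym_pm_simps:
  "carrier Sym_pm = sym_pm" "\<one>\<^bsub>Sym_pm\<^esub> = id"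
  "\<pi> \<in> sym_pm \<Longrightarrow> \<tau> \<in> sym_pm \<Longrightarrow> \<pi> \<otimes>\<^bsub>Sym_pm\<^esub> \<tau> = \<pi> \<circ> \<tau>"
  by (auto simp: Sym_pm_def BijGroup_def Bij_def sym_pm_iff compose_def fun_eq_iff)

lemma group_perms:
  assumes "\<And>\<pi>. \<pi> \<in> H \<Longrightarrow> bij \<pi>" "id \<in> H" "\<And>\<pi> \<tau>. \<pi> \<in> H \<Longrightarrow> \<tau> \<in> H \<Longrightarrow> \<pi> \<circ> \<tau> \<in> H"
    "\<And>\<pi>. \<pi> \<in> H \<Longrightarrow> Hilbert_Choice.inv \<pi> \<in> H"
  shows "group \<lparr>carrier = H, mult = (\<circ>), one = id\<rparr>"
proof (rule groupI)
  let ?G = "\<lparr>carrier = H, mult = (\<circ>), one = id\<rparr>"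
  fix \<pi> assume "\<pi> \<in> carrier ?G"
  then have "\<pi> \<in> H" by simp
  then have "Hilbert_Choice.inv \<pi> \<in> carrier ?G" "Hilbert_Choice.inv \<pi> \<circ> \<pi> = \<one>\<^bsub>?G\<^esub>"
    using assms(4) inv_comp_bij[OF assms(1)] by simp_all
  then show "\<exists>\<tau>\<in>carrier ?G. \<tau> \<otimes>\<^bsub>?G\<^esub> \<pi> = \<one>\<^bsub>?G\<^esub>" unfolding monoid.simps by blast
qed (simp_all only: partial_object.simps monoid.simps assms(2,3) comp_assoc id_comp)

text \<open>Provides all three groups: \<open>Sym_pm\<close> and \<open>PMG l\<close> as images of
  groups of permutations, \<open>Aut_inf\<close> as the image of \<open>PMG l\<close>, so that no
  axiom is checked on arrows or germs.\<close>

lemma group_hom_image: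
  assumes "group G" "h \<in> hom G H" "h ` carrier G = carrier H" "h \<one>\<^bsub>G\<^esub> = \<one>\<^bsub>H\<^esub>"
  shows "group H"
  using group.hom_imp_img_group[OF assms(1,2)] assms(3,4) by simp

lemma group_Sym_pm: "group Sym_pm"
proof (rule group_hom_image[OF group_perms[of sym_pm], of id])
  show "id \<in> hom \<lparr>carrier = sym_pm, mult = (\<circ>), one = id\<rparr> Sym_pm"
    by (rule homI) (simp_all only: Sym_pm_simps partial_object.simps monoid.simps id_apply)
qed (simp_all only: Sym_pm_simps partial_object.simps monoid.simps sym_pm_id sym_pm_comp sym_pm_inv
    flip_group_bij[OF sym_pm_flip_group] image_id id_apply)

lemma carrier_PMG:
  assumes "labeling farey l"
  shows "carrier (PMG l) = perm_to_auto ` flip_group"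
proof (intro equalityI subsetI)
  fix \<Phi> assume "\<Phi> \<in> carrier (PMG l)"
  then have "induced (farey, l) (farey, l) \<Phi>" by (simp add: PMG_def isotropy_def)
  then show "\<Phi> \<in> perm_to_auto ` flip_group" using PMG_imp_flip_group by (intro image_eqI)
next
  fix \<Phi> assume "\<Phi> \<in> perm_to_auto ` flip_group"
  then show "\<Phi> \<in> carrier (PMG l)" using flip_group_induced[OF assms] by (auto simp: PMG_def isotropy_def)
qed

lemma PMG_simps:
  "\<one>\<^bsub>PMG l\<^esub> = perm_to_auto id"
  "perm_to_auto \<pi> \<otimes>\<^bsub>PMG l\<^esub> perm_to_auto \<tau> = perm_to_auto (\<pi> \<circ> \<tau>)"
  by (simp_all only: PMG_def isotropy_def monoid.simps partial_object.simps fst_conv gid_farey perm_to_auto_comp)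

lemma group_PMG:
  assumes l: "labeling farey l"
  shows "group (PMG l)"
proof (rule group_hom_image[OF group_perms[of flip_group], of perm_to_auto])
  show "perm_to_auto \<in> hom \<lparr>carrier = flip_group, mult = (\<circ>), one = id\<rparr> (PMG l)"
    by (rule homI) (simp_all only: carrier_PMG[OF l] PMG_simps partial_object.simps monoid.simps imageI)
qed (simp_all only: carrier_PMG[OF l] PMG_simps partial_object.simps monoid.simps
    flip_group.id flip_group_comp flip_group_inv flip_group_bij)

text \<open>Every finite set of edges lies in a finite subtree, which eliminates subtrees from the
  relation.\<close>

lemma germ_rel_iff:
  "(\<sigma>, \<tau>) \<in> germ_rel \<longleftrightarrow> \<sigma> \<in> flip_group \<and> \<tau> \<in> flip_group \<and> finite {W. \<sigma> W \<noteq> \<tau> W}"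
proof -
  have "(\<exists>T. finite_subtree farey T \<and> (\<forall>W. W \<notin> snd T \<longrightarrow> \<sigma> W = \<tau> W)) \<longleftrightarrow> finite {W. \<sigma> W \<noteq> \<tau> W}"
  proof
    assume "\<exists>T. finite_subtree farey T \<and> (\<forall>W. W \<notin> snd T \<longrightarrow> \<sigma> W = \<tau> W)"
    then obtain T where T: "finite_subtree farey T" "\<forall>W. W \<notin> snd T \<longrightarrow> \<sigma> W = \<tau> W" by blast
    show "finite {W. \<sigma> W \<noteq> \<tau> W}"
      by (rule finite_subset[OF _ finite_subtreeD(3)[OF T(1)]]) (use T(2) in blast)
  next
    assume "finite {W. \<sigma> W \<noteq> \<tau> W}"
    then obtain T where "finite_subtree farey T" "{W. \<sigma> W \<noteq> \<tau> W} \<subseteq> snd T" by (rule finite_subtree_exists)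
    then show "\<exists>T. finite_subtree farey T \<and> (\<forall>W. W \<notin> snd T \<longrightarrow> \<sigma> W = \<tau> W)" by blast
  qed
  then show ?thesis unfolding germ_rel_def near_aut_iff_flip_group by blast
qed

lemma equiv_germ_rel: "equiv flip_group germ_rel"
proof (rule equivI)
  show "germ_rel \<subseteq> flip_group \<times> flip_group" by (auto simp: germ_rel_iff)
  show "refl_on flip_group germ_rel" by (auto simp: refl_on_def germ_rel_iff)
  show "sym germ_rel" by (auto simp: sym_def germ_rel_iff eq_commute)
  show "trans germ_rel"
  proof (rule transI)
    fix \<sigma> \<tau> \<rho> assume "(\<sigma>, \<tau>) \<in> germ_rel" "(\<tau>, \<rho>) \<in> germ_rel"
    moreover from this have "finite ({W. \<sigma> W \<noteq> \<tau> W} \<union> {W. \<tau> W \<noteq> \<rho> W})" by (simp add: germ_rel_iff)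
    then have "finite {W. \<sigma> W \<noteq> \<rho> W}" by (rule rev_finite_subset) auto
    ultimately show "(\<sigma>, \<rho>) \<in> germ_rel" by (simp add: germ_rel_iff)
  qed
qed

text \<open>The composites differ at most where the inner maps differ or where \<open>\<tau>\<close>
  meets the finite set on which the outer maps differ; injectivity of \<open>\<tau>\<close> makes
  the latter finite.\<close>

lemma germ_rel_comp:
  assumes "(\<sigma>, \<sigma>') \<in> germ_rel" "(\<tau>, \<tau>') \<in> germ_rel"
  shows "(\<sigma> \<circ> \<tau>, \<sigma>' \<circ> \<tau>') \<in> germ_rel"
proof -
  have in_group: "\<sigma> \<in> flip_group" "\<tau> \<in> flip_group" "\<sigma>' \<in> flip_group" "\<tau>' \<in> flip_group"
    using assms by (simp_all add: germ_rel_iff)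
  have "{W. (\<sigma> \<circ> \<tau>) W \<noteq> (\<sigma>' \<circ> \<tau>') W} \<subseteq> {W. \<tau> W \<noteq> \<tau>' W} \<union> \<tau> -` {W. \<sigma> W \<noteq> \<sigma>' W}" by auto
  moreover have "finite \<dots>"
    using assms in_group by (intro finite_UnI finite_vimageI) (simp_all add: germ_rel_iff bij_is_inj flip_group_bij)
  ultimately have "finite {W. (\<sigma> \<circ> \<tau>) W \<noteq> (\<sigma>' \<circ> \<tau>') W}" by (rule finite_subset)
  then show ?thesis unfolding germ_rel_iff using in_group flip_group_comp by blast
qed

lemma germ_eq_iff: "\<sigma> \<in> flip_group \<Longrightarrow> \<tau> \<in> flip_group \<Longrightarrow> germ \<sigma> = germ \<tau> \<longleftrightarrow> (\<sigma>, \<tau>) \<in> germ_rel"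
  unfolding germ_def using eq_equiv_class_iff[OF equiv_germ_rel] by blast

lemma germ_self: "\<sigma> \<in> flip_group \<Longrightarrow> \<sigma> \<in> germ \<sigma>"
  unfolding germ_def using equiv_class_self[OF equiv_germ_rel] by blast

lemma Aut_inf_simps:
  "carrier Aut_inf = germ ` flip_group" "\<one>\<^bsub>Aut_inf\<^esub> = germ id"
  "\<sigma> \<in> flip_group \<Longrightarrow> \<tau> \<in> flip_group \<Longrightarrow> germ \<sigma> \<otimes>\<^bsub>Aut_inf\<^esub> germ \<tau> = germ (\<sigma> \<circ> \<tau>)"
proof -
  have "Collect near_aut = flip_group" using near_aut_iff_flip_group by blast
  then show "carrier Aut_inf = germ ` flip_group" by (auto simp: Aut_inf_def quotient_def germ_def)
  show "\<one>\<^bsub>Aut_inf\<^esub> = germ id" by (simp add: Aut_inf_def)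
  assume *: "\<sigma> \<in> flip_group" "\<tau> \<in> flip_group"
  have "germ (\<sigma>' \<circ> \<tau>') = germ (\<sigma> \<circ> \<tau>)" if "\<sigma>' \<in> germ \<sigma>" "\<tau>' \<in> germ \<tau>" for \<sigma>' \<tau>'
  proof -
    have rel: "(\<sigma>, \<sigma>') \<in> germ_rel" "(\<tau>, \<tau>') \<in> germ_rel" using that by (simp_all add: germ_def)
    then have "(\<sigma> \<circ> \<tau>, \<sigma>' \<circ> \<tau>') \<in> germ_rel" by (rule germ_rel_comp)
    then show ?thesis unfolding germ_def using equiv_class_eq[OF equiv_germ_rel] by blast
  qed
  then have "(\<Union>\<sigma>'\<in>germ \<sigma>. \<Union>\<tau>'\<in>germ \<tau>. germ (\<sigma>' \<circ> \<tau>')) = germ (\<sigma> \<circ> \<tau>)"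
    using germ_self[OF *(1)] germ_self[OF *(2)] by blast
  then show "germ \<sigma> \<otimes>\<^bsub>Aut_inf\<^esub> germ \<tau> = germ (\<sigma> \<circ> \<tau>)"
    unfolding Aut_inf_def monoid.simps .
qed

lemma germification_perm_to_auto: "germification (perm_to_auto \<pi>) = germ \<pi>"
  by (simp add: germification_def)

text \<open>Trivial germ means finite support, and elements of \<open>flip_group\<close> respect
  twins in any case.\<close>

lemma germ_eq_one_iff: "\<pi> \<in> flip_group \<Longrightarrow> germ \<pi> = germ id \<longleftrightarrow> \<pi> \<in> sym_pm"
  unfolding germ_eq_iff[OF _ flip_group.id] germ_rel_iff flip_group_sym_pm_iff
  using flip_group.id by simp

lemma germification_epi:
  assumes "labeling farey l"
  shows "germification \<in> epi (PMG l) Aut_inf"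
proof -
  note PMG = carrier_PMG[OF assms]
  have "germification \<in> hom (PMG l) Aut_inf"
  proof (rule homI)
    fix \<Phi> assume "\<Phi> \<in> carrier (PMG l)"
    then show "germification \<Phi> \<in> carrier Aut_inf"
      unfolding PMG Aut_inf_simps using germification_perm_to_auto by fastforce
  next
    fix \<Phi> \<Psi> assume "\<Phi> \<in> carrier (PMG l)" "\<Psi> \<in> carrier (PMG l)"
    then obtain \<pi> \<tau> where "\<Phi> = perm_to_auto \<pi>" "\<Psi> = perm_to_auto \<tau>" "\<pi> \<in> flip_group" "\<tau> \<in> flip_group"
      unfolding PMG by blast
    then show "germification (\<Phi> \<otimes>\<^bsub>PMG l\<^esub> \<Psi>) = germification \<Phi> \<otimes>\<^bsub>Aut_inf\<^esub> germification \<Psi>"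
      by (simp only: PMG_simps germification_perm_to_auto Aut_inf_simps)
  qed
  moreover have "germification ` carrier (PMG l) = carrier Aut_inf"
    unfolding PMG Aut_inf_simps by (simp only: image_image germification_perm_to_auto)
  ultimately show ?thesis by (simp add: epi_def)
qed

lemma group_Aut_inf:
  assumes "labeling farey l"
  shows "group Aut_inf"
proof (rule group_hom_image[OF group_PMG[OF assms]])
  show "germification \<in> hom (PMG l) Aut_inf" "germification ` carrier (PMG l) = carrier Aut_inf"
    using germification_epi[OF assms] by (simp_all add: epi_def)
  show "germification \<one>\<^bsub>PMG l\<^esub> = \<one>\<^bsub>Aut_inf\<^esub>"
    by (simp only: PMG_simps Aut_inf_simps germification_perm_to_auto)
qed

theorem theorem5p5:
  fixes l :: "psl2z \<Rightarrow> label"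
  assumes "labeling farey l"
  shows "group Sym_pm \<and> group (PMG l) \<and> group Aut_inf \<and>
         perm_to_auto \<in> mon Sym_pm (PMG l) \<and>
         germification \<in> epi (PMG l) Aut_inf \<and>
         perm_to_auto ` carrier Sym_pm = kernel (PMG l) Aut_inf germification"
proof (intro conjI)
  note PMG = carrier_PMG[OF assms]
  show "group Sym_pm" "group (PMG l)" "group Aut_inf"
    by (rule group_Sym_pm group_PMG[OF assms] group_Aut_inf[OF assms])+
  have "perm_to_auto \<in> hom Sym_pm (PMG l)"
  proof (rule homI)
    fix \<pi> assume "\<pi> \<in> carrier Sym_pm"
    then show "perm_to_auto \<pi> \<in> carrier (PMG l)"
      unfolding PMG Sym_pm_simps using sym_pm_flip_group by blast
  next
    fix \<pi> \<tau> assume "\<pi> \<in> carrier Sym_pm" "\<tau> \<in> carrier Sym_pm"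
    then show "perm_to_auto (\<pi> \<otimes>\<^bsub>Sym_pm\<^esub> \<tau>) = perm_to_auto \<pi> \<otimes>\<^bsub>PMG l\<^esub> perm_to_auto \<tau>"
      by (simp only: Sym_pm_simps PMG_simps)
  qed
  moreover have "inj_on perm_to_auto (carrier Sym_pm)"
    by (rule inj_on_inverseI[of _ fst]) (rule fst_perm_to_auto)
  ultimately show "perm_to_auto \<in> mon Sym_pm (PMG l)" by (simp add: mon_def)
  show "germification \<in> epi (PMG l) Aut_inf" by (rule germification_epi[OF assms])
  \<comment> \<open>The substantial half, that all of \<open>sym_pm\<close> is produced by flips,
    rests on the pentagon relation.\<close>
  have "perm_to_auto ` sym_pm = {\<Phi> \<in> perm_to_auto ` flip_group. germification \<Phi> = germ id}"
    using sym_pm_flip_group germ_eq_one_iff germification_perm_to_auto by fastforce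
  then show "perm_to_auto ` carrier Sym_pm = kernel (PMG l) Aut_inf germification"
    unfolding kernel_def PMG Sym_pm_simps Aut_inf_simps by simp
qed

end
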